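(* Let $\mathbf{X}=\{X_i, i\geq 1\}$ be a collection of centered independent random variables with unit variance. Assume, moreover, that $\beta:=\sup_{i}E(X_i^4)<\infty$ and let $\alpha:=\max\{3;\beta\}$. Fix an even integer $d\geq 2$ and, for $N\geq 1$, let $f: [N]^{d}\rightarrow\mathbb{R}$ be symmetric and vanishing on diagonals. Let $Q_d(\mathbf{X})=Q_{d}(N,f,\mathbf{X})$ be the associated homogeneous sum and assume that $E[Q_d(\mathbf{X})^2]=2\nu$ for some integer $\nu\geq 1$. Let $\varphi:\mathbb{R}\to\mathbb{R}$ be a thrice differentiable function such that $\|\varphi\|_\infty\leq 1$, $\|\varphi'\|_\infty\leq 1$ and $\|\varphi'''\|_\infty\leq B$. Then, for $Z_\nu\sim\chi^2(\nu)$ (centered chi-square), $$\begin{aligned}|E[\varphi(Q_d(\mathbf{X}))]-E[\varphi(Z_\nu)]|\leq{}& B(30\beta)^d d!\sqrt{\max_{1\leq i\leq N}\operatorname{Inf}_i(f)}\\&+\max\left\{\sqrt{\frac{2\pi}{\nu}},\frac1\nu+\frac2{\nu^2}\right\}\sqrt{\frac{d-1}{3d}}\Bigl[\sqrt{|E[Q_d(\mathbf{X})^4]-12E[Q_d(\mathbf{X})^3]-12\nu^2+48\nu|}\\&\quad+4\sqrt{d}\,d!\Bigl(\sqrt2\times144^{d-1/2}\alpha^{d/2}+\sqrt{\nu}\,(2\sqrt2)^{3(2d-1)/2}\alpha^{3d/2}\Bigr)\Bigl(\max_{1\leq i\leq N}\operatorname{Inf}_i(f)\Bigr)^{1/4}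\Bigr].\end{aligned}$$
   Context: Notation: $[N]=\{1,\ldots,N\}$. A symmetric function $f:[N]^d\to\mathbb{R}$ vanishes on diagonals if $f(i_1,\ldots,i_d)=0$ whenever $i_k=i_j$ for some $k\neq j$. The homogeneous sum is $$Q_d(N,f,\mathbf{X})=\sum_{1\leq i_1,\ldots,i_d\leq N} f(i_1,\ldots,i_d)X_{i_1}\cdots X_{i_d},$$ and the influence of the variable $i$ is $$\operatorname{Inf}_i(f)=\frac1{(d-1)!}\sum_{1\leq i_2,\ldots,i_d\leq N}f(i,i_2,\ldots,i_d)^2.$$ $Z_\nu\sim\chi^2(\nu)$ means that $Z_\nu$ has the law of $\sum_{i=1}^\nu(g_i^2-1)$ with $g_1,\ldots,g_\nu$ i.i.d. $\mathscr{N}(0,1)$. $\|\cdot\|_\infty$ is the supremum norm. *)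

theory Defs
  imports "HOL-Probability.Probability" "HOL-Combinatorics.Combinatorics"
begin

text \<open>The index set \<open>[N]\<^sup>d\<close>: a tuple \<open>(i\<^sub>1, \<dots>, i\<^sub>d)\<close> is encoded as a list of length \<open>d\<close>. Functions on
  \<open>[N]\<^sup>d\<close> are total functions on lists; their values outside this set are never used.\<close>

definition index_tuples :: "nat \<Rightarrow> nat \<Rightarrow> nat list set" where
  "index_tuples N d = {is. length is = d \<and> set is \<subseteq> {1..N}}"

definition symmetric_kernel :: "nat \<Rightarrow> nat \<Rightarrow> (nat list \<Rightarrow> real) \<Rightarrow> bool" where
  "symmetric_kernel N d f \<longleftrightarrow>
     (\<forall>is \<in> index_tuples N d. \<forall>p. p permutes {..<d} \<longrightarrow> f (permute_list p is) = f is)"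

definition vanishes_on_diagonals :: "nat \<Rightarrow> nat \<Rightarrow> (nat list \<Rightarrow> real) \<Rightarrow> bool" where
  "vanishes_on_diagonals N d f \<longleftrightarrow>
     (\<forall>is \<in> index_tuples N d. (\<exists>j<d. \<exists>k<d. j \<noteq> k \<and> is ! j = is ! k) \<longrightarrow> f is = 0)"

definition homogeneous_sum ::
  "nat \<Rightarrow> nat \<Rightarrow> (nat list \<Rightarrow> real) \<Rightarrow> (nat \<Rightarrow> 'a \<Rightarrow> real) \<Rightarrow> 'a \<Rightarrow> real" where
  "homogeneous_sum d N f X \<omega> = (\<Sum>is \<in> index_tuples N d. f is * (\<Prod>i\<leftarrow>is. X i \<omega>))"

definition influence :: "nat \<Rightarrow> nat \<Rightarrow> (nat list \<Rightarrow> real) \<Rightarrow> nat \<Rightarrow> real" where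
  "influence d N f i = 1 / fact (d - 1) * (\<Sum>is \<in> index_tuples N (d - 1). (f (i # is))\<^sup>2)"

definition max_influence :: "nat \<Rightarrow> nat \<Rightarrow> (nat list \<Rightarrow> real) \<Rightarrow> real" where
  "max_influence d N f = Max (influence d N f ` {1..N})"

text \<open>The law of \<open>\<Sum>\<^sub>i (g\<^sub>i\<^sup>2 - 1)\<close> for i.i.d. standard Gaussian \<open>g\<^sub>1, \<dots>, g\<^sub>\<nu>\<close>, which are realized as the
  coordinates on the product space.\<close>

definition centered_chi_square :: "nat \<Rightarrow> real measure" where
  "centered_chi_square \<nu> =
     distr (\<Pi>\<^sub>M i \<in> {1..\<nu>}. density lborel std_normal_density) borel (\<lambda>g. \<Sum>i = 1..\<nu>. ((g i)\<^sup>2 - 1))"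

end

theory Submission
  imports Defs
begin

text \<open>
  Why the bound holds. Single out one variable in the homogeneous sum, \<open>Q = U\<^sub>i + X\<^sub>i V\<^sub>i\<close>, where \<open>U\<^sub>i\<close> and
  \<open>V\<^sub>i\<close> do not involve \<open>X\<^sub>i\<close>. Then \<open>E V\<^sub>i\<^sup>2 = d!\<^sup>2 Inf\<^sub>i(f)\<close>, so every \<open>V\<^sub>i\<close> is small in \<open>L\<^sup>2\<close> when
  the influences are small, while \<open>\<Sum>\<^sub>i E V\<^sub>i\<^sup>2 = 2 d \<nu>\<close>. The proof works on the product space of the
  \<open>X\<^sub>i\<close> itself, with the quadratic form \<open>\<Gamma> = \<Sum>\<^sub>i (1 + X\<^sub>i\<^sup>2) / 2 * V\<^sub>i\<^sup>2\<close>, the carre du champ of \<open>Q\<close> for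
  the dynamics that resamples one coordinate at a time.

  Stein's method. Let \<open>F\<close> solve \<open>2 (x + \<nu>) F'(x) - x F(x) = \<phi>(x) - E \<phi>(Z)\<close>. The solution is an explicit
  integral (\<open>laguerre_inverse\<close>), its derivative is given by the same kind of integral with \<open>\<nu> + 2\<close>
  degrees of freedom, and comparison with explicit supersolutions yields \<open>|F'| \<le> K\<close>, with \<open>K\<close> the
  maximum in the theorem, and \<open>\<nu> |F''| \<le> 8 + 2 B\<close> (\<open>chi_square_stein_solution\<close>). Expanding
  \<open>d E[Q F(Q)] = \<Sum>\<^sub>i E[X\<^sub>i V\<^sub>i F(U\<^sub>i + X\<^sub>i V\<^sub>i)]\<close> in \<open>X\<^sub>i\<close> gives \<open>E[F'(Q) \<Gamma>]\<close> up to
  \<open>|F''| \<Sum>\<^sub>i E |V\<^sub>i|\<^sup>3\<close>. Hence \<open>|E \<phi>(Q) - E \<phi>(Z)|\<close> is at most \<open>K \<surd>(E D\<^sup>2)\<close> plus that error, where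
  \<open>D = \<Gamma>/d - 2 Q - 2 \<nu>\<close> is the Stein discrepancy (\<open>stein_bound\<close>).

  The fourth moment. Split \<open>Q\<^sup>2\<close> into orthogonal components, one for each set \<open>S\<close> of variables.
  Passing from \<open>Q\<^sup>2\<close> to \<open>\<Gamma>/d\<close> multiplies the component \<open>S\<close> by \<open>t\<^sub>S = 1 - |S| / (2 d)\<close>, so \<open>D\<close> arises in the
  same way from \<open>W = Q\<^sup>2 - 4 Q - 2 \<nu>\<close>. No component of \<open>W\<close> has \<open>S\<close> empty or \<open>|S| > 2 d\<close>, and
  \<open>0 \<le> t\<^sub>S \<le> (d - 1) / d\<close> for \<open>2 \<le> |S| \<le> 2 d\<close>; so \<open>E D\<^sup>2 \<le> (d - 1) / d * E[W D]\<close> apart from the components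
  \<open>(X\<^sub>i\<^sup>2 - 1) E V\<^sub>i\<^sup>2\<close> of the one-point sets. Integration by parts evaluates \<open>3 E[W D]\<close> as
  \<open>E Q\<^sup>4 - 12 E Q\<^sup>3 - 12 \<nu>\<^sup>2 + 48 \<nu>\<close> plus a multiple of \<open>\<Sum>\<^sub>i E V\<^sub>i\<^sup>4\<close>
  (\<open>discrepancy_fourth_moment_bound\<close>).

  Hypercontractivity turns \<open>E V\<^sub>i\<^sup>4\<close> and \<open>E |V\<^sub>i|\<^sup>3\<close> into powers of \<open>E V\<^sub>i\<^sup>2\<close>. With \<open>\<tau>\<close> the maximal
  influence, the error in \<open>E D\<^sup>2\<close> is at most \<open>C \<nu> \<tau>\<close>, where \<open>C\<close> depends on \<open>d\<close> and \<open>\<beta>\<close>; the factor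
  \<open>K\<close>, of order \<open>1/\<surd>\<nu>\<close> for large \<open>\<nu>\<close>, compensates the \<open>\<nu>\<close> under the root, and the factor \<open>\<nu>\<close> in \<open>|F''| \<Sum>\<^sub>i E |V\<^sub>i|\<^sup>3\<close> is compensated by the bound on \<open>\<nu> |F''|\<close>. It
  remains to compare constants if \<open>\<tau> \<le> 1\<close>; if \<open>\<tau> \<ge> 1\<close> the right-hand side exceeds \<open>2\<close>, which bounds the
  left-hand side because \<open>|\<phi>| \<le> 1\<close>.
\<close>

section \<open>An integral operator solving the Stein equation of the chi-square law\<close>

text \<open>In the variable \<open>y = x + \<nu>\<close> the Stein operator of the chi-square law with \<open>n\<close> degrees of freedom is
  \<open>g \<mapsto> 2 y g' + (n - y) g\<close>, a Laguerre operator. Solving by an integrating factor gives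
  \<open>g(y) = \<integral>\<^sub>0\<^sup>y s\<^bsup>n/2-1\<^esup> e\<^bsup>-s/2\<^esup> r(s) ds / (2 y\<^bsup>n/2\<^esup> e\<^bsup>-y/2\<^esup>)\<close>; the substitution \<open>s = y v\<^sup>2\<close> removes the singularities
  at \<open>0\<close>, and the resulting formula makes sense for every real \<open>y\<close>.\<close>

definition laguerre_inverse :: "nat \<Rightarrow> (real \<Rightarrow> real) \<Rightarrow> real \<Rightarrow> real" where
  "laguerre_inverse n r y = integral {0..1} (\<lambda>v. v ^ (n - 1) * exp (y * (1 - v\<^sup>2) / 2) * r (y * v\<^sup>2))"

lemma has_derivative_imp_continuous_on:
  fixes g :: "real \<Rightarrow> real"
  assumes "\<And>x. (g has_real_derivative g' x) (at x)"
  shows "continuous_on S g"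
  using assms by (meson DERIV_isCont continuous_at_imp_continuous_on)

lemma continuous_on_UNIV_compose:
  fixes g :: "real \<Rightarrow> real"
  assumes "continuous_on UNIV g" "continuous_on S f"
  shows "continuous_on S (\<lambda>x. g (f x))"
  by (rule continuous_on_compose2[OF assms]) simp

text \<open>The integrand is the \<open>v\<close>-derivative of \<open>v\<^sup>n e\<^bsup>y(1-v\<^sup>2)/2\<^esup> g(y v\<^sup>2)\<close>. In other words, the integral operator is
  a left inverse of the Laguerre operator.\<close>

lemma laguerre_inverse_weighted_integral:
  assumes n: "n \<ge> 1"
    and g: "\<And>x. (g has_real_derivative g' x) (at x)" and g': "continuous_on UNIV g'"
  shows "((\<lambda>v. v ^ (n - 1) * exp (y * (1 - v\<^sup>2) / 2) *
            (2 * (y * v\<^sup>2) * g' (y * v\<^sup>2) + (real n - y * v\<^sup>2) * g (y * v\<^sup>2))) has_integral g y) {0..1}"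
proof -
  let ?\<Phi> = "\<lambda>v. v ^ n * exp (y * (1 - v\<^sup>2) / 2) * g (y * v\<^sup>2)"
  obtain k where k: "n = Suc k" using n by (cases n) auto
  have "(?\<Phi> has_real_derivative v ^ (n - 1) * exp (y * (1 - v\<^sup>2) / 2) *
            (2 * (y * v\<^sup>2) * g' (y * v\<^sup>2) + (real n - y * v\<^sup>2) * g (y * v\<^sup>2))) (at v)" for v
    apply (rule derivative_eq_intros DERIV_chain2[OF g] refl | simp)+
    apply (simp add: k field_simps power2_eq_square power_Suc)
    done
  then have "((\<lambda>v. v ^ (n - 1) * exp (y * (1 - v\<^sup>2) / 2) *
            (2 * (y * v\<^sup>2) * g' (y * v\<^sup>2) + (real n - y * v\<^sup>2) * g (y * v\<^sup>2))) has_integral ?\<Phi> 1 - ?\<Phi> 0) {0..1}"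
    by (intro fundamental_theorem_of_calculus)
       (auto simp: has_real_derivative_iff_has_vector_derivative[symmetric] intro: DERIV_subset)
  then show ?thesis using n by (simp add: power_0_left)
qed

lemma laguerre_inverse_DERIV_aux:
  assumes r: "\<And>x. (r has_real_derivative r' x) (at x)" and r': "continuous_on UNIV r'"
  shows "(laguerre_inverse n r has_real_derivative
     integral {0..1} (\<lambda>v. v ^ (n - 1) * exp (y * (1 - v\<^sup>2) / 2) *
        ((1 - v\<^sup>2) / 2 * r (y * v\<^sup>2) + v\<^sup>2 * r' (y * v\<^sup>2)))) (at y)"
proof -
  have rc: "continuous_on UNIV r" using r by (rule has_derivative_imp_continuous_on)
  have eq: "laguerre_inverse n r = (\<lambda>y. integral (cbox 0 1) (\<lambda>v. v ^ (n - 1) * exp (y * (1 - v\<^sup>2) / 2) * r (y * v\<^sup>2)))"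
    by (simp add: laguerre_inverse_def fun_eq_iff)
  have "((\<lambda>y. integral (cbox 0 1) (\<lambda>v. v ^ (n - 1) * exp (y * (1 - v\<^sup>2) / 2) * r (y * v\<^sup>2)))
      has_field_derivative integral (cbox 0 1) (\<lambda>v. v ^ (n - 1) * exp (y * (1 - v\<^sup>2) / 2) *
        ((1 - v\<^sup>2) / 2 * r (y * v\<^sup>2) + v\<^sup>2 * r' (y * v\<^sup>2)))) (at y within UNIV)"
  proof (rule leibniz_rule_field_derivative[where fx="\<lambda>y v. v ^ (n - 1) * exp (y * (1 - v\<^sup>2) / 2) *
        ((1 - v\<^sup>2) / 2 * r (y * v\<^sup>2) + v\<^sup>2 * r' (y * v\<^sup>2))"])
    fix x t :: real
    show "((\<lambda>y. t ^ (n - 1) * exp (y * (1 - t\<^sup>2) / 2) * r (y * t\<^sup>2)) has_field_derivative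
        t ^ (n - 1) * exp (x * (1 - t\<^sup>2) / 2) * ((1 - t\<^sup>2) / 2 * r (x * t\<^sup>2) + t\<^sup>2 * r' (x * t\<^sup>2)))
        (at x within UNIV)"
      apply (rule derivative_eq_intros DERIV_chain2[OF r] refl | simp)+
      apply (simp add: field_simps)
      done
  next
    fix x :: real
    show "(\<lambda>v. v ^ (n - 1) * exp (x * (1 - v\<^sup>2) / 2) * r (x * v\<^sup>2)) integrable_on cbox 0 1"
      by (intro integrable_continuous continuous_intros continuous_on_UNIV_compose[OF rc]) auto
  next
    show "continuous_on (UNIV \<times> cbox 0 1) (\<lambda>(y, v). v ^ (n - 1) * exp (y * (1 - v\<^sup>2) / 2) *
        ((1 - v\<^sup>2) / 2 * r (y * v\<^sup>2) + v\<^sup>2 * r' (y * v\<^sup>2)))"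
      unfolding case_prod_beta
      by (intro continuous_intros continuous_on_UNIV_compose[OF rc] continuous_on_UNIV_compose[OF r']) auto
  qed auto
  then show ?thesis by (simp add: eq)
qed

lemma laguerre_inverse_has_integral:
  assumes "continuous_on UNIV r"
  shows "((\<lambda>v. v ^ (n - 1) * exp (y * (1 - v\<^sup>2) / 2) * r (y * v\<^sup>2)) has_integral laguerre_inverse n r y) {0..1}"
  unfolding laguerre_inverse_def
  by (intro integrable_integral integrable_continuous_real continuous_intros continuous_on_UNIV_compose[OF assms]) auto

text \<open>Differentiating \<open>2 y g' + (n - y) g = r\<close> shows that \<open>g'\<close> solves the equation with \<open>n + 2\<close> in place of \<open>n\<close> and
  right-hand side \<open>r' + g\<close>. The integral form of this statement requires only one derivative of \<open>r\<close>: the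
  derivative under the integral and the claimed formula differ by the integral of an exact derivative.\<close>

lemma laguerre_inverse_solves_and_DERIV:
  assumes n: "n \<ge> 1"
    and r: "\<And>x. (r has_real_derivative r' x) (at x)" and r': "continuous_on UNIV r'"
  shows laguerre_inverse_DERIV:
      "(laguerre_inverse n r has_real_derivative laguerre_inverse (n + 2) (\<lambda>x. r' x + laguerre_inverse n r x) y) (at y)"
    and laguerre_inverse_ode:
      "2 * y * laguerre_inverse (n + 2) (\<lambda>x. r' x + laguerre_inverse n r x) y
         + (real n - y) * laguerre_inverse n r y = r y"
proof -
  obtain k where k: "n = Suc k" using n by (cases n) auto
  define g where "g = laguerre_inverse n r"
  define w where "w = (\<lambda>y v::real. v ^ (n - 1) * exp (y * (1 - v\<^sup>2) / 2))"
  have rc: "continuous_on UNIV r" using r by (rule has_derivative_imp_continuous_on)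
  define D where "D = (\<lambda>y. integral {0..1} (\<lambda>v. w y v * ((1 - v\<^sup>2) / 2 * r (y * v\<^sup>2) + v\<^sup>2 * r' (y * v\<^sup>2))))"
  have gD: "(g has_real_derivative D y) (at y)" for y
    unfolding g_def D_def w_def by (rule laguerre_inverse_DERIV_aux[OF r r'])
  have gc: "continuous_on UNIV g" using gD by (rule has_derivative_imp_continuous_on)
  have Dint: "((\<lambda>v. w y v * ((1 - v\<^sup>2) / 2 * r (y * v\<^sup>2) + v\<^sup>2 * r' (y * v\<^sup>2))) has_integral D y) {0..1}" for y
    unfolding D_def w_def
    by (intro integrable_integral integrable_continuous_real continuous_intros
        continuous_on_UNIV_compose[OF rc] continuous_on_UNIV_compose[OF r']) auto
  have gint: "((\<lambda>v. w y v * r (y * v\<^sup>2)) has_integral g y) {0..1}" for y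
    unfolding g_def w_def by (rule laguerre_inverse_has_integral[OF rc])
  have ode: "2 * y * D y + (real n - y) * g y = r y" for y
  proof (rule has_integral_unique)
    show "((\<lambda>v. 2 * y * (w y v * ((1 - v\<^sup>2) / 2 * r (y * v\<^sup>2) + v\<^sup>2 * r' (y * v\<^sup>2)))
        + (real n - y) * (w y v * r (y * v\<^sup>2))) has_integral 2 * y * D y + (real n - y) * g y) {0..1}"
      by (intro has_integral_add has_integral_mult_right Dint gint)
    have "(\<lambda>v. 2 * y * (w y v * ((1 - v\<^sup>2) / 2 * r (y * v\<^sup>2) + v\<^sup>2 * r' (y * v\<^sup>2)))
        + (real n - y) * (w y v * r (y * v\<^sup>2))) = (\<lambda>v. v ^ (n - 1) * exp (y * (1 - v\<^sup>2) / 2) *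
            (2 * (y * v\<^sup>2) * r' (y * v\<^sup>2) + (real n - y * v\<^sup>2) * r (y * v\<^sup>2)))"
      unfolding w_def by (rule ext) (simp add: field_simps)
    with laguerre_inverse_weighted_integral[OF n r r', of y]
    show "((\<lambda>v. 2 * y * (w y v * ((1 - v\<^sup>2) / 2 * r (y * v\<^sup>2) + v\<^sup>2 * r' (y * v\<^sup>2)))
        + (real n - y) * (w y v * r (y * v\<^sup>2))) has_integral r y) {0..1}" by simp
  qed
  \<comment> \<open>The primitive carries the factor 1 - v^2, so it vanishes at both ends of the interval.\<close>
  have ibp: "((\<lambda>v. (1 - v\<^sup>2) / 2 * w y v * r (y * v\<^sup>2) - v\<^sup>2 * w y v * g (y * v\<^sup>2)) has_integral 0) {0..1}" for y
  proof -
    let ?\<Phi> = "\<lambda>v. v ^ n * (1 - v\<^sup>2) / 2 * exp (y * (1 - v\<^sup>2) / 2) * g (y * v\<^sup>2)"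
    have "(?\<Phi> has_real_derivative ((1 - v\<^sup>2) / 2 * w y v * r (y * v\<^sup>2) - v\<^sup>2 * w y v * g (y * v\<^sup>2))) (at v)" for v
      unfolding ode[symmetric, of "y * v\<^sup>2"]
      apply (rule derivative_eq_intros DERIV_chain2[OF gD] refl | simp)+
      apply (simp add: k w_def)
      apply (simp add: field_simps power2_eq_square)
      done
    then have "((\<lambda>v. (1 - v\<^sup>2) / 2 * w y v * r (y * v\<^sup>2) - v\<^sup>2 * w y v * g (y * v\<^sup>2)) has_integral ?\<Phi> 1 - ?\<Phi> 0) {0..1}"
      by (intro fundamental_theorem_of_calculus)
       (auto simp: has_real_derivative_iff_has_vector_derivative[symmetric] intro: DERIV_subset)
    then show ?thesis using n by (simp add: power_0_left)
  qed
  have D_eq: "D y = laguerre_inverse (n + 2) (\<lambda>x. r' x + g x) y" for y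
  proof -
    have "((\<lambda>v. w y v * ((1 - v\<^sup>2) / 2 * r (y * v\<^sup>2) + v\<^sup>2 * r' (y * v\<^sup>2))
        - ((1 - v\<^sup>2) / 2 * w y v * r (y * v\<^sup>2) - v\<^sup>2 * w y v * g (y * v\<^sup>2))) has_integral D y - 0) {0..1}"
      by (intro has_integral_diff Dint ibp)
    also have "(\<lambda>v. w y v * ((1 - v\<^sup>2) / 2 * r (y * v\<^sup>2) + v\<^sup>2 * r' (y * v\<^sup>2))
        - ((1 - v\<^sup>2) / 2 * w y v * r (y * v\<^sup>2) - v\<^sup>2 * w y v * g (y * v\<^sup>2)))
      = (\<lambda>v. v ^ (n + 2 - 1) * exp (y * (1 - v\<^sup>2) / 2) * (r' (y * v\<^sup>2) + g (y * v\<^sup>2)))"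
      unfolding w_def by (rule ext) (simp add: k algebra_simps power2_eq_square)
    finally have "((\<lambda>v. v ^ (n + 2 - 1) * exp (y * (1 - v\<^sup>2) / 2) * (r' (y * v\<^sup>2) + g (y * v\<^sup>2))) has_integral D y) {0..1}"
      by simp
    then show ?thesis unfolding laguerre_inverse_def by (simp add: integral_unique)
  qed
  show "(laguerre_inverse n r has_real_derivative laguerre_inverse (n + 2) (\<lambda>x. r' x + laguerre_inverse n r x) y) (at y)"
    using gD[of y] unfolding D_eq g_def .
  show "2 * y * laguerre_inverse (n + 2) (\<lambda>x. r' x + laguerre_inverse n r x) y
         + (real n - y) * laguerre_inverse n r y = r y"
    using ode[of y] unfolding D_eq g_def .
qed

lemma laguerre_inverse_abs_le_nonpos:
  assumes n: "n \<ge> 1" and y: "y \<le> 0" and rc: "continuous_on UNIV r"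
    and R: "\<And>x. y \<le> x \<Longrightarrow> x \<le> 0 \<Longrightarrow> \<bar>r x\<bar> \<le> R"
  shows "\<bar>laguerre_inverse n r y\<bar> \<le> R / n"
proof -
  obtain k where k: "n = Suc k" using n by (cases n) auto
  have R0: "0 \<le> R" using R[of 0] y by (smt (verit))
  have "((\<lambda>v. v ^ n * (R / n)) has_real_derivative v ^ (n - 1) * R) (at v)" for v
    using DERIV_cmult_right[OF DERIV_pow[of n v UNIV], of "R / n"] n by (simp add: field_simps)
  then have "((\<lambda>v. v ^ (n - 1) * R) has_integral (1 ^ n * (R / n) - 0 ^ n * (R / n))) {0..1::real}"
    by (intro fundamental_theorem_of_calculus)
      (auto simp: has_real_derivative_iff_has_vector_derivative[symmetric] intro: DERIV_subset)
  then have I: "((\<lambda>v. v ^ (n - 1) * R) has_integral R / n) {0..1::real}"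
    using n by (simp add: power_0_left)
  have "norm (laguerre_inverse n r y) \<le> integral {0..1} (\<lambda>v. v ^ (n - 1) * R)"
    unfolding laguerre_inverse_def
  proof (rule integral_norm_bound_integral)
    show "(\<lambda>v. v ^ (n - 1) * exp (y * (1 - v\<^sup>2) / 2) * r (y * v\<^sup>2)) integrable_on {0..1}"
      using laguerre_inverse_has_integral[OF rc] by blast
    show "(\<lambda>v. v ^ (n - 1) * R) integrable_on {0..1::real}" using I by blast
    fix v :: real assume v: "v \<in> {0..1}"
    have v2: "v\<^sup>2 \<le> 1" using v by (simp add: power_le_one)
    then have "exp (y * (1 - v\<^sup>2) / 2) \<le> 1" using y by (simp add: mult_nonpos_nonneg)
    moreover have "\<bar>r (y * v\<^sup>2)\<bar> \<le> R"
    proof (rule R)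
      show "y * v\<^sup>2 \<le> 0" using y by (simp add: mult_nonpos_nonneg)
      show "y \<le> y * v\<^sup>2" using mult_left_mono_neg[OF v2 y] by simp
    qed
    ultimately have "exp (y * (1 - v\<^sup>2) / 2) * \<bar>r (y * v\<^sup>2)\<bar> \<le> 1 * R"
      by (intro mult_mono) auto
    then have "v ^ (n - 1) * (exp (y * (1 - v\<^sup>2) / 2) * \<bar>r (y * v\<^sup>2)\<bar>) \<le> v ^ (n - 1) * R"
      using v by (intro mult_left_mono) auto
    then show "norm (v ^ (n - 1) * exp (y * (1 - v\<^sup>2) / 2) * r (y * v\<^sup>2)) \<le> v ^ (n - 1) * R"
      using v by (simp add: abs_mult)
  qed
  then show ?thesis unfolding integral_unique[OF I] by simp
qed

text \<open>The integrating factor: up to a constant, \<open>2 y\<close> times the chi-square density. Multiplied by it, the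
  Laguerre operator becomes a derivative, so its sign controls monotonicity.\<close>

definition gamma_weight :: "nat \<Rightarrow> real \<Rightarrow> real" where
  "gamma_weight n y = sqrt y ^ n * exp (- y / 2)"

lemma gamma_weight_pos: "y > 0 \<Longrightarrow> gamma_weight n y > 0"
  by (simp add: gamma_weight_def)

lemma continuous_on_gamma_weight: "continuous_on S (gamma_weight n)"
  unfolding gamma_weight_def by (intro continuous_intros) auto

lemma gamma_weight_mult_DERIV:
  assumes y: "y > 0" and g: "(g has_real_derivative g') (at y)"
  shows "((\<lambda>y. gamma_weight n y * g y) has_real_derivative
      gamma_weight n y / (2 * y) * (2 * y * g' + (real n - y) * g y)) (at y)"
proof (cases n)
  case 0
  then show ?thesis
    unfolding gamma_weight_def
    using y apply -
    apply (rule derivative_eq_intros g refl | simp)+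
    apply (simp add: field_simps)
    done
next
  case (Suc k)
  have s: "sqrt y * sqrt y = y" using y by simp
  have "((\<lambda>y. gamma_weight n y * g y) has_real_derivative
     ((real n * sqrt y ^ k * (inverse (sqrt y) / 2)) * exp (- y / 2) + sqrt y ^ n * (exp (- y / 2) * (- 1 / 2))) * g y
       + sqrt y ^ n * exp (- y / 2) * g') (at y)"
    unfolding gamma_weight_def Suc
    using y apply -
    apply (rule derivative_eq_intros g refl | simp)+
    apply (simp add: algebra_simps)
    done
  moreover have "real n * sqrt y ^ k * (inverse (sqrt y) / 2) = real n * sqrt y ^ n / (2 * y)"
  proof -
    have "inverse (sqrt y) = sqrt y / y" using y s by (simp add: field_simps)
    then show ?thesis by (simp add: Suc field_simps)
  qed
  ultimately show ?thesis
    using y by (auto simp: gamma_weight_def field_simps elim!: DERIV_cong)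
qed

section \<open>Comparison principles for the Stein equation\<close>

lemma gamma_weight_add2: "y \<ge> 0 \<Longrightarrow> gamma_weight (n + 2) y = y * gamma_weight n y"
  by (simp add: gamma_weight_def)

lemma gamma_weight_tendsto_0: "(gamma_weight n \<longlongrightarrow> 0) at_top"
proof -
  have "((\<lambda>y::real. 2 ^ n * ((y / 2) ^ n / exp (y / 2))) \<longlongrightarrow> 2 ^ n * 0) at_top"
    by (intro tendsto_mult tendsto_const filterlim_compose[OF tendsto_power_div_exp_0]) real_asymp
  then have l: "((\<lambda>y::real. 2 ^ n * ((y / 2) ^ n / exp (y / 2))) \<longlongrightarrow> 0) at_top" by simp
  show ?thesis
  proof (rule tendsto_sandwich[OF _ _ tendsto_const l])
    show "\<forall>\<^sub>F y in at_top. 0 \<le> gamma_weight n y"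
      by (rule eventually_at_top_linorderI[of 0]) (simp add: gamma_weight_def)
    show "\<forall>\<^sub>F y in at_top. gamma_weight n y \<le> 2 ^ n * ((y / 2) ^ n / exp (y / 2))"
    proof (rule eventually_at_top_linorderI[of 1])
      fix y :: real assume y: "1 \<le> y"
      have "sqrt y \<le> y" using y by (simp add: real_le_rsqrt sqrt_le_D real_sqrt_le_iff power2_eq_square real_le_lsqrt)
      then have "sqrt y ^ n \<le> y ^ n" using y by (intro power_mono) auto
      then show "gamma_weight n y \<le> 2 ^ n * ((y / 2) ^ n / exp (y / 2))"
        by (simp add: gamma_weight_def exp_minus field_simps)
    qed
  qed
qed

lemma gamma_weight_times_bounded_tendsto_0:
  assumes "\<And>y. y \<ge> b \<Longrightarrow> \<bar>G y\<bar> \<le> C"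
  shows "((\<lambda>y. gamma_weight n y * G y) \<longlongrightarrow> 0) at_top"
proof (rule Lim_null_comparison)
  show "\<forall>\<^sub>F y in at_top. norm (gamma_weight n y * G y) \<le> gamma_weight n y * C"
  proof (rule eventually_at_top_linorderI[of "max b 0"])
    fix y assume "max b 0 \<le> y"
    then have "gamma_weight n y * \<bar>G y\<bar> \<le> gamma_weight n y * C" 
      using assms[of y] by (intro mult_left_mono) (auto simp: gamma_weight_def)
    then show "norm (gamma_weight n y * G y) \<le> gamma_weight n y * C"
      using \<open>max b 0 \<le> y\<close> by (simp add: abs_mult gamma_weight_def)
  qed
  show "((\<lambda>y. gamma_weight n y * C) \<longlongrightarrow> 0) at_top"
    using tendsto_mult[OF gamma_weight_tendsto_0 tendsto_const, of n C] by simp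
qed

text \<open>All comparison principles below rest on this monotonicity. The boundary condition needed to conclude
  is void at \<open>0\<close>, where the weight vanishes, and is a growth condition at infinity.\<close>

lemma gamma_weight_mult_mono:
  assumes ab: "0 \<le> a" "a \<le> b" and cont: "continuous_on {a..b} u"
    and u: "\<And>y. a < y \<Longrightarrow> y < b \<Longrightarrow> (u has_real_derivative u' y) (at y)"
    and nonneg: "\<And>y. a < y \<Longrightarrow> y < b \<Longrightarrow> 2 * y * u' y + (real n - y) * u y \<ge> 0"
  shows "gamma_weight n a * u a \<le> gamma_weight n b * u b"
proof (cases "a = b")
  case False
  then have "a < b" using ab by simp
  have "\<exists>l z. a < z \<and> z < b \<and> ((\<lambda>y. gamma_weight n y * u y) has_real_derivative l) (at z)
      \<and> gamma_weight n b * u b - gamma_weight n a * u a = (b - a) * l"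
  proof (rule MVT[OF \<open>a < b\<close>])
    show "continuous_on {a..b} (\<lambda>y. gamma_weight n y * u y)"
      by (intro continuous_on_mult continuous_on_gamma_weight cont)
    show "(\<lambda>y. gamma_weight n y * u y) differentiable (at x)" if "a < x" "x < b" for x
      using gamma_weight_mult_DERIV[OF _ u[of x], of n] ab that
      by (auto simp: real_differentiable_def)
  qed
  then obtain l z where z: "a < z" "z < b"
    and l: "((\<lambda>y. gamma_weight n y * u y) has_real_derivative l) (at z)"
      "gamma_weight n b * u b - gamma_weight n a * u a = (b - a) * l" by blast
  have "l = gamma_weight n z / (2 * z) * (2 * z * u' z + (real n - z) * u z)"
    using DERIV_unique[OF l(1) gamma_weight_mult_DERIV[OF _ u[of z]]] z ab by simp
  with l have eq: "gamma_weight n b * u b - gamma_weight n a * u a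
      = (b - a) * (gamma_weight n z / (2 * z) * (2 * z * u' z + (real n - z) * u z))" by simp
  have "0 \<le> (b - a) * (gamma_weight n z / (2 * z) * (2 * z * u' z + (real n - z) * u z))"
    using z ab nonneg[OF z] gamma_weight_pos[of z n] by (intro mult_nonneg_nonneg) auto
  with eq show ?thesis by simp
qed simp

lemma gamma_weight_mult_mono_minus:
  assumes ab: "0 \<le> a" "a \<le> b" and cont: "continuous_on {a..b} u"
    and u: "\<And>y. a < y \<Longrightarrow> y < b \<Longrightarrow> (u has_real_derivative u' y) (at y)"
    and nonpos: "\<And>y. a < y \<Longrightarrow> y < b \<Longrightarrow> 2 * y * u' y + (real n - y) * u y \<le> 0"
  shows "gamma_weight n b * u b \<le> gamma_weight n a * u a"
proof -
  have "gamma_weight n a * - u a \<le> gamma_weight n b * - u b"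
  proof (rule gamma_weight_mult_mono[OF ab, where u'="\<lambda>y. - u' y"])
    fix y assume "a < y" "y < b"
    then show "0 \<le> 2 * y * - u' y + (real n - y) * - u y" "((\<lambda>y. - u y) has_real_derivative - u' y) (at y)"
      using nonpos[of y] u[of y] by (auto intro: DERIV_minus)
  qed (intro continuous_on_minus cont)
  then show ?thesis by simp
qed

lemma comparison_from_left:
  assumes ab: "0 \<le> a" "a < b" and cont: "continuous_on {a..b} u"
    and u: "\<And>y. a < y \<Longrightarrow> y < b \<Longrightarrow> (u has_real_derivative u' y) (at y)"
    and nonneg: "\<And>y. a < y \<Longrightarrow> y < b \<Longrightarrow> 2 * y * u' y + (real n - y) * u y \<ge> 0"
    and start: "(n \<ge> 1 \<and> a = 0) \<or> u a \<ge> 0"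
  shows "u b \<ge> 0"
proof -
  have "0 \<le> gamma_weight n a * u a"
    using start ab by (auto simp: gamma_weight_def power_0_left)
  also have "\<dots> \<le> gamma_weight n b * u b"
    using gamma_weight_mult_mono[OF ab(1) less_imp_le[OF ab(2)] cont u nonneg] by simp
  finally show ?thesis using gamma_weight_pos[of b n] ab by (simp add: zero_le_mult_iff)
qed

lemma comparison_from_right:
  assumes ab: "0 < a" "a \<le> b" and cont: "continuous_on {a..b} u"
    and u: "\<And>y. a < y \<Longrightarrow> y < b \<Longrightarrow> (u has_real_derivative u' y) (at y)"
    and nonpos: "\<And>y. a < y \<Longrightarrow> y < b \<Longrightarrow> 2 * y * u' y + (real n - y) * u y \<le> 0"
    and start: "u b \<ge> 0"
  shows "u a \<ge> 0"
proof -
  have "0 \<le> gamma_weight n b * u b"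
    using start ab by (auto simp: gamma_weight_def)
  also have "\<dots> \<le> gamma_weight n a * u a"
    using gamma_weight_mult_mono_minus[of a b u u' n] ab cont u nonpos by simp
  finally show ?thesis using gamma_weight_pos[of a n] ab by (simp add: zero_le_mult_iff)
qed

lemma comparison_from_infinity:
  assumes a: "0 < a" and cont: "continuous_on {a..} u"
    and u: "\<And>y. a < y \<Longrightarrow> (u has_real_derivative u' y) (at y)"
    and nonpos: "\<And>y. a < y \<Longrightarrow> 2 * y * u' y + (real n - y) * u y \<le> 0"
    and lim: "((\<lambda>y. gamma_weight n y * u y) \<longlongrightarrow> 0) at_top"
  shows "u a \<ge> 0"
proof -
  have "gamma_weight n z * u z \<le> gamma_weight n a * u a" if "z \<ge> a" for z
    using gamma_weight_mult_mono_minus[of a z u u' n] a that u nonpos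
      continuous_on_subset[OF cont, of "{a..z}"] by simp
  then have "\<forall>\<^sub>F z in at_top. gamma_weight n z * u z \<le> gamma_weight n a * u a"
    by (rule eventually_at_top_linorderI)
  then have "0 \<le> gamma_weight n a * u a"
    by (rule tendsto_upperbound[OF lim]) simp
  then show ?thesis using gamma_weight_pos[of a n] a by (simp add: zero_le_mult_iff)
qed

text \<open>If the right-hand side decreases, it is positive and then negative, so the weighted solution rises
  from its limit \<open>0\<close> at the left end and then falls to its limit \<open>0\<close> at infinity.\<close>

lemma nonneg_of_antitone_source:
  assumes n: "n \<ge> 1" and u: "\<And>y. (u has_real_derivative u' y) (at y)"
    and anti: "\<And>x y. 0 < x \<Longrightarrow> x \<le> y \<Longrightarrow>
          2 * y * u' y + (real n - y) * u y \<le> 2 * x * u' x + (real n - x) * u x"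
    and lim: "((\<lambda>y. gamma_weight n y * u y) \<longlongrightarrow> 0) at_top"
    and y: "y > 0"
  shows "u y \<ge> 0"
proof (cases "2 * y * u' y + (real n - y) * u y \<ge> 0")
  case True
  show ?thesis
    by (rule comparison_from_left[of 0 y u u' n])
      (use n y u True anti[of _ y] in \<open>fastforce intro: has_derivative_imp_continuous_on[OF u]\<close>)+
next
  case False
  have "2 * x * u' x + (real n - x) * u x \<le> 0" if "y < x" for x
    using False anti[of y x] y that by linarith
  then show ?thesis
    by (intro comparison_from_infinity[OF y has_derivative_imp_continuous_on[OF u] u _ lim])
qed

text \<open>The solutions are estimated by barriers: if \<open>|r| \<le> R\<close>, a function \<open>G\<close> with \<open>2 x G' + (a - x) G \<ge> R\<close>
  propagates the bound \<open>|g| \<le> G\<close> to the right, and one with \<open>2 x G' + (a - x) G \<le> -R\<close> propagates it to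
  the left. Far from the centre \<open>a\<close>
  the hyperbola \<open>R / |a - x|\<close> is a barrier; within distance \<open>2 \<surd>a\<close> of \<open>a\<close> a parabola of height
  \<open>5 R / (4 \<surd>a)\<close> is one.\<close>

locale laguerre_equation =
  fixes a :: nat and R :: real and r g g' :: "real \<Rightarrow> real"
  assumes a: "a \<ge> 1"
    and g: "\<And>y. (g has_real_derivative g' y) (at y)"
    and ode: "\<And>y. y > 0 \<Longrightarrow> 2 * y * g' y + (real a - y) * g y = r y"
begin

lemma abs_le_barrier_left:
  assumes b: "0 \<le> b" "b < y"
    and r: "\<And>x. b < x \<Longrightarrow> x < y \<Longrightarrow> \<bar>r x\<bar> \<le> R"
    and G: "\<And>x. b \<le> x \<Longrightarrow> x \<le> y \<Longrightarrow> (G has_real_derivative G' x) (at x)"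
    and super: "\<And>x. b < x \<Longrightarrow> x < y \<Longrightarrow> R \<le> 2 * x * G' x + (real a - x) * G x"
    and start: "b = 0 \<or> \<bar>g b\<bar> \<le> G b"
  shows "\<bar>g y\<bar> \<le> G y"
proof -
  have G_cont: "continuous_on {b..y} G" using G by (auto intro!: continuous_at_imp_continuous_on DERIV_isCont)
  have "G y - \<epsilon> * g y \<ge> 0" if \<epsilon>: "\<bar>\<epsilon>\<bar> = 1" for \<epsilon>
  proof (rule comparison_from_left[OF b, where u'="\<lambda>x. G' x - \<epsilon> * g' x" and n=a])
    show "continuous_on {b..y} (\<lambda>x. G x - \<epsilon> * g x)"
      by (intro continuous_intros G_cont has_derivative_imp_continuous_on[OF g])
    fix x assume x: "b < x" "x < y"
    show "((\<lambda>x. G x - \<epsilon> * g x) has_real_derivative G' x - \<epsilon> * g' x) (at x)"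
      using x by (intro DERIV_diff DERIV_cmult G g) auto
    have "\<epsilon> * r x \<le> R" using r[OF x] \<epsilon> by (auto simp: abs_if split: if_splits)
    then have "0 \<le> (2 * x * G' x + (real a - x) * G x) - \<epsilon> * (2 * x * g' x + (real a - x) * g x)"
      using super[OF x] ode[of x] x b by simp
    then show "0 \<le> 2 * x * (G' x - \<epsilon> * g' x) + (real a - x) * (G x - \<epsilon> * g x)"
      by (simp add: algebra_simps)
  qed (use a start \<epsilon> in \<open>auto simp: abs_if split: if_splits\<close>)
  from this[of 1] this[of "-1"] show ?thesis by simp
qed

lemma abs_le_barrier_right:
  assumes b: "0 < y" "y \<le> b"
    and r: "\<And>x. y < x \<Longrightarrow> x < b \<Longrightarrow> \<bar>r x\<bar> \<le> R"
    and G: "\<And>x. y \<le> x \<Longrightarrow> x \<le> b \<Longrightarrow> (G has_real_derivative G' x) (at x)"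
    and super: "\<And>x. y < x \<Longrightarrow> x < b \<Longrightarrow> 2 * x * G' x + (real a - x) * G x \<le> - R"
    and start: "\<bar>g b\<bar> \<le> G b"
  shows "\<bar>g y\<bar> \<le> G y"
proof -
  have G_cont: "continuous_on {y..b} G" using G by (auto intro!: continuous_at_imp_continuous_on DERIV_isCont)
  have "G y - \<epsilon> * g y \<ge> 0" if \<epsilon>: "\<bar>\<epsilon>\<bar> = 1" for \<epsilon>
  proof (rule comparison_from_right[OF b, where u'="\<lambda>x. G' x - \<epsilon> * g' x" and n=a])
    show "continuous_on {y..b} (\<lambda>x. G x - \<epsilon> * g x)"
      by (intro continuous_intros G_cont has_derivative_imp_continuous_on[OF g])
    fix x assume x: "y < x" "x < b"
    show "((\<lambda>x. G x - \<epsilon> * g x) has_real_derivative G' x - \<epsilon> * g' x) (at x)"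
      using x by (intro DERIV_diff DERIV_cmult G g) auto
    have "- (\<epsilon> * r x) \<le> R" using r[OF x] \<epsilon> by (auto simp: abs_if split: if_splits)
    then have "(2 * x * G' x + (real a - x) * G x) - \<epsilon> * (2 * x * g' x + (real a - x) * g x) \<le> 0"
      using super[OF x] ode[of x] x b by simp
    then show "2 * x * (G' x - \<epsilon> * g' x) + (real a - x) * (G x - \<epsilon> * g x) \<le> 0"
      by (simp add: algebra_simps)
  qed (use start \<epsilon> in \<open>auto simp: abs_if split: if_splits\<close>)
  from this[of 1] this[of "-1"] show ?thesis by simp
qed

lemma abs_le_hyperbola_left:
  assumes y: "0 < y" "y < real a" and r: "\<And>x. 0 < x \<Longrightarrow> x < y \<Longrightarrow> \<bar>r x\<bar> \<le> R" and R: "R \<ge> 0"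
  shows "\<bar>g y\<bar> \<le> R / (real a - y)"
proof (rule abs_le_barrier_left[where G'="\<lambda>x. R / (real a - x)\<^sup>2"])
  fix x assume x: "0 < x" "x < y"
  then have "(real a - x) * (R / (real a - x)) = R" using y by simp
  moreover have "2 * x * (R / (real a - x)\<^sup>2) \<ge> 0" using x R by simp
  ultimately show "R \<le> 2 * x * (R / (real a - x)\<^sup>2) + (real a - x) * (R / (real a - x))" by linarith
next
  fix x assume x: "0 \<le> x" "x \<le> y"
  then have "real a - x \<noteq> 0" using y by simp
  then show "((\<lambda>x. R / (real a - x)) has_real_derivative R / (real a - x)\<^sup>2) (at x)"
    by (auto intro!: derivative_eq_intros simp: power2_eq_square)
qed (use y r in auto)

text \<open>For few degrees of freedom the interval \<open>[0, a]\<close> is too short for the parabolic barrier, and an affine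
  function does better.\<close>

lemma abs_le_linear_left:
  assumes y: "0 < y" "y \<le> real a" and r: "\<And>x. 0 < x \<Longrightarrow> x < y \<Longrightarrow> \<bar>r x\<bar> \<le> R" and R: "R \<ge> 0"
  shows "\<bar>g y\<bar> \<le> R * (1 / real a + 1 / 2)"
proof -
  have a0: "real a \<noteq> 0" using a by simp
  have "\<bar>g y\<bar> \<le> R / real a * (1 + y / 2)"
  proof (rule abs_le_barrier_left[where G'="\<lambda>x. R / real a / 2"])
    fix x assume x: "0 < x" "x < y"
    have "2 * x * (R / real a / 2) + (real a - x) * (R / real a * (1 + x / 2)) = R + R * (x * (real a - x)) / (2 * real a)"
      using a0 by (simp add: field_simps)
    moreover have "R * (x * (real a - x)) / (2 * real a) \<ge> 0" using x y R by simp
    ultimately show "R \<le> 2 * x * (R / real a / 2) + (real a - x) * (R / real a * (1 + x / 2))" by linarith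
  next
    fix x
    show "((\<lambda>x. R / real a * (1 + x / 2)) has_real_derivative R / real a / 2) (at x)"
      using a0 by (auto intro!: derivative_eq_intros)
  qed (use y r in auto)
  also have "\<dots> \<le> R / real a * (1 + real a / 2)" using y R by (intro mult_left_mono) auto
  also have "\<dots> = R * (1 / real a + 1 / 2)" using a0 by (simp add: field_simps)
  finally show ?thesis .
qed

lemma abs_le_hyperbola_right:
  assumes y: "real a < y" and r: "\<And>x. y < x \<Longrightarrow> \<bar>r x\<bar> \<le> R" and R: "R \<ge> 0"
    and lim: "((\<lambda>y. gamma_weight a y * g y) \<longlongrightarrow> 0) at_top"
  shows "\<bar>g y\<bar> \<le> R / (y - real a)"
proof -
  let ?G = "\<lambda>x. R / (x - real a)" and ?G' = "\<lambda>x. - (R / (x - real a)\<^sup>2)"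
  have G: "(?G has_real_derivative ?G' x) (at x)" if "x \<ge> y" for x
    using that y by (auto intro!: derivative_eq_intros simp: power2_eq_square)
  have super: "2 * x * ?G' x + (real a - x) * ?G x \<le> - R" if "x > y" for x
  proof -
    have "(real a - x) * ?G x = - R" using that y by (simp add: field_simps)
    moreover have "2 * x * (R / (x - real a)\<^sup>2) \<ge> 0" using that y R by simp
    ultimately show ?thesis by simp
  qed
  have G_cont: "continuous_on {y..} ?G" using G by (auto intro!: continuous_at_imp_continuous_on DERIV_isCont)
  have limG: "((\<lambda>x. gamma_weight a x * ?G x) \<longlongrightarrow> 0) at_top"
  proof (rule gamma_weight_times_bounded_tendsto_0)
    fix x assume "real a + 1 \<le> x"
    then show "\<bar>R / (x - real a)\<bar> \<le> R" using R divide_left_mono[of 1 "x - real a" R] by simp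
  qed
  have y0: "0 < y" using y by simp
  have "?G y - \<epsilon> * g y \<ge> 0" if \<epsilon>: "\<bar>\<epsilon>\<bar> = 1" for \<epsilon>
  proof (rule comparison_from_infinity[OF y0, where u'="\<lambda>x. ?G' x - \<epsilon> * g' x" and n=a])
    show "continuous_on {y..} (\<lambda>x. ?G x - \<epsilon> * g x)"
      by (intro continuous_on_diff continuous_on_mult_left G_cont has_derivative_imp_continuous_on[OF g])
    fix x assume x: "y < x"
    show "((\<lambda>x. ?G x - \<epsilon> * g x) has_real_derivative ?G' x - \<epsilon> * g' x) (at x)"
      using x by (intro DERIV_diff DERIV_cmult G g) auto
    have "- (\<epsilon> * r x) \<le> R" using r[OF x] \<epsilon> by (auto simp: abs_if split: if_splits)
    then have "(2 * x * ?G' x + (real a - x) * ?G x) - \<epsilon> * (2 * x * g' x + (real a - x) * g x) \<le> 0"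
      using super[OF x] ode[of x] x y0 by simp
    then show "2 * x * (?G' x - \<epsilon> * g' x) + (real a - x) * (?G x - \<epsilon> * g x) \<le> 0"
      by (simp add: algebra_simps)
  next
    have "((\<lambda>x. gamma_weight a x * ?G x - \<epsilon> * (gamma_weight a x * g x)) \<longlongrightarrow> 0 - \<epsilon> * 0) at_top"
      by (intro tendsto_diff tendsto_mult_left limG lim)
    then show "((\<lambda>x. gamma_weight a x * (?G x - \<epsilon> * g x)) \<longlongrightarrow> 0) at_top"
      by (simp add: algebra_simps)
  qed
  from this[of 1] this[of "-1"] show ?thesis by (simp only: mult_1 mult_minus1 abs_le_iff) simp
qed

text \<open>In the scaled variable \<open>t = (x - a) / \<surd>a\<close> the barrier is \<open>R (1/4 + (1 - t/4)\<^sup>2) / \<surd>a\<close>. It meets the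
  hyperbola at \<open>t = 2\<close>, and its value \<open>5 R / (4 \<surd>a)\<close> at \<open>t = 0\<close> is, for \<open>R = 2\<close>, just below the
  bound \<open>\<surd>(2 \<pi> / (a - 2))\<close> that the application requires.\<close>

lemma abs_le_center_right:
  assumes y: "real a \<le> y" and r: "\<And>x. y < x \<Longrightarrow> \<bar>r x\<bar> \<le> R" and R: "R \<ge> 0"
    and lim: "((\<lambda>y. gamma_weight a y * g y) \<longlongrightarrow> 0) at_top"
  shows "\<bar>g y\<bar> \<le> 5 / 4 * R / sqrt a"
proof (cases "y \<ge> real a + 2 * sqrt a")
  case True
  have "sqrt (real a) > 0" using a by simp
  with True have "\<bar>g y\<bar> \<le> R / (y - real a)" using a r R lim by (intro abs_le_hyperbola_right) (auto intro: less_le_trans[of _ "real a + 2 * sqrt (real a)"])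
  also have "\<dots> \<le> R / (2 * sqrt a)" using True R \<open>sqrt (real a) > 0\<close> by (intro divide_left_mono mult_pos_pos) linarith+
  also have "\<dots> \<le> 5 / 4 * R / sqrt a" using R a by (simp add: field_simps)
  finally show ?thesis .
next
  case False
  define q where "q = sqrt (real a)"
  have q: "q > 0" "real a = q * q" using a by (auto simp: q_def)
  define G where "G = (\<lambda>x. R / q * (1 / 4 + (1 - (x - real a) / (4 * q))\<^sup>2))"
  define G' where "G' = (\<lambda>x. - (R * (1 - (x - real a) / (4 * q)) / (2 * real a)))"
  have "\<bar>g y\<bar> \<le> G y"
  proof (rule abs_le_barrier_right[where G'=G' and b="real a + 2 * q"])
    fix x
    show "(G has_real_derivative G' x) (at x)"
      unfolding G_def G'_def using q(1)
      by (auto intro!: derivative_eq_intros simp: q(2) field_simps power2_eq_square power4_eq_xxxx)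
    assume x: "y < x" "x < real a + 2 * q"
    define t where "t = (x - real a) / q"
    define s where "s = 1 - t / 4"
    have t: "0 \<le> t" "t \<le> 2" using x y q by (auto simp: t_def field_simps)
    have xt: "x = q * q + q * t" using q by (simp add: t_def)
    have "2 * x * G' x + (real a - x) * G x = - R * (1 + t * s\<^sup>2 + t * s / q)"
    proof -
      have e: "(x - real a) / (4 * q) = t / 4" by (simp add: t_def)
      have "2 * x * G' x = - R * s * (1 + t / q)"
        unfolding G'_def e s_def[symmetric] unfolding xt q(2) using q(1) by (simp add: field_simps)
      moreover have "(real a - x) * G x = - R * t * (1 / 4 + s\<^sup>2)"
        unfolding G_def e s_def[symmetric] unfolding xt q(2) using q(1) by (simp add: field_simps)
      ultimately have "2 * x * G' x + (real a - x) * G x = - R * s * (1 + t / q) + - R * t * (1 / 4 + s\<^sup>2)" by simp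
      also have "\<dots> = - R * ((s + t / 4) + t * s\<^sup>2 + t * s / q)"
        by (simp add: algebra_simps)
      finally show ?thesis by (simp add: s_def)
    qed
    moreover have "t * s\<^sup>2 + t * s / q \<ge> 0" using t q by (simp add: s_def)
    then have "R * (1 + t * s\<^sup>2 + t * s / q) \<ge> R * 1" using R by (intro mult_left_mono) auto
    ultimately show "2 * x * G' x + (real a - x) * G x \<le> - R" by simp
  next
    have "\<bar>g (real a + 2 * q)\<bar> \<le> R / (real a + 2 * q - real a)"
      using q(1) y False r by (intro abs_le_hyperbola_right[OF _ _ R lim]) (auto simp: q_def)
    then show "\<bar>g (real a + 2 * q)\<bar> \<le> G (real a + 2 * q)"
      using q(1) by (simp add: G_def power2_eq_square)
  qed (use y r a False in \<open>auto simp: q_def\<close>)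
  also have "G y \<le> R / q * (1 / 4 + 1\<^sup>2)"
    unfolding G_def using y False q(1) R
    by (intro mult_left_mono add_left_mono power_mono) (auto simp: q_def field_simps)
  finally show ?thesis by (simp add: q_def)
qed

text \<open>The mirror image of the previous barrier. On this side the supersolution property requires
  \<open>1 - t/4 \<ge> 1 / \<surd>a\<close> for \<open>t \<le> 2\<close>, which is the reason for \<open>a \<ge> 4\<close>.\<close>

lemma abs_le_center_left:
  assumes a4: "a \<ge> 4" and y: "0 < y" "y \<le> real a" and r: "\<And>x. 0 < x \<Longrightarrow> x < y \<Longrightarrow> \<bar>r x\<bar> \<le> R" and R: "R \<ge> 0"
  shows "\<bar>g y\<bar> \<le> 5 / 4 * R / sqrt a"
proof (cases "y \<le> real a - 2 * sqrt a")
  case True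
  have "sqrt (real a) > 0" using a by simp
  with True have "\<bar>g y\<bar> \<le> R / (real a - y)" using a y r R by (intro abs_le_hyperbola_left) (auto intro: le_less_trans[of _ "real a - 2 * sqrt (real a)"])
  also have "\<dots> \<le> R / (2 * sqrt a)" using True R \<open>sqrt (real a) > 0\<close> by (intro divide_left_mono mult_pos_pos) linarith+
  also have "\<dots> \<le> 5 / 4 * R / sqrt a" using R a by (simp add: field_simps)
  finally show ?thesis .
next
  case False
  define q where "q = sqrt (real a)"
  have q: "q > 0" "real a = q * q" using a by (auto simp: q_def)
  have q2: "q \<ge> 2" using a4 by (simp add: q_def real_le_rsqrt)
  define b where "b = real a - 2 * q"
  have y_gt: "b < y" using \<open>\<not> y \<le> real a - 2 * sqrt a\<close> by (simp add: b_def q_def)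
  have b0: "b \<ge> 0" using q2 q by (simp add: b_def mult_right_mono)
  define G where "G = (\<lambda>x. R / q * (1 / 4 + (1 - (real a - x) / (4 * q))\<^sup>2))"
  define G' where "G' = (\<lambda>x. (R * (1 - (real a - x) / (4 * q)) / (2 * real a)))"
  have "\<bar>g y\<bar> \<le> G y"
  proof (rule abs_le_barrier_left[where G'=G' and b=b])
    fix x
    show "(G has_real_derivative G' x) (at x)"
      unfolding G_def G'_def using q(1)
      by (auto intro!: derivative_eq_intros simp: q(2) field_simps power2_eq_square power4_eq_xxxx)
    assume x: "b < x" "x < y"
    define t where "t = (real a - x) / q"
    define s where "s = 1 - t / 4"
    have t: "0 \<le> t" "t \<le> 2" using x y q by (auto simp: t_def b_def field_simps)
    have xt: "x = q * q - q * t" using q by (simp add: t_def)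
    have "2 * x * G' x + (real a - x) * G x = R * (1 + t * s * (s - 1 / q))"
    proof -
      have e: "(real a - x) / (4 * q) = t / 4" by (simp add: t_def)
      have "2 * x * G' x = R * s * (1 - t / q)"
        unfolding G'_def e s_def[symmetric] unfolding xt q(2) using q(1) by (simp add: field_simps)
      moreover have "(real a - x) * G x = R * t * (1 / 4 + s\<^sup>2)"
        unfolding G_def e s_def[symmetric] unfolding xt q(2) using q(1) by (simp add: field_simps)
      ultimately have "2 * x * G' x + (real a - x) * G x = R * s * (1 - t / q) + R * t * (1 / 4 + s\<^sup>2)" by simp
      also have "\<dots> = R * ((s + t / 4) + t * s * (s - 1 / q))"
        by (simp add: algebra_simps power2_eq_square)
      finally show ?thesis by (simp add: s_def)
    qed
    moreover have "1 / q \<le> 1 / 2" using q2 by (simp add: field_simps)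
    then have "t * s * (s - 1 / q) \<ge> 0" using t by (intro mult_nonneg_nonneg) (auto simp: s_def)
    then have "R * (1 + t * s * (s - 1 / q)) \<ge> R * 1" using R by (intro mult_left_mono) auto
    ultimately show "R \<le> 2 * x * G' x + (real a - x) * G x" by simp
  next
    show "b = 0 \<or> \<bar>g b\<bar> \<le> G b"
    proof (cases "b = 0")
      case False
      then have "\<bar>g b\<bar> \<le> R / (real a - b)"
        using q(1) y y_gt b0 r by (intro abs_le_hyperbola_left[OF _ _ _ R]) (auto simp: q_def b_def)
      then show ?thesis
        using q(1) by (simp add: G_def b_def power2_eq_square)
    qed simp
  qed (use y r a False b0 in \<open>auto simp: q_def b_def\<close>)
  also have "G y \<le> R / q * (1 / 4 + 1\<^sup>2)"
    unfolding G_def using y False q(1) R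
    by (intro mult_left_mono add_left_mono power_mono) (auto simp: q_def field_simps)
  finally show ?thesis by (simp add: q_def)
qed

end

section \<open>The Stein identity of the chi-square law\<close>

text \<open>The unnormalized density of the square root of a chi-square variable.\<close>

definition chi_kernel :: "nat \<Rightarrow> real \<Rightarrow> real" where
  "chi_kernel n w = w ^ (n - 1) * exp (- w\<^sup>2 / 2)"

lemma continuous_on_chi_kernel: "continuous_on S (chi_kernel n)"
  unfolding chi_kernel_def by (intro continuous_intros) auto

lemma chi_kernel_mult_integrable:
  assumes "h \<in> borel_measurable borel" "\<And>w. \<bar>h w\<bar> \<le> C"
  shows "set_integrable lborel {0..} (\<lambda>w. chi_kernel n w * h w)"
  unfolding set_integrable_def
proof (rule Bochner_Integration.integrable_bound)
  show "integrable lborel (\<lambda>w. sqrt (2 * pi) * C * (std_normal_density w * \<bar>w\<bar> ^ (n - 1)))"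
    by (intro integrable_mult_right integrable_std_normal_moment_abs)
  have "chi_kernel n \<in> borel_measurable borel"
    by (intro borel_measurable_continuous_onI continuous_on_chi_kernel)
  with assms(1) show "(\<lambda>w. indicat_real {0..} w *\<^sub>R (chi_kernel n w * h w)) \<in> borel_measurable lborel"
    by simp
  have "C \<ge> 0" using assms(2)[of 0] by (smt (verit))
  have "\<bar>indicat_real {0..} w * (chi_kernel n w * h w)\<bar>
      \<le> sqrt (2 * pi) * C * (std_normal_density w * \<bar>w\<bar> ^ (n - 1))" for w
  proof -
    have "sqrt (2 * pi) * C * (std_normal_density w * \<bar>w\<bar> ^ (n - 1)) = \<bar>chi_kernel n w\<bar> * C"
      by (simp add: std_normal_density_def chi_kernel_def abs_mult power_abs)
    moreover have "\<bar>chi_kernel n w\<bar> * \<bar>h w\<bar> \<le> \<bar>chi_kernel n w\<bar> * C"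
      using assms(2) by (intro mult_left_mono) auto
    moreover have "\<bar>indicat_real {0..} w * (chi_kernel n w * h w)\<bar> \<le> \<bar>chi_kernel n w\<bar> * \<bar>h w\<bar>"
      by (simp add: abs_mult split: split_indicator)
    ultimately show ?thesis by linarith
  qed
  then show "AE w in lborel. norm (indicat_real {0..} w *\<^sub>R (chi_kernel n w * h w))
      \<le> norm (sqrt (2 * pi) * C * (std_normal_density w * \<bar>w\<bar> ^ (n - 1)))"
    by (intro AE_I2) (smt (verit) real_norm_def real_scaleR_def)
qed

lemma chi_kernel_integral_pos: "(LBINT w:{0..}. chi_kernel n w) > 0"
proof -
  have int: "set_integrable lborel {0..} (chi_kernel n)"
    using chi_kernel_mult_integrable[of "\<lambda>_. 1" 1 n] by simp
  have nn: "0 \<le> indicat_real {0..} w *\<^sub>R chi_kernel n w" for w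
    by (simp add: chi_kernel_def split: split_indicator)
  have "(LBINT w:{0..}. chi_kernel n w) \<noteq> 0"
  proof
    assume "(LBINT w:{0..}. chi_kernel n w) = 0"
    then have "AE w in lborel. indicat_real {0..} w *\<^sub>R chi_kernel n w = 0"
      using integral_nonneg_eq_0_iff_AE[of lborel "\<lambda>w. indicat_real {0..} w *\<^sub>R chi_kernel n w"] int nn
      by (simp add: set_lebesgue_integral_def set_integrable_def)
    moreover have "AE w in lborel. w \<noteq> (0::real)" by (rule AE_lborel_singleton)
    ultimately have "AE w in lborel. w \<notin> {0..1::real}"
      by eventually_elim (auto simp: chi_kernel_def split: split_indicator_asm)
    then have "emeasure lborel {w \<in> space lborel. \<not> (w \<notin> {0..1::real})} = 0"
      by (rule AE_E2)
    moreover have "{w \<in> space lborel. \<not> (w \<notin> {0..1::real})} = {0..1}" by auto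
    ultimately show False by simp
  qed
  moreover have "(LBINT w:{0..}. chi_kernel n w) \<ge> 0"
    using nn by (auto simp: set_lebesgue_integral_def intro!: integral_nonneg)
  ultimately show ?thesis by simp
qed

text \<open>Substituting \<open>y = w\<^sup>2\<close> turns the weighted solution into \<open>\<integral>\<^sub>0\<^sup>\<surd>\<^sup>y w\<^bsup>n-1\<^esup> e\<^bsup>-w\<^sup>2/2\<^esup> r(w\<^sup>2) dw\<close>. Hence the growth condition at
  infinity holds exactly when \<open>r\<close> has mean zero under the chi-square law.\<close>

lemma gamma_weight_mult_tendsto:
  assumes n: "n \<ge> 1"
    and g: "\<And>y. (g has_real_derivative g' y) (at y)"
    and ode: "\<And>y. 2 * y * g' y + (real n - y) * g y = r y"
    and rc: "continuous_on UNIV r" and rb: "\<And>y. \<bar>r y\<bar> \<le> C"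
  shows "((\<lambda>y. gamma_weight n y * g y) \<longlongrightarrow> (LBINT w:{0..}. chi_kernel n w * r (w\<^sup>2))) at_top"
proof -
  let ?\<Psi> = "\<lambda>w. w ^ n * exp (- w\<^sup>2 / 2) * g (w\<^sup>2)"
  obtain k where k: "n = Suc k" using n by (cases n) auto
  have D: "(?\<Psi> has_real_derivative chi_kernel n w * r (w\<^sup>2)) (at w)" for w
    unfolding ode[symmetric] chi_kernel_def
    apply (rule derivative_eq_intros DERIV_chain2[OF g] refl | simp)+
    apply (simp add: k field_simps power2_eq_square)
    done
  have c: "continuous_on UNIV (\<lambda>w. chi_kernel n w * r (w\<^sup>2))"
    by (intro continuous_intros continuous_on_chi_kernel continuous_on_UNIV_compose[OF rc])
  have int: "set_integrable lborel {0..} (\<lambda>w. chi_kernel n w * r (w\<^sup>2))"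
    by (rule chi_kernel_mult_integrable[OF _ rb])
       (intro borel_measurable_continuous_onI continuous_on_UNIV_compose[OF rc] continuous_intros)
  have fin: "(LBINT w:{0..b}. chi_kernel n w * r (w\<^sup>2)) = ?\<Psi> b" if "b \<ge> 0" for b
  proof -
    have "(\<integral>w. (chi_kernel n w * r (w\<^sup>2)) * indicator {0 .. b} w \<partial>lborel) = ?\<Psi> b - ?\<Psi> 0"
      using D c by (intro integral_FTC_Icc_real that) (auto simp: continuous_on_eq_continuous_at)
    then show ?thesis using n by (simp add: set_lebesgue_integral_def mult.commute power_0_left)
  qed
  have "((\<lambda>b. LBINT w:{0..b}. chi_kernel n w * r (w\<^sup>2)) \<longlongrightarrow> (LBINT w:{0..}. chi_kernel n w * r (w\<^sup>2))) at_top"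
    by (rule tendsto_set_lebesgue_integral_at_top[OF _ int]) simp
  then have "((\<lambda>y. LBINT w:{0..sqrt y}. chi_kernel n w * r (w\<^sup>2)) \<longlongrightarrow> (LBINT w:{0..}. chi_kernel n w * r (w\<^sup>2))) at_top"
    by (rule filterlim_compose) (rule sqrt_at_top)
  moreover have "\<forall>\<^sub>F y in at_top. (LBINT w:{0..sqrt y}. chi_kernel n w * r (w\<^sup>2)) = gamma_weight n y * g y"
    using eventually_ge_at_top[of 0]
    by eventually_elim (simp add: fin gamma_weight_def)
  ultimately show ?thesis by (rule Lim_transform_eventually)
qed

lemma std_normal_integration_by_parts:
  assumes g: "\<And>y. (g has_real_derivative g' y) (at y)" and g'c: "continuous_on UNIV g'"
    and gb: "\<And>y. \<bar>g y\<bar> \<le> A" and g'b: "\<And>y. \<bar>g' y\<bar> \<le> B"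
  shows "(\<integral>x. x\<^sup>2 * g (x\<^sup>2 + s) \<partial>density lborel std_normal_density)
       = (\<integral>x. g (x\<^sup>2 + s) + 2 * x\<^sup>2 * g' (x\<^sup>2 + s) \<partial>density lborel std_normal_density)"
proof -
  let ?N = std_normal_density
  have gc: "continuous_on UNIV g" using g by (rule has_derivative_imp_continuous_on)
  define u where "u = (\<lambda>x. x * g (x\<^sup>2 + s) * ?N x)"
  define v where "v = (\<lambda>x. ?N x * (g (x\<^sup>2 + s) + 2 * x\<^sup>2 * g' (x\<^sup>2 + s)) - ?N x * (x\<^sup>2 * g (x\<^sup>2 + s)))"
  have Nc: "continuous_on S ?N" for S
    unfolding std_normal_density_def by (intro continuous_intros) auto
  have meas: "(\<lambda>x. g (x\<^sup>2 + s)) \<in> borel_measurable borel" "(\<lambda>x. g' (x\<^sup>2 + s)) \<in> borel_measurable borel"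
    by (intro borel_measurable_continuous_onI continuous_on_UNIV_compose[OF gc] continuous_on_UNIV_compose[OF g'c] continuous_intros)+
  have i1: "integrable lborel (\<lambda>x. ?N x * x\<^sup>2 * f (x\<^sup>2 + s))"
    if "(\<lambda>x. f (x\<^sup>2 + s)) \<in> borel_measurable borel" "\<And>y. \<bar>f y\<bar> \<le> C" for f C
  proof (rule Bochner_Integration.integrable_bound)
    show "integrable lborel (\<lambda>x. ?N x * x\<^sup>2 * C)"
      by (intro integrable_mult_left integrable_std_normal_moment)
    show "(\<lambda>x. ?N x * x\<^sup>2 * f (x\<^sup>2 + s)) \<in> borel_measurable lborel" using that(1) by simp
    show "AE x in lborel. norm (?N x * x\<^sup>2 * f (x\<^sup>2 + s)) \<le> norm (?N x * x\<^sup>2 * C)"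
      using that(2) by (intro AE_I2) (auto simp: abs_mult intro!: mult_left_mono order_trans[OF that(2) abs_ge_self])
  qed
  have i0: "integrable lborel (\<lambda>x. ?N x * f (x\<^sup>2 + s))"
    if "(\<lambda>x. f (x\<^sup>2 + s)) \<in> borel_measurable borel" "\<And>y. \<bar>f y\<bar> \<le> C" for f C
  proof (rule Bochner_Integration.integrable_bound)
    show "integrable lborel (\<lambda>x. ?N x * C)"
      using integrable_std_normal_moment[of 0] by simp
    show "(\<lambda>x. ?N x * f (x\<^sup>2 + s)) \<in> borel_measurable lborel" using that(1) by simp
    show "AE x in lborel. norm (?N x * f (x\<^sup>2 + s)) \<le> norm (?N x * C)"
      using that(2) by (intro AE_I2) (auto simp: abs_mult intro!: mult_left_mono order_trans[OF that(2) abs_ge_self])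
  qed
  have I2: "integrable lborel (\<lambda>x. ?N x * (x\<^sup>2 * g (x\<^sup>2 + s)))"
    using i1[OF meas(1) gb] by (simp add: mult.assoc)
  have I1: "integrable lborel (\<lambda>x. ?N x * (g (x\<^sup>2 + s) + 2 * x\<^sup>2 * g' (x\<^sup>2 + s)))"
    using Bochner_Integration.integrable_add[OF i0[OF meas(1) gb] integrable_mult_right[OF i1[OF meas(2) g'b], of 2]]
    by (simp add: algebra_simps)
  have D: "(u has_real_derivative v x) (at x)" for x
    unfolding u_def v_def std_normal_density_def
    apply (rule derivative_eq_intros DERIV_chain2[OF g] refl | simp)+
    apply (simp add: field_simps power2_eq_square)
    done
  have vc: "isCont v x" for x
  proof -
    have "continuous_on UNIV v"
      unfolding v_def
      by (intro continuous_intros Nc continuous_on_UNIV_compose[OF gc] continuous_on_UNIV_compose[OF g'c])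
    then show ?thesis by (simp add: continuous_on_eq_continuous_at)
  qed
  have vint: "integrable lborel v" unfolding v_def by (intro Bochner_Integration.integrable_diff I1 I2)
  have A0: "A \<ge> 0" using gb[of 0] by (smt (verit))
  have lim: "(u \<longlongrightarrow> 0) F" if F: "((\<lambda>x. A * (\<bar>x\<bar> * ?N x)) \<longlongrightarrow> 0) F" for F
  proof (rule Lim_null_comparison[OF _ F])
    show "\<forall>\<^sub>F x in F. norm (u x) \<le> A * (\<bar>x\<bar> * ?N x)"
    proof (rule always_eventually, rule allI)
      fix x
      have "\<bar>g (x\<^sup>2 + s)\<bar> * (\<bar>x\<bar> * ?N x) \<le> A * (\<bar>x\<bar> * ?N x)"
        using gb by (intro mult_right_mono) auto
      then show "norm (u x) \<le> A * (\<bar>x\<bar> * ?N x)"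
        by (simp add: u_def abs_mult mult_ac)
    qed
  qed
  have lims: "((\<lambda>x. A * (\<bar>x\<bar> * ?N x)) \<longlongrightarrow> 0) at_top" "((\<lambda>x. A * (\<bar>x\<bar> * ?N x)) \<longlongrightarrow> 0) at_bot"
    unfolding std_normal_density_def by real_asymp+
  have "(LBINT x=-\<infinity>..\<infinity>. v x) = 0 - 0"
  proof (rule interval_integral_FTC_integrable)
    show "((u \<circ> real_of_ereal) \<longlongrightarrow> 0) (at_right (-\<infinity>))" "((u \<circ> real_of_ereal) \<longlongrightarrow> 0) (at_left \<infinity>)"
      using lim[OF lims(1)] lim[OF lims(2)] by (simp_all add: ereal_tendsto_simps)
    show "set_integrable lborel (einterval (-\<infinity>) \<infinity>) v"
      using vint by (simp add: set_integrable_def einterval_def)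
  qed (use D vc in \<open>auto simp: has_real_derivative_iff_has_vector_derivative[symmetric]\<close>)
  then have "integral\<^sup>L lborel v = 0"
    by (simp add: interval_lebesgue_integral_def set_lebesgue_integral_def)
  then have "(\<integral>x. ?N x * (g (x\<^sup>2 + s) + 2 * x\<^sup>2 * g' (x\<^sup>2 + s)) \<partial>lborel) = (\<integral>x. ?N x * (x\<^sup>2 * g (x\<^sup>2 + s)) \<partial>lborel)"
    unfolding v_def by (subst (asm) Bochner_Integration.integral_diff[OF I1 I2]) simp
  then show ?thesis
    using meas by (simp add: integral_density normal_density_nonneg)
qed

abbreviation gaussian_product :: "nat set \<Rightarrow> (nat \<Rightarrow> real) measure" where
  "gaussian_product I \<equiv> (\<Pi>\<^sub>M i\<in>I. density lborel std_normal_density)"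

lemma prob_space_std_normal: "prob_space (density lborel std_normal_density)"
  by (rule prob_space_normal_density) simp

lemma product_prob_space_std_normal: "product_prob_space (\<lambda>_. density lborel std_normal_density)"
  by (simp add: product_prob_spaceI prob_space_std_normal)

lemma gaussian_product_square_integrable:
  assumes "i \<in> I" shows "integrable (gaussian_product I) (\<lambda>x. (x i)\<^sup>2)"
proof -
  interpret product_prob_space "\<lambda>_::nat. density lborel std_normal_density" I
    by (rule product_prob_space_std_normal)
  have "integrable (density lborel std_normal_density) (\<lambda>x. x\<^sup>2)"
    using integrable_std_normal_moment[of 2] by (simp add: integrable_density normal_density_nonneg)
  then have "integrable (distr (gaussian_product I) (density lborel std_normal_density) (\<lambda>x. x i)) (\<lambda>x. x\<^sup>2)"
    using PiM_component[OF assms] by simp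
  then show ?thesis using assms by (subst (asm) integrable_distr_eq) auto
qed

text \<open>Gaussian integration by parts in each coordinate, summed over the coordinates. This identifies the
  chi-square mean without computing the density of a sum of squares.\<close>

lemma chi_square_stein_identity:
  assumes g: "\<And>y. (g has_real_derivative g' y) (at y)" and g'c: "continuous_on UNIV g'"
    and gb: "\<And>y. \<bar>g y\<bar> \<le> A" and g'b: "\<And>y. \<bar>g' y\<bar> \<le> B"
    and I: "finite I"
  defines "S \<equiv> \<lambda>x::nat \<Rightarrow> real. \<Sum>i\<in>I. (x i)\<^sup>2"
  shows "integrable (gaussian_product I) (\<lambda>x. 2 * S x * g' (S x) + (real (card I) - S x) * g (S x))"
    and "(\<integral>x. 2 * S x * g' (S x) + (real (card I) - S x) * g (S x) \<partial>gaussian_product I) = 0"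
proof -
  let ?P = "gaussian_product I"
  interpret product_prob_space "\<lambda>_::nat. density lborel std_normal_density" I
    by (rule product_prob_space_std_normal)
  have gc: "continuous_on UNIV g" using g by (rule has_derivative_imp_continuous_on)
  have gm: "g \<in> borel_measurable borel" "g' \<in> borel_measurable borel"
    using gc g'c by (auto intro: borel_measurable_continuous_onI)
  have Sm: "S \<in> borel_measurable ?P" unfolding S_def by measurable
  have i1: "integrable ?P (\<lambda>x. (x i)\<^sup>2 * f (S x))"
    if "i \<in> I" "f \<in> borel_measurable borel" "\<And>y. \<bar>f y\<bar> \<le> C" for i f C
  proof (rule Bochner_Integration.integrable_bound)
    show "integrable ?P (\<lambda>x. (x i)\<^sup>2 * C)"
      using gaussian_product_square_integrable[OF that(1)] by simp
    show "(\<lambda>x. (x i)\<^sup>2 * f (S x)) \<in> borel_measurable ?P"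
      using that Sm by measurable
    show "AE x in ?P. norm ((x i)\<^sup>2 * f (S x)) \<le> norm ((x i)\<^sup>2 * C)"
      using that(3) by (intro AE_I2) (auto simp: abs_mult intro!: mult_left_mono order_trans[OF that(3) abs_ge_self])
  qed
  have i0: "integrable ?P (\<lambda>x. g (S x))"
    by (rule integrable_const_bound[of _ A]) (use gb gm Sm in auto)
  have step: "(\<integral>x. (x i)\<^sup>2 * g (S x) \<partial>?P) = (\<integral>x. g (S x) + 2 * (x i)\<^sup>2 * g' (S x) \<partial>?P)" if i: "i \<in> I" for i
  proof -
    define J where "J = I - {i}"
    have IJ: "I = insert i J" "i \<notin> J" "finite J" using i I by (auto simp: J_def)
    have Su: "S (x(i := y)) = y\<^sup>2 + (\<Sum>j\<in>J. (x j)\<^sup>2)" for x y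
    proof -
      have "S (x(i := y)) = y\<^sup>2 + (\<Sum>j\<in>J. ((x(i := y)) j)\<^sup>2)"
        unfolding S_def IJ(1) using IJ(2,3) by simp
      also have "(\<Sum>j\<in>J. ((x(i := y)) j)\<^sup>2) = (\<Sum>j\<in>J. (x j)\<^sup>2)"
        using IJ(2) by (intro sum.cong) auto
      finally show ?thesis .
    qed
    have e1: "integrable (gaussian_product (insert i J)) (\<lambda>x. (x i)\<^sup>2 * g (S x))"
      using i1[OF i gm(1) gb] IJ(1) by simp
    have e2: "integrable (gaussian_product (insert i J)) (\<lambda>x. g (S x) + 2 * (x i)\<^sup>2 * g' (S x))"
      using Bochner_Integration.integrable_add[OF i0 integrable_mult_right[OF i1[OF i gm(2) g'b], of 2]] IJ(1)
      by (simp add: mult.assoc)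
    show ?thesis
      unfolding IJ(1) product_integral_insert[OF IJ(3,2) e1] product_integral_insert[OF IJ(3,2) e2]
      by (simp only: Su fun_upd_same std_normal_integration_by_parts[OF g g'c gb g'b])
  qed
  have eq: "2 * S x * g' (S x) + (real (card I) - S x) * g (S x)
      = (\<Sum>i\<in>I. (g (S x) + 2 * (x i)\<^sup>2 * g' (S x)) - (x i)\<^sup>2 * g (S x))" for x
    by (simp add: sum.distrib sum_subtractf S_def sum_distrib_left sum_distrib_right algebra_simps)
  have i2: "integrable ?P (\<lambda>x. (g (S x) + 2 * (x i)\<^sup>2 * g' (S x)) - (x i)\<^sup>2 * g (S x))" if "i \<in> I" for i
    using Bochner_Integration.integrable_diff[OF Bochner_Integration.integrable_add[OF i0 integrable_mult_right[OF i1[OF that gm(2) g'b], of 2]] i1[OF that gm(1) gb]]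
    by (simp add: mult.assoc)
  show "integrable ?P (\<lambda>x. 2 * S x * g' (S x) + (real (card I) - S x) * g (S x))"
    unfolding eq by (intro Bochner_Integration.integrable_sum i2)
  have "(\<integral>x. (g (S x) + 2 * (x i)\<^sup>2 * g' (S x)) - (x i)\<^sup>2 * g (S x) \<partial>?P) = 0" if "i \<in> I" for i
    using Bochner_Integration.integral_diff[OF Bochner_Integration.integrable_add[OF i0 integrable_mult_right[OF i1[OF that gm(2) g'b], of 2]] i1[OF that gm(1) gb]]
      step[OF that] by (simp add: mult.assoc)
  then show "(\<integral>x. 2 * S x * g' (S x) + (real (card I) - S x) * g (S x) \<partial>?P) = 0"
    unfolding eq by (subst Bochner_Integration.integral_sum[OF i2]) auto
qed

section \<open>Bounds on the solution of the chi-square Stein equation\<close>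

text \<open>The hyperbolic barrier again, this time for a source that is merely continuous, as is the case for
  the equation satisfied by the second derivative.\<close>

lemma laguerre_inverse_abs_le_hyperbola:
  assumes n: "n \<ge> 1" and y: "0 < y" "y < real n" and rc: "continuous_on UNIV r"
    and R: "\<And>x. 0 \<le> x \<Longrightarrow> x \<le> y \<Longrightarrow> \<bar>r x\<bar> \<le> R"
  shows "\<bar>laguerre_inverse n r y\<bar> \<le> R / (real n - y)"
proof -
  have R0: "R \<ge> 0" using R[of 0] y by (smt (verit))
  define W where "W = (\<lambda>v. v ^ (n - 1) * exp (y * (1 - v\<^sup>2) / 2))"
  define \<rho> where "\<rho> = (\<lambda>x. 2 * x * (R / (real n - x)\<^sup>2) + (real n - x) * (R / (real n - x)))"
  have x: "0 \<le> y * v\<^sup>2" "y * v\<^sup>2 \<le> y" if "v \<in> {0..1}" for v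
    using that y by (auto simp: power_le_one mult_le_cancel_left2)
  let ?\<Phi> = "\<lambda>v. v ^ n * exp (y * (1 - v\<^sup>2) / 2) * (R / (real n - y * v\<^sup>2))"
  obtain k where k: "n = Suc k" using n by (cases n) auto
  have D: "(?\<Phi> has_real_derivative W v * \<rho> (y * v\<^sup>2)) (at v)" if v: "v \<in> {0..1}" for v
  proof -
    have ne: "real n - y * v\<^sup>2 \<noteq> 0" using x[OF v] y by linarith
    have G: "((\<lambda>v. R / (real n - y * v\<^sup>2)) has_real_derivative R * (2 * y * v) / (real n - y * v\<^sup>2)\<^sup>2) (at v)"
      using ne by (auto intro!: derivative_eq_intros simp: power2_eq_square)
    have E: "((\<lambda>v. v ^ n * exp (y * (1 - v\<^sup>2) / 2)) has_real_derivative
        real n * v ^ (n - 1) * exp (y * (1 - v\<^sup>2) / 2) + v ^ n * (exp (y * (1 - v\<^sup>2) / 2) * (- (y * v)))) (at v)"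
      by (auto intro!: derivative_eq_intros)
    have "(?\<Phi> has_real_derivative (real n * v ^ (n - 1) * exp (y * (1 - v\<^sup>2) / 2) + v ^ n * (exp (y * (1 - v\<^sup>2) / 2) * (- (y * v)))) * (R / (real n - y * v\<^sup>2))
        + v ^ n * exp (y * (1 - v\<^sup>2) / 2) * (R * (2 * y * v) / (real n - y * v\<^sup>2)\<^sup>2)) (at v)"
      using DERIV_mult[OF E G] by (simp add: algebra_simps)
    moreover have "(real n * v ^ (n - 1) * exp (y * (1 - v\<^sup>2) / 2) + v ^ n * (exp (y * (1 - v\<^sup>2) / 2) * (- (y * v)))) * (R / (real n - y * v\<^sup>2))
        + v ^ n * exp (y * (1 - v\<^sup>2) / 2) * (R * (2 * y * v) / (real n - y * v\<^sup>2)\<^sup>2) = W v * \<rho> (y * v\<^sup>2)"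
      unfolding W_def \<rho>_def by (simp add: k algebra_simps power2_eq_square add_divide_distrib diff_divide_distrib)
    ultimately show ?thesis by simp
  qed
  have "((\<lambda>v. W v * \<rho> (y * v\<^sup>2)) has_integral ?\<Phi> 1 - ?\<Phi> 0) {0..1}"
    using D by (intro fundamental_theorem_of_calculus)
       (auto simp: has_real_derivative_iff_has_vector_derivative[symmetric] intro: DERIV_subset)
  then have I: "((\<lambda>v. W v * \<rho> (y * v\<^sup>2)) has_integral R / (real n - y)) {0..1}"
    using n by (simp add: power_0_left)
  have "norm (laguerre_inverse n r y) \<le> integral {0..1} (\<lambda>v. W v * \<rho> (y * v\<^sup>2))"
    unfolding laguerre_inverse_def
  proof (rule integral_norm_bound_integral)
    show "(\<lambda>v. v ^ (n - 1) * exp (y * (1 - v\<^sup>2) / 2) * r (y * v\<^sup>2)) integrable_on {0..1}"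
      using laguerre_inverse_has_integral[OF rc] by blast
    show "(\<lambda>v. W v * \<rho> (y * v\<^sup>2)) integrable_on {0..1}" using I by blast
    fix v :: real assume v: "v \<in> {0..1}"
    have "real n - y * v\<^sup>2 > 0" using x[OF v] y by linarith
    then have "\<rho> (y * v\<^sup>2) \<ge> R" using R0 x[OF v] by (simp add: \<rho>_def)
    then have "\<bar>r (y * v\<^sup>2)\<bar> \<le> \<rho> (y * v\<^sup>2)" using R[OF x[OF v]] by linarith
    then show "norm (v ^ (n - 1) * exp (y * (1 - v\<^sup>2) / 2) * r (y * v\<^sup>2)) \<le> W v * \<rho> (y * v\<^sup>2)"
      using v by (simp add: W_def abs_mult mult_left_mono)
  qed
  then show ?thesis unfolding integral_unique[OF I] by simp
qed

lemma lipschitz_of_DERIV_bound: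
  fixes g :: "real \<Rightarrow> real"
  assumes "\<And>x. (g has_real_derivative g' x) (at x)" "\<And>x. \<bar>g' x\<bar> \<le> C"
  shows "\<bar>g y - g x\<bar> \<le> C * \<bar>y - x\<bar>"
  using field_differentiable_bound[of UNIV g g' C y x] assms
  by (auto simp: has_field_derivative_at_within)

text \<open>The sources of the equations for \<open>F\<close>, \<open>F'\<close>, \<open>F''\<close> are \<open>\<phi> - E \<phi>\<close>, \<open>\<phi>' + F\<close> and \<open>\<phi>'' + 2 F'\<close>. On the support
  of the chi-square law \<open>|F| \<le> 1\<close>, because \<open>F \<plusminus> 1\<close> has a monotone source; hence the source of \<open>F'\<close> is
  bounded by \<open>2\<close> and the barriers apply. To the left of the support the integral formula gives
  \<open>|F| \<le> 2/\<nu>\<close> and \<open>|F'| \<le> 1/\<nu>\<close>. The bound on \<open>F''\<close> decays like \<open>1/\<nu>\<close>: for \<open>y \<ge> \<nu>/2\<close> it is read off from the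
  equation for \<open>F'\<close>, since the hyperbolic barrier bounds \<open>(\<nu> + 2 - y) F'\<close>; for \<open>y \<le> \<nu>/2\<close> the hyperbolic
  barrier is applied to \<open>F''\<close>.\<close>

theorem chi_square_stein_solution:
  fixes \<phi> \<phi>' \<phi>'' :: "real \<Rightarrow> real"
  assumes \<nu>: "\<nu> \<ge> 1"
    and \<phi>: "\<And>x. (\<phi> has_real_derivative \<phi>' x) (at x)" "\<And>x. (\<phi>' has_real_derivative \<phi>'' x) (at x)"
    and \<phi>''c: "continuous_on UNIV \<phi>''"
    and \<phi>b: "\<And>x. \<bar>\<phi> x\<bar> \<le> 1" "\<And>x. \<bar>\<phi>' x\<bar> \<le> 1" "\<And>x. \<bar>\<phi>'' x\<bar> \<le> C"
  obtains F F' F'' where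
    "\<And>x. (F has_real_derivative F' x) (at x)" "\<And>x. (F' has_real_derivative F'' x) (at x)"
    "\<And>x. \<bar>F x\<bar> \<le> 2"
    "\<And>x. \<bar>F' x\<bar> \<le> max (sqrt (2 * pi / real \<nu>)) (1 / real \<nu> + 2 / (real \<nu>)\<^sup>2)"
    "\<And>x. \<bar>F'' x\<bar> \<le> (2 * C + 4) / real \<nu>"
    "\<And>x. 2 * (x + real \<nu>) * F' x - x * F x = \<phi> x - (\<integral>x. \<phi> x \<partial>centered_chi_square \<nu>)"
proof -
  let ?K = "max (sqrt (2 * pi / real \<nu>)) (1 / real \<nu> + 2 / (real \<nu>)\<^sup>2)"
  have \<nu>0: "real \<nu> \<ge> 1" using \<nu> by simp
  define h h' h'' where hdefs: "h = (\<lambda>y. \<phi> (y - real \<nu>))" "h' = (\<lambda>y. \<phi>' (y - real \<nu>))" "h'' = (\<lambda>y. \<phi>'' (y - real \<nu>))"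
  have hD: "(h has_real_derivative h' y) (at y)" "(h' has_real_derivative h'' y) (at y)" for y
    using \<phi>(1)[of "y + - real \<nu>"] \<phi>(2)[of "y + - real \<nu>"] unfolding DERIV_shift hdefs by simp_all
  have hb: "\<bar>h y\<bar> \<le> 1" "\<bar>h' y\<bar> \<le> 1" "\<bar>h'' y\<bar> \<le> C" for y
    unfolding hdefs by (rule \<phi>b)+
  have hc: "continuous_on UNIV h" "continuous_on UNIV h'" "continuous_on UNIV h''"
    using has_derivative_imp_continuous_on[OF hD(1)] has_derivative_imp_continuous_on[OF hD(2)]
    by (auto simp: hdefs intro!: continuous_on_UNIV_compose[OF \<phi>''c] continuous_intros)
  have hm: "h \<in> borel_measurable borel" using hc(1) by (rule borel_measurable_continuous_onI)
  define k where "k = chi_kernel \<nu>"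
  have kint: "set_integrable lborel {0..} k" using chi_kernel_mult_integrable[of "\<lambda>_. 1" 1 \<nu>] by (simp add: k_def)
  have khint: "set_integrable lborel {0..} (\<lambda>w. k w * h (w\<^sup>2))"
    unfolding k_def by (rule chi_kernel_mult_integrable[of _ 1]) (use hm hb in auto)
  have kpos: "(LBINT w:{0..}. k w) > 0" unfolding k_def by (rule chi_kernel_integral_pos)
  \<comment> \<open>The mean of h under the chi-square law; that it agrees with the Gaussian definition of the law is shown last.\<close>
  define m where "m = (LBINT w:{0..}. k w * h (w\<^sup>2)) / (LBINT w:{0..}. k w)"
  have "\<bar>LBINT w:{0..}. k w * h (w\<^sup>2)\<bar> \<le> (LBINT w:{0..}. k w)"
  proof -
    have "\<bar>LBINT w:{0..}. k w * h (w\<^sup>2)\<bar> \<le> (\<integral>w. \<bar>indicator {0..} w *\<^sub>R (k w * h (w\<^sup>2))\<bar> \<partial>lborel)"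
      unfolding set_lebesgue_integral_def by (rule integral_abs_bound)
    also have "\<dots> \<le> (\<integral>w. indicator {0..} w *\<^sub>R k w \<partial>lborel)"
    proof (rule integral_mono)
      show "integrable lborel (\<lambda>w. \<bar>indicator {0..} w *\<^sub>R (k w * h (w\<^sup>2))\<bar>)"
        using khint unfolding set_integrable_def by (rule integrable_abs)
      show "integrable lborel (\<lambda>w. indicator {0..} w *\<^sub>R k w)" using kint unfolding set_integrable_def .
      fix w :: real
      have "\<bar>k w\<bar> * \<bar>h (w\<^sup>2)\<bar> \<le> \<bar>k w\<bar> * 1" using hb by (intro mult_left_mono) auto
      then show "\<bar>indicator {0..} w *\<^sub>R (k w * h (w\<^sup>2))\<bar> \<le> indicator {0..} w *\<^sub>R k w"
        by (auto simp: abs_mult k_def chi_kernel_def split: split_indicator)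
    qed
    finally show ?thesis by (simp add: set_lebesgue_integral_def)
  qed
  then have m1: "\<bar>m\<bar> \<le> 1" using kpos by (simp add: m_def)
  define r where "r = (\<lambda>y. h y - m)"
  have rD: "(r has_real_derivative h' y) (at y)" for y
    unfolding r_def using hD(1)[of y] by (auto intro!: derivative_eq_intros)
  have rc: "continuous_on UNIV r" using rD by (rule has_derivative_imp_continuous_on)
  have rb: "\<bar>r y\<bar> \<le> 2" for y using hb(1)[of y] m1 by (simp add: r_def)

  define f where "f = laguerre_inverse \<nu> r"
  define f1 where "f1 = laguerre_inverse (\<nu> + 2) (\<lambda>x. h' x + f x)"
  define f2 where "f2 = laguerre_inverse (\<nu> + 2 + 2) (\<lambda>x. (h'' x + f1 x) + f1 x)"
  have fD: "(f has_real_derivative f1 y) (at y)" for y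
    unfolding f1_def f_def by (rule laguerre_inverse_DERIV[OF \<nu> rD hc(2)])
  have f_ode: "2 * y * f1 y + (real \<nu> - y) * f y = r y" for y
    unfolding f1_def f_def by (rule laguerre_inverse_ode[OF \<nu> rD hc(2)])
  have r1D: "((\<lambda>x. h' x + f x) has_real_derivative h'' y + f1 y) (at y)" for y
    by (intro DERIV_add hD fD)
  have fc: "continuous_on S f" for S using fD by (rule has_derivative_imp_continuous_on)
  have f1c: "continuous_on UNIV f1"
  proof -
    have 1: "continuous_on UNIV (\<lambda>x. h' x + f x)" using r1D by (rule has_derivative_imp_continuous_on)
    have "continuous_on UNIV (\<lambda>y. integral (cbox 0 1) (\<lambda>v. v ^ (\<nu> + 2 - 1) * exp (y * (1 - v\<^sup>2) / 2) * (h' (y * v\<^sup>2) + f (y * v\<^sup>2))))"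
      apply (rule integral_continuous_on_param)
      unfolding case_prod_beta
      by (intro continuous_intros continuous_on_UNIV_compose[OF hc(2)] continuous_on_UNIV_compose[OF fc]) auto
    then show ?thesis unfolding f1_def laguerre_inverse_def by simp
  qed
  have r1D': "continuous_on UNIV (\<lambda>x. h'' x + f1 x)" by (intro continuous_intros hc f1c)
  have n2: "1 \<le> \<nu> + 2" "1 \<le> \<nu> + 2 + 2" by auto
  have f1D: "(f1 has_real_derivative f2 y) (at y)" for y
    unfolding f2_def f1_def by (rule laguerre_inverse_DERIV[OF n2(1) r1D r1D', unfolded f1_def])
  have f1_ode: "2 * y * f2 y + (real (\<nu> + 2) - y) * f1 y = h' y + f y" for y
    unfolding f2_def f1_def by (rule laguerre_inverse_ode[OF n2(1) r1D r1D', unfolded f1_def])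

  have limf: "((\<lambda>y. gamma_weight \<nu> y * f y) \<longlongrightarrow> 0) at_top"
  proof -
    have "(LBINT w:{0..}. k w * r (w\<^sup>2)) = (LBINT w:{0..}. k w * h (w\<^sup>2) - m * k w)"
      by (simp add: r_def algebra_simps)
    also have "\<dots> = (LBINT w:{0..}. k w * h (w\<^sup>2)) - (LBINT w:{0..}. m * k w)"
      by (rule set_integral_diff(2)[OF khint]) (use kint in simp)
    also have "\<dots> = 0" using kpos by (simp add: m_def)
    finally show ?thesis
      using gamma_weight_mult_tendsto[OF \<nu> fD f_ode rc rb] by (simp add: k_def)
  qed
  have one: "((\<lambda>y. gamma_weight \<nu> y * 1) \<longlongrightarrow> 0) at_top" using gamma_weight_tendsto_0 by simp
  have lip: "\<bar>r y - r x\<bar> \<le> \<bar>y - x\<bar>" for x y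
    using lipschitz_of_DERIV_bound[OF rD hb(2), of y x] by simp
  have f_pos: "\<bar>f y\<bar> \<le> 1" if y: "y > 0" for y
  proof -
    have "f y + 1 \<ge> 0"
    proof (rule nonneg_of_antitone_source[OF \<nu> _ _ _ y, where u'=f1])
      show "((\<lambda>y. f y + 1) has_real_derivative f1 y) (at y)" for y
        using fD[of y] by (auto intro!: derivative_eq_intros)
      show "2 * y * f1 y + (real \<nu> - y) * (f y + 1) \<le> 2 * x * f1 x + (real \<nu> - x) * (f x + 1)"
        if "0 < x" "x \<le> y" for x y
        using f_ode[of x] f_ode[of y] lip[of x y] that by (simp add: algebra_simps)
      show "((\<lambda>y. gamma_weight \<nu> y * (f y + 1)) \<longlongrightarrow> 0) at_top"
        using tendsto_add[OF limf one] by (simp add: algebra_simps)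
    qed
    moreover have "1 - f y \<ge> 0"
    proof (rule nonneg_of_antitone_source[OF \<nu> _ _ _ y, where u'="\<lambda>y. - f1 y"])
      show "((\<lambda>y. 1 - f y) has_real_derivative - f1 y) (at y)" for y
        using fD[of y] by (auto intro!: derivative_eq_intros)
      show "2 * y * - f1 y + (real \<nu> - y) * (1 - f y) \<le> 2 * x * - f1 x + (real \<nu> - x) * (1 - f x)"
        if "0 < x" "x \<le> y" for x y
        using f_ode[of x] f_ode[of y] lip[of x y] that by (simp add: algebra_simps)
      show "((\<lambda>y. gamma_weight \<nu> y * (1 - f y)) \<longlongrightarrow> 0) at_top"
        using tendsto_diff[OF one limf] by (simp add: algebra_simps)
    qed
    ultimately show ?thesis by linarith
  qed
  have f_neg: "\<bar>f y\<bar> \<le> 2 / real \<nu>" if "y \<le> 0" for y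
    unfolding f_def by (rule laguerre_inverse_abs_le_nonpos[OF \<nu> that rc rb])
  have f_le2: "\<bar>f y\<bar> \<le> 2" for y
  proof (cases "y > 0")
    case False
    then have "\<bar>f y\<bar> \<le> 2 / real \<nu>" using f_neg[of y] by simp
    also have "\<dots> \<le> 2" using \<nu>0 by (simp add: field_simps)
    finally show ?thesis .
  qed (use f_pos[of y] in auto)
  have r1c: "continuous_on UNIV (\<lambda>x. h' x + f x)" by (intro continuous_intros hc fc)
  have f1_neg: "\<bar>f1 y\<bar> \<le> 1 / real \<nu>" if y: "y \<le> 0" for y
  proof -
    have "\<bar>f1 y\<bar> \<le> (1 + 2 / real \<nu>) / real (\<nu> + 2)"
      unfolding f1_def
    proof (rule laguerre_inverse_abs_le_nonpos[OF n2(1) y r1c])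
      fix x :: real assume "x \<le> 0"
      then show "\<bar>h' x + f x\<bar> \<le> 1 + 2 / real \<nu>" using hb(2)[of x] f_neg[of x] by linarith
    qed
    also have "\<dots> = 1 / real \<nu>" using \<nu>0 by (simp add: divide_simps)
    finally show ?thesis .
  qed
  interpret eq: laguerre_equation "\<nu> + 2" 2 "\<lambda>y. h' y + f y" f1 f2
    by unfold_locales (use f1D f1_ode in auto)
  have r1b: "\<bar>h' y + f y\<bar> \<le> 2" if "y > 0" for y
    using hb(2)[of y] f_pos[OF that] by linarith
  have limf1: "((\<lambda>y. gamma_weight (\<nu> + 2) y * f1 y) \<longlongrightarrow> 0) at_top"
  proof -
    have *: "((\<lambda>y. gamma_weight \<nu> y * ((r y - real \<nu> * f y) / 2)) \<longlongrightarrow> 0) at_top"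
    proof (rule gamma_weight_times_bounded_tendsto_0[of 1])
      fix y :: real assume "1 \<le> y"
      then have "real \<nu> * \<bar>f y\<bar> \<le> real \<nu> * 1" by (intro mult_left_mono f_pos) auto
      moreover have "\<bar>(r y - real \<nu> * f y) / 2\<bar> \<le> (\<bar>r y\<bar> + real \<nu> * \<bar>f y\<bar>) / 2"
        using abs_triangle_ineq4[of "r y" "real \<nu> * f y"] by (simp add: abs_mult)
      ultimately show "\<bar>(r y - real \<nu> * f y) / 2\<bar> \<le> (2 + real \<nu>) / 2" using rb[of y] by simp
    qed
    have **: "((\<lambda>y. gamma_weight (\<nu> + 2) y * (f y / 2)) \<longlongrightarrow> 0) at_top"
      by (rule gamma_weight_times_bounded_tendsto_0[of 1 _ "1 / 2"]) (use f_pos in auto)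
    have "\<forall>\<^sub>F y in at_top. gamma_weight \<nu> y * ((r y - real \<nu> * f y) / 2) + gamma_weight (\<nu> + 2) y * (f y / 2)
         = gamma_weight (\<nu> + 2) y * f1 y"
      using eventually_gt_at_top[of 0]
    proof eventually_elim
      case (elim y)
      have "y * f1 y = (r y - real \<nu> * f y) / 2 + y * (f y / 2)"
        using f_ode[of y] by (simp add: field_simps)
      then have "gamma_weight \<nu> y * (y * f1 y) = gamma_weight \<nu> y * ((r y - real \<nu> * f y) / 2 + y * (f y / 2))"
        by simp
      then show ?case using elim by (simp add: gamma_weight_add2[of y \<nu>, simplified] algebra_simps)
    qed
    with tendsto_add[OF * **] show ?thesis by (simp add: Lim_transform_eventually)
  qed
  have f1_K: "\<bar>f1 y\<bar> \<le> ?K" for y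
  proof (cases "y > 0")
    case False
    then have "\<bar>f1 y\<bar> \<le> 1 / real \<nu>" using f1_neg by simp
    also have "\<dots> \<le> 1 / real \<nu> + 2 / (real \<nu>)\<^sup>2" by simp
    finally show ?thesis by simp
  next
    case y: True
    have c: "5 / 4 * 2 / sqrt (real (\<nu> + 2)) \<le> ?K"
    proof -
      \<comment> \<open>The height of the parabolic barrier for R = 2 and a = \<nu> + 2.\<close>
      have "5 / 4 * 2 / sqrt (real (\<nu> + 2)) \<le> 5 / 2 / sqrt (real \<nu>)"
        using \<nu>0 by (intro frac_le) auto
      also have "5 / 2 \<le> sqrt (2 * pi)"
        using pi_approx by (intro real_le_rsqrt) (simp add: power2_eq_square)
      then have "5 / 2 / sqrt (real \<nu>) \<le> sqrt (2 * pi) / sqrt (real \<nu>)"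
        using \<nu>0 by (intro divide_right_mono) auto
      also have "\<dots> = sqrt (2 * pi / real \<nu>)" by (simp add: real_sqrt_divide)
      finally show ?thesis by simp
    qed
    show ?thesis
    proof (cases "y \<ge> real (\<nu> + 2)")
      case True
      then have "\<bar>f1 y\<bar> \<le> 5 / 4 * 2 / sqrt (real (\<nu> + 2))"
        by (intro eq.abs_le_center_right r1b limf1) auto
      with c show ?thesis by linarith
    next
      case yl: False
      show ?thesis
      proof (cases "\<nu> = 1")
        case True
        \<comment> \<open>For \<nu> = 1 the required bound is 3, the value of 1/\<nu> + 2/\<nu>^2.\<close>
        have "\<bar>f1 y\<bar> \<le> 2 * (1 / real (\<nu> + 2) + 1 / 2)"
          using y yl by (intro eq.abs_le_linear_left r1b) auto
        then have "\<bar>f1 y\<bar> \<le> 3" using True by simp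
        then show ?thesis using True by simp
      next
        case False
        then have "\<bar>f1 y\<bar> \<le> 5 / 4 * 2 / sqrt (real (\<nu> + 2))"
          using \<nu> y yl by (intro eq.abs_le_center_left r1b) auto
        with c show ?thesis by linarith
      qed
    qed
  qed
  have f1_small: "\<bar>f1 y\<bar> \<le> 1" if y: "y \<le> real \<nu> / 2" for y
  proof (cases "y > 0")
    case False
    then have "\<bar>f1 y\<bar> \<le> 1 / real \<nu>" using f1_neg by simp
    also have "\<dots> \<le> 1" using \<nu>0 by simp
    finally show ?thesis .
  next
    case True
    have "\<bar>f1 y\<bar> \<le> 2 / (real (\<nu> + 2) - y)"
      using True y by (intro eq.abs_le_hyperbola_left r1b) auto
    also have "\<dots> \<le> 1" using y \<nu>0 by (simp add: field_simps)
    finally show ?thesis .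
  qed
  have C0: "C \<ge> 0" using hb(3)[of 0] by (smt (verit))
  have r2c: "continuous_on UNIV (\<lambda>x. (h'' x + f1 x) + f1 x)" by (intro continuous_intros hc f1c)
  have r2b: "\<bar>(h'' x + f1 x) + f1 x\<bar> \<le> C + 2" if "x \<le> real \<nu> / 2" for x
    using hb(3)[of x] f1_small[OF that] by linarith
  have f2_b: "\<bar>f2 y\<bar> \<le> (2 * C + 4) / real \<nu>" for y
  proof (cases "y \<ge> real \<nu> / 2")
    case True
    then have y0: "y > 0" using \<nu>0 by simp
    have D: "\<bar>(real (\<nu> + 2) - y) * f1 y\<bar> \<le> 2"
    proof -
      consider "y < real (\<nu> + 2)" | "y = real (\<nu> + 2)" | "y > real (\<nu> + 2)" by linarith
      then show ?thesis
      proof cases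
        case 1
        then have "\<bar>f1 y\<bar> \<le> 2 / (real (\<nu> + 2) - y)"
          using y0 by (intro eq.abs_le_hyperbola_left r1b) auto
        then have "(real (\<nu> + 2) - y) * \<bar>f1 y\<bar> \<le> 2" using 1 by (simp add: pos_le_divide_eq mult.commute)
        then show ?thesis using 1 unfolding abs_mult by simp
      next
        case 3
        then have "\<bar>f1 y\<bar> \<le> 2 / (y - real (\<nu> + 2))"
          using y0 by (intro eq.abs_le_hyperbola_right r1b limf1) auto
        then have "(y - real (\<nu> + 2)) * \<bar>f1 y\<bar> \<le> 2" using 3 by (simp add: pos_le_divide_eq mult.commute)
        then show ?thesis using 3 unfolding abs_mult by simp
      qed simp
    qed
    have "\<bar>2 * y * f2 y\<bar> \<le> 4"
      using f1_ode[of y] D r1b[OF y0] by linarith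
    then have "\<bar>f2 y\<bar> \<le> 2 / y" using y0 by (simp add: abs_mult field_simps)
    also have "\<dots> \<le> 2 / (real \<nu> / 2)" using True \<nu>0 y0 by (intro divide_left_mono) auto
    also have "\<dots> \<le> (2 * C + 4) / real \<nu>" using C0 \<nu>0 by (simp add: field_simps)
    finally show ?thesis .
  next
    case False
    show ?thesis
    proof (cases "y > 0")
      case y0: True
      have "\<bar>f2 y\<bar> \<le> (C + 2) / (real (\<nu> + 2 + 2) - y)"
        unfolding f2_def
        using y0 False by (intro laguerre_inverse_abs_le_hyperbola r2c r2b) auto
      also have "\<dots> \<le> (C + 2) / (real \<nu> / 2)" using False C0 \<nu>0 by (intro divide_left_mono mult_pos_pos) auto
      also have "\<dots> = (2 * C + 4) / real \<nu>" using \<nu>0 by (simp add: field_simps)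
      finally show ?thesis .
    next
      case y0: False
      have "\<bar>f2 y\<bar> \<le> (C + 2) / real (\<nu> + 2 + 2)"
        unfolding f2_def
        using y0 by (intro laguerre_inverse_abs_le_nonpos r2c r2b) auto
      also have "\<dots> \<le> (2 * C + 4) / real \<nu>" using C0 \<nu>0 by (intro frac_le) auto
      finally show ?thesis .
    qed
  qed
  have m_eq: "(\<integral>x. \<phi> x \<partial>centered_chi_square \<nu>) = m"
  proof -
    let ?P = "gaussian_product {1..\<nu>}" and ?S = "\<lambda>x::nat \<Rightarrow> real. \<Sum>i\<in>{1..\<nu>}. (x i)\<^sup>2"
    interpret P: prob_space ?P by (intro prob_space_PiM prob_space_std_normal)
    have \<phi>m: "\<phi> \<in> borel_measurable borel"
      using has_derivative_imp_continuous_on[OF \<phi>(1)] by (rule borel_measurable_continuous_onI)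
    have "(\<integral>x. \<phi> x \<partial>centered_chi_square \<nu>) = (\<integral>x. \<phi> (\<Sum>i = 1..\<nu>. ((x i)\<^sup>2 - 1)) \<partial>?P)"
      unfolding centered_chi_square_def
      by (subst integral_distr) (use \<phi>m in measurable)
    also have "\<dots> = (\<integral>x. r (?S x) + m \<partial>?P)"
      by (simp add: r_def hdefs sum_subtractf)
    also have "\<dots> = (\<integral>x. r (?S x) \<partial>?P) + m"
    proof -
      have "integrable ?P (\<lambda>x. r (?S x))"
        using chi_square_stein_identity(1)[OF fD f1c f_le2 f1_K, of "{1..\<nu>}"] by (simp add: f_ode)
      then have "(\<integral>x. r (?S x) + m \<partial>?P) = (\<integral>x. r (?S x) \<partial>?P) + (\<integral>x. m \<partial>?P)"
        by (intro Bochner_Integration.integral_add P.integrable_const)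
      also have "(\<integral>x. m \<partial>?P) = m" using P.prob_space by simp
      finally show ?thesis .
    qed
    also have "(\<integral>x. r (?S x) \<partial>?P) = 0"
      using chi_square_stein_identity(2)[OF fD f1c f_le2 f1_K, of "{1..\<nu>}"] by (simp add: f_ode)
    finally show ?thesis by simp
  qed
  show thesis
  proof (rule that[of "\<lambda>x. f (x + real \<nu>)" "\<lambda>x. f1 (x + real \<nu>)" "\<lambda>x. f2 (x + real \<nu>)"])
    fix x
    show "((\<lambda>x. f (x + real \<nu>)) has_real_derivative f1 (x + real \<nu>)) (at x)"
      "((\<lambda>x. f1 (x + real \<nu>)) has_real_derivative f2 (x + real \<nu>)) (at x)"
      using fD[of "x + real \<nu>"] f1D[of "x + real \<nu>"] by (simp_all add: DERIV_shift)
    show "2 * (x + real \<nu>) * f1 (x + real \<nu>) - x * f (x + real \<nu>) = \<phi> x - (\<integral>x. \<phi> x \<partial>centered_chi_square \<nu>)"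
      using f_ode[of "x + real \<nu>"] by (simp add: m_eq r_def hdefs algebra_simps)
  qed (rule f_le2 f1_K f2_b)+
qed

section \<open>Multilinear polynomials and the components of their squares\<close>

text \<open>Coefficients are indexed by sets, so that a homogeneous sum becomes a sum over subsets in which each
  monomial occurs once.\<close>

definition multilinear :: "(nat set \<Rightarrow> real) \<Rightarrow> nat set \<Rightarrow> (nat \<Rightarrow> real) \<Rightarrow> real" where
  "multilinear c J x = (\<Sum>A\<in>Pow J. c A * (\<Prod>i\<in>A. x i))"

lemma sum_Pow_insert:
  assumes "finite J" "j \<notin> J"
  shows "(\<Sum>A\<in>Pow (insert j J). g A) = (\<Sum>A\<in>Pow J. g A) + (\<Sum>A\<in>Pow J. g (insert j A))"
proof -
  have "inj_on (insert j) (Pow J)" using assms(2) by (auto simp: inj_on_def)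
  moreover have "Pow J \<inter> insert j ` Pow J = {}" using assms(2) by auto
  ultimately show ?thesis using assms(1)
    by (simp add: Pow_insert sum.union_disjoint sum.reindex)
qed

lemma multilinear_insert:
  assumes "finite J" "j \<notin> J"
  shows "multilinear c (insert j J) x = multilinear c J x + x j * multilinear (\<lambda>A. c (insert j A)) J x"
proof -
  have "(\<Sum>A\<in>Pow J. c (insert j A) * (\<Prod>i\<in>insert j A. x i)) = x j * (\<Sum>A\<in>Pow J. c (insert j A) * (\<Prod>i\<in>A. x i))"
    unfolding sum_distrib_left
  proof (intro sum.cong refl)
    fix A assume "A \<in> Pow J"
    then have "finite A" "j \<notin> A" using assms by (auto intro: finite_subset)
    then show "c (insert j A) * (\<Prod>i\<in>insert j A. x i) = x j * (c (insert j A) * (\<Prod>i\<in>A. x i))" by simp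
  qed
  then show ?thesis using assms by (simp add: multilinear_def sum_Pow_insert)
qed

lemma multilinear_empty [simp]: "multilinear c {} x = c {}"
  by (simp add: multilinear_def)

lemma multilinear_restrict: "multilinear c J (restrict x J) = multilinear c J x"
  unfolding multilinear_def by (intro sum.cong refl arg_cong2[where f="(*)"] prod.cong) auto

lemma measurable_multilinear [measurable]:
  "multilinear c J \<in> borel_measurable (\<Pi>\<^sub>M i\<in>J. borel)"
  unfolding multilinear_def by (intro borel_measurable_sum borel_measurable_times borel_measurable_prod) auto

abbreviation partial_coeff :: "nat \<Rightarrow> (nat set \<Rightarrow> real) \<Rightarrow> nat set \<Rightarrow> real" where
  "partial_coeff i c \<equiv> (\<lambda>A. c (insert i A))"

lemma multilinear_split:
  assumes "finite I" "i \<in> I"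
  shows "multilinear c I x = multilinear c (I - {i}) x + x i * multilinear (partial_coeff i c) (I - {i}) x"
  using multilinear_insert[of "I - {i}" i c x] assms by (simp add: insert_absorb)

lemma multilinear_partial_eq:
  assumes "finite I" "i \<in> I"
  shows "multilinear (partial_coeff i c) (I - {i}) x = (\<Sum>A | A \<in> Pow I \<and> i \<in> A. c A * (\<Prod>j\<in>A - {i}. x j))"
  unfolding multilinear_def
proof (rule sum.reindex_bij_witness[where i="\<lambda>A. A - {i}" and j="insert i"])
  fix A assume "A \<in> Pow (I - {i})"
  then have e: "insert i A - {i} = A" by auto
  show "insert i A - {i} = A" by (rule e)
  show "c (insert i A) * (\<Prod>j\<in>insert i A - {i}. x j) = c (insert i A) * (\<Prod>j\<in>A. x j)"
    by (simp only: e)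
qed (use assms in auto)

lemma sum_Pow_mem_swap:
  assumes "finite I"
  shows "(\<Sum>i\<in>I. \<Sum>A | A \<in> Pow I \<and> i \<in> A. g A :: real) = (\<Sum>A\<in>Pow I. real (card A) * g A)"
proof -
  have "(\<Sum>i\<in>I. \<Sum>A | A \<in> Pow I \<and> i \<in> A. g A) = (\<Sum>i\<in>I. \<Sum>A\<in>Pow I. if i \<in> A then g A else 0)"
    by (rule sum.cong[OF refl], rule sum.inter_filter) (use assms in simp)
  also have "\<dots> = (\<Sum>A\<in>Pow I. \<Sum>i\<in>I. if i \<in> A then g A else 0)" by (rule sum.swap)
  also have "\<dots> = (\<Sum>A\<in>Pow I. real (card A) * g A)"
  proof (intro sum.cong refl)
    fix A assume "A \<in> Pow I"
    then have "I \<inter> A = A" by auto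
    then show "(\<Sum>i\<in>I. if i \<in> A then g A else 0) = real (card A) * g A"
      using sum.inter_restrict[OF assms, of "\<lambda>_. g A" A] by simp
  qed
  finally show ?thesis .
qed

definition homogeneous :: "nat \<Rightarrow> (nat set \<Rightarrow> real) \<Rightarrow> bool" where
  "homogeneous d q \<longleftrightarrow> (\<forall>A. card A \<noteq> d \<longrightarrow> q A = 0)"

lemma homogeneousD: "homogeneous d q \<Longrightarrow> q A \<noteq> 0 \<Longrightarrow> card A = d"
  by (auto simp: homogeneous_def)

lemma sum_card_homogeneous:
  assumes "homogeneous d q"
  shows "(\<Sum>A\<in>F. real (card A) * (q A * g A)) = real d * (\<Sum>A\<in>F. q A * g A)"
  unfolding sum_distrib_left
  by (intro sum.cong refl) (use assms in \<open>auto simp: homogeneous_def\<close>)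

lemma euler_identity:
  assumes "finite I" "homogeneous d q"
  shows "(\<Sum>i\<in>I. x i * multilinear (partial_coeff i q) (I - {i}) x) = real d * multilinear q I x"
proof -
  have "(\<Sum>i\<in>I. x i * multilinear (partial_coeff i q) (I - {i}) x)
      = (\<Sum>i\<in>I. \<Sum>A | A \<in> Pow I \<and> i \<in> A. q A * (\<Prod>j\<in>A. x j))"
  proof (intro sum.cong refl)
    fix i assume i: "i \<in> I"
    show "x i * multilinear (partial_coeff i q) (I - {i}) x = (\<Sum>A | A \<in> Pow I \<and> i \<in> A. q A * (\<Prod>j\<in>A. x j))"
      unfolding multilinear_partial_eq[OF assms(1) i] sum_distrib_left
    proof (intro sum.cong refl)
      fix A assume "A \<in> {A. A \<in> Pow I \<and> i \<in> A}"
      then have "finite A" "i \<in> A" using assms(1) by (auto intro: finite_subset)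
      then show "x i * (q A * (\<Prod>j\<in>A - {i}. x j)) = q A * (\<Prod>j\<in>A. x j)"
        by (simp add: prod.remove)
    qed
  qed
  also have "\<dots> = real d * multilinear q I x"
    unfolding sum_Pow_mem_swap[OF assms(1)] sum_card_homogeneous[OF assms(2)] multilinear_def ..
  finally show ?thesis .
qed

text \<open>Since \<open>x\<^sub>i\<^sup>2 = 1 + (x\<^sub>i\<^sup>2 - 1)\<close>, a product of two monomials \<open>x\<^sub>A x\<^sub>B\<close> is a sum of terms with factors \<open>x\<^sub>i\<close> for
  \<open>i\<close> in \<open>D = A \<triangle> B\<close> and \<open>x\<^sub>i\<^sup>2 - 1\<close> for \<open>i\<close> in a subset of \<open>A \<inter> B\<close>. All these factors are centred, so
  grouping the terms by the set \<open>S\<close> of variables that occur gives the Hoeffding decomposition of the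
  square of a multilinear polynomial.\<close>

definition component_term :: "nat set \<Rightarrow> nat set \<Rightarrow> (nat \<Rightarrow> real) \<Rightarrow> real" where
  "component_term S D x = (\<Prod>i\<in>D. x i) * (\<Prod>i\<in>S - D. (x i)\<^sup>2 - 1)"

definition square_coeff :: "nat set \<Rightarrow> (nat set \<Rightarrow> real) \<Rightarrow> nat set \<Rightarrow> nat set \<Rightarrow> real" where
  "square_coeff I q S D = (\<Sum>A\<in>Pow I. \<Sum>B\<in>Pow I. if D = sym_diff A B \<and> S \<subseteq> A \<union> B then q A * q B else 0)"

lemma sum_Pow_prod_centred_squares:
  fixes x :: "nat \<Rightarrow> real"
  assumes "finite E"
  shows "(\<Sum>C\<in>Pow E. \<Prod>i\<in>C. (x i)\<^sup>2 - 1) = (\<Prod>i\<in>E. (x i)\<^sup>2)"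
    and "(\<Sum>C\<in>Pow E. (2 * real (card E) - real (card C)) * (\<Prod>i\<in>C. (x i)\<^sup>2 - 1))
       = (\<Sum>i\<in>E. (1 + (x i)\<^sup>2) * (\<Prod>j\<in>E - {i}. (x j)\<^sup>2))"
  using assms
proof (induction E)
  case empty
  show "(\<Sum>C\<in>Pow {}. \<Prod>i\<in>C. (x i)\<^sup>2 - 1) = (\<Prod>i\<in>{}. (x i)\<^sup>2)" by simp
  show "(\<Sum>C\<in>Pow {}. (2 * real (card {}) - real (card C)) * (\<Prod>i\<in>C. (x i)\<^sup>2 - 1))
       = (\<Sum>i\<in>{}. (1 + (x i)\<^sup>2) * (\<Prod>j\<in>{} - {i}. (x j)\<^sup>2))" by simp
next
  case (insert j E)
  let ?y = "\<lambda>i. (x i)\<^sup>2 - 1"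
  have fin: "finite C" "j \<notin> C" if "C \<in> Pow E" for C
    using that insert.hyps by (auto intro: finite_subset)
  show *: "(\<Sum>C\<in>Pow (insert j E). \<Prod>i\<in>C. ?y i) = (\<Prod>i\<in>insert j E. (x i)\<^sup>2)"
  proof -
    have "(\<Sum>C\<in>Pow (insert j E). \<Prod>i\<in>C. ?y i) = (\<Sum>C\<in>Pow E. \<Prod>i\<in>C. ?y i) + (\<Sum>C\<in>Pow E. ?y j * (\<Prod>i\<in>C. ?y i))"
      unfolding sum_Pow_insert[OF insert.hyps(1,2)]
      by (rule arg_cong2[where f="(+)", OF refl sum.cong[OF refl]]) (simp add: fin)
    also have "\<dots> = (\<Prod>i\<in>E. (x i)\<^sup>2) + ?y j * (\<Prod>i\<in>E. (x i)\<^sup>2)"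
      unfolding sum_distrib_left[symmetric] insert.IH(1) ..
    also have "\<dots> = (\<Prod>i\<in>insert j E. (x i)\<^sup>2)"
      using insert.hyps(1,2) by (simp add: algebra_simps)
    finally show ?thesis .
  qed
  show "(\<Sum>C\<in>Pow (insert j E). (2 * real (card (insert j E)) - real (card C)) * (\<Prod>i\<in>C. ?y i))
       = (\<Sum>i\<in>insert j E. (1 + (x i)\<^sup>2) * (\<Prod>k\<in>insert j E - {i}. (x k)\<^sup>2))"
  proof -
    let ?G = "\<Sum>C\<in>Pow E. (2 * real (card E) - real (card C)) * (\<Prod>i\<in>C. ?y i)"
    let ?P = "\<Sum>C\<in>Pow E. \<Prod>i\<in>C. ?y i"
    have alg: "(2 * (e + 1) - k) * p = (2 * e - k) * p + 2 * p"
      "(2 * (e + 1) - (k + 1)) * (y * p) = y * ((2 * e - k) * p) + y * p"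
      "e + 2 * p + ((y - 1) * e + (y - 1) * p) = y * e + (1 + y) * p" for e k p y :: real
      by (simp_all add: algebra_simps)
    have cE: "real (card (insert j E)) = real (card E) + 1" using insert.hyps(1,2) by simp
    have cC: "real (card (insert j C)) = real (card C) + 1" "(\<Prod>i\<in>insert j C. ?y i) = ?y j * (\<Prod>i\<in>C. ?y i)"
      if "C \<in> Pow E" for C
      using fin[OF that] by simp_all
    have "(\<Sum>C\<in>Pow (insert j E). (2 * real (card (insert j E)) - real (card C)) * (\<Prod>i\<in>C. ?y i))
       = (\<Sum>C\<in>Pow E. (2 * (real (card E) + 1) - real (card C)) * (\<Prod>i\<in>C. ?y i))
         + (\<Sum>C\<in>Pow E. (2 * (real (card E) + 1) - real (card (insert j C))) * (\<Prod>i\<in>insert j C. ?y i))"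
      unfolding cE by (rule sum_Pow_insert[OF insert.hyps(1,2)])
    also have "(\<Sum>C\<in>Pow E. (2 * (real (card E) + 1) - real (card (insert j C))) * (\<Prod>i\<in>insert j C. ?y i))
       = (\<Sum>C\<in>Pow E. ?y j * ((2 * real (card E) - real (card C)) * (\<Prod>i\<in>C. ?y i)) + ?y j * (\<Prod>i\<in>C. ?y i))"
      by (rule sum.cong[OF refl], simp only: cC alg(2))
    also have "(\<Sum>C\<in>Pow E. (2 * (real (card E) + 1) - real (card C)) * (\<Prod>i\<in>C. ?y i))
       = (\<Sum>C\<in>Pow E. (2 * real (card E) - real (card C)) * (\<Prod>i\<in>C. ?y i) + 2 * (\<Prod>i\<in>C. ?y i))"
      by (rule sum.cong[OF refl], rule alg(1))
    also have "(\<Sum>C\<in>Pow E. (2 * real (card E) - real (card C)) * (\<Prod>i\<in>C. ?y i) + 2 * (\<Prod>i\<in>C. ?y i))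
        + (\<Sum>C\<in>Pow E. ?y j * ((2 * real (card E) - real (card C)) * (\<Prod>i\<in>C. ?y i)) + ?y j * (\<Prod>i\<in>C. ?y i))
      = ?G + 2 * ?P + (?y j * ?G + ?y j * ?P)"
      by (simp only: sum.distrib sum_distrib_left)
    also have "\<dots> = (x j)\<^sup>2 * ?G + (1 + (x j)\<^sup>2) * ?P" by (rule alg(3))
    also have "\<dots> = (x j)\<^sup>2 * (\<Sum>i\<in>E. (1 + (x i)\<^sup>2) * (\<Prod>k\<in>E - {i}. (x k)\<^sup>2)) + (1 + (x j)\<^sup>2) * (\<Prod>k\<in>E. (x k)\<^sup>2)"
      unfolding insert.IH ..
    also have "(x j)\<^sup>2 * (\<Sum>i\<in>E. (1 + (x i)\<^sup>2) * (\<Prod>k\<in>E - {i}. (x k)\<^sup>2))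
        = (\<Sum>i\<in>E. (1 + (x i)\<^sup>2) * (\<Prod>k\<in>insert j E - {i}. (x k)\<^sup>2))"
      unfolding sum_distrib_left
    proof (intro sum.cong refl)
      fix i assume "i \<in> E"
      then have "insert j E - {i} = insert j (E - {i})" "j \<notin> E - {i}" using insert.hyps by auto
      then show "(x j)\<^sup>2 * ((1 + (x i)\<^sup>2) * (\<Prod>k\<in>E - {i}. (x k)\<^sup>2)) = (1 + (x i)\<^sup>2) * (\<Prod>k\<in>insert j E - {i}. (x k)\<^sup>2)"
        using insert.hyps by simp
    qed
    also have "(\<Sum>i\<in>E. (1 + (x i)\<^sup>2) * (\<Prod>k\<in>insert j E - {i}. (x k)\<^sup>2)) + (1 + (x j)\<^sup>2) * (\<Prod>k\<in>E. (x k)\<^sup>2)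
        = (\<Sum>i\<in>insert j E. (1 + (x i)\<^sup>2) * (\<Prod>k\<in>insert j E - {i}. (x k)\<^sup>2))"
      using insert.hyps(1,2) by simp
    finally show ?thesis .
  qed
qed

text \<open>For a pair \<open>(A, B)\<close> the sets \<open>S\<close> that occur are the sets \<open>(A \<triangle> B) \<union> C\<close> with \<open>C \<subseteq> A \<inter> B\<close>.\<close>

lemma sum_components:
  assumes I: "finite I"
  shows "(\<Sum>S\<in>Pow I. w (card S) * (\<Sum>D\<in>Pow S. square_coeff I q S D * component_term S D x))
       = (\<Sum>A\<in>Pow I. \<Sum>B\<in>Pow I. q A * q B * ((\<Prod>i\<in>sym_diff A B. x i) *
            (\<Sum>C\<in>Pow (A \<inter> B). w (card (sym_diff A B) + card C) * (\<Prod>i\<in>C. (x i)\<^sup>2 - 1))))"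
    (is "?L = ?R")
proof -
  let ?g = "\<lambda>S D A B. if D = sym_diff A B \<and> S \<subseteq> A \<union> B then q A * q B * (w (card S) * component_term S D x) else 0"
  have "?L = (\<Sum>S\<in>Pow I. \<Sum>D\<in>Pow S. \<Sum>A\<in>Pow I. \<Sum>B\<in>Pow I. ?g S D A B)"
    unfolding square_coeff_def sum_distrib_left sum_distrib_right
    by (intro sum.cong refl) simp
  also have "\<dots> = (\<Sum>S\<in>Pow I. \<Sum>A\<in>Pow I. \<Sum>D\<in>Pow S. \<Sum>B\<in>Pow I. ?g S D A B)"
    by (rule sum.cong[OF refl], rule sum.swap)
  also have "\<dots> = (\<Sum>A\<in>Pow I. \<Sum>S\<in>Pow I. \<Sum>B\<in>Pow I. \<Sum>D\<in>Pow S. ?g S D A B)"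
    by (subst sum.swap, rule sum.cong[OF refl], rule sum.cong[OF refl], rule sum.swap)
  also have "\<dots> = (\<Sum>A\<in>Pow I. \<Sum>B\<in>Pow I. \<Sum>S\<in>Pow I. \<Sum>D\<in>Pow S. ?g S D A B)"
    by (rule sum.cong[OF refl], rule sum.swap)
  also have "\<dots> = ?R"
  proof (intro sum.cong refl)
    fix A B assume AB: "A \<in> Pow I" "B \<in> Pow I"
    let ?D = "sym_diff A B"
    let ?h = "\<lambda>S. q A * q B * (w (card S) * component_term S ?D x)"
    let ?r = "q A * q B * ((\<Prod>i\<in>?D. x i) * (\<Sum>C\<in>Pow (A \<inter> B). w (card ?D + card C) * (\<Prod>i\<in>C. (x i)\<^sup>2 - 1)))"
    have fin: "finite A" "finite B" using AB I by (auto intro: finite_subset)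
    have "(\<Sum>S\<in>Pow I. \<Sum>D\<in>Pow S. ?g S D A B)
      = (\<Sum>S\<in>Pow I. if ?D \<subseteq> S \<and> S \<subseteq> A \<union> B then ?h S else 0)"
    proof (intro sum.cong refl)
      fix S assume "S \<in> Pow I"
      then have fS: "finite (Pow S)" using I by (auto intro: finite_subset)
      have "(\<Sum>D\<in>Pow S. ?g S D A B)
         = (\<Sum>D\<in>Pow S. if D = ?D then (if S \<subseteq> A \<union> B then ?h S else 0) else 0)"
        by (intro sum.cong refl) auto
      also have "\<dots> = (if ?D \<in> Pow S then (if S \<subseteq> A \<union> B then ?h S else 0) else 0)"
        using fS by (rule sum.delta)
      finally show "(\<Sum>D\<in>Pow S. ?g S D A B)
        = (if ?D \<subseteq> S \<and> S \<subseteq> A \<union> B then ?h S else 0)" by auto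
    qed
    also have "\<dots> = (\<Sum>S | ?D \<subseteq> S \<and> S \<subseteq> A \<union> B. ?h S)"
    proof (subst sum.inter_filter[symmetric])
      show "finite (Pow I)" using I by simp
      have "{S \<in> Pow I. ?D \<subseteq> S \<and> S \<subseteq> A \<union> B} = {S. ?D \<subseteq> S \<and> S \<subseteq> A \<union> B}" using AB by auto
      then show "(\<Sum>S | S \<in> Pow I \<and> ?D \<subseteq> S \<and> S \<subseteq> A \<union> B. ?h S)
         = (\<Sum>S | ?D \<subseteq> S \<and> S \<subseteq> A \<union> B. ?h S)" by simp
    qed
    also have "\<dots> = (\<Sum>C\<in>Pow (A \<inter> B). ?h (?D \<union> C))"
    proof (rule sum.reindex_bij_witness[where i="\<lambda>C. ?D \<union> C" and j="\<lambda>S. S - ?D"])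
      fix S assume "S \<in> {S. ?D \<subseteq> S \<and> S \<subseteq> A \<union> B}"
      then have e: "?D \<union> (S - ?D) = S" by blast
      show "?D \<union> (S - ?D) = S" by (rule e)
      show "?h (?D \<union> (S - ?D))
        = ?h S" unfolding e ..
    qed auto
    also have "\<dots> = (\<Sum>C\<in>Pow (A \<inter> B). q A * q B * ((\<Prod>i\<in>?D. x i) * (w (card ?D + card C) * (\<Prod>i\<in>C. (x i)\<^sup>2 - 1))))"
    proof (intro sum.cong refl)
      fix C assume C: "C \<in> Pow (A \<inter> B)"
      then have "finite C" "?D \<inter> C = {}" "(?D \<union> C) - ?D = C" using fin by (auto intro: finite_subset)
      then show "?h (?D \<union> C)
        = q A * q B * ((\<Prod>i\<in>?D. x i) * (w (card ?D + card C) * (\<Prod>i\<in>C. (x i)\<^sup>2 - 1)))"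
        using fin by (simp add: component_term_def card_Un_disjoint)
    qed
    also have "\<dots> = ?r"
      by (simp only: sum_distrib_left)
    finally show "(\<Sum>S\<in>Pow I. \<Sum>D\<in>Pow S. ?g S D A B)
      = ?r" .
  qed
  finally show ?thesis .
qed

lemma prod_sym_diff_inter:
  fixes x :: "nat \<Rightarrow> real"
  assumes "finite A" "finite B"
  shows "(\<Prod>i\<in>sym_diff A B. x i) * (\<Prod>i\<in>A \<inter> B. (x i)\<^sup>2) = (\<Prod>i\<in>A. x i) * (\<Prod>i\<in>B. x i)"
proof -
  have "(\<Prod>i\<in>A. x i) = (\<Prod>i\<in>A - B. x i) * (\<Prod>i\<in>A \<inter> B. x i)"
    using assms by (subst prod.union_disjoint[symmetric]) (auto intro!: prod.cong)
  moreover have "(\<Prod>i\<in>B. x i) = (\<Prod>i\<in>B - A. x i) * (\<Prod>i\<in>A \<inter> B. x i)"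
    using assms by (subst prod.union_disjoint[symmetric]) (auto intro!: prod.cong)
  moreover have "(\<Prod>i\<in>sym_diff A B. x i) = (\<Prod>i\<in>A - B. x i) * (\<Prod>i\<in>B - A. x i)"
    using assms by (subst prod.union_disjoint) auto
  moreover have "(\<Prod>i\<in>A \<inter> B. (x i)\<^sup>2) = (\<Prod>i\<in>A \<inter> B. x i) * (\<Prod>i\<in>A \<inter> B. x i)"
    by (simp add: power2_eq_square prod.distrib)
  ultimately show ?thesis by (simp add: mult_ac)
qed

lemma square_component_sum:
  assumes I: "finite I"
  shows "(\<Sum>S\<in>Pow I. \<Sum>D\<in>Pow S. square_coeff I q S D * component_term S D x) = (multilinear q I x)\<^sup>2"
proof -
  have "(\<Sum>S\<in>Pow I. \<Sum>D\<in>Pow S. square_coeff I q S D * component_term S D x)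
     = (\<Sum>A\<in>Pow I. \<Sum>B\<in>Pow I. q A * q B * ((\<Prod>i\<in>sym_diff A B. x i) *
            (\<Sum>C\<in>Pow (A \<inter> B). (\<Prod>i\<in>C. (x i)\<^sup>2 - 1))))"
    using sum_components[OF I, of "\<lambda>_. 1" q x] by simp
  also have "\<dots> = (\<Sum>A\<in>Pow I. \<Sum>B\<in>Pow I. (q A * (\<Prod>i\<in>A. x i)) * (q B * (\<Prod>i\<in>B. x i)))"
  proof (intro sum.cong refl)
    fix A B assume "A \<in> Pow I" "B \<in> Pow I"
    then have "finite A" "finite B" using I by (auto intro: finite_subset)
    then show "q A * q B * ((\<Prod>i\<in>sym_diff A B. x i) * (\<Sum>C\<in>Pow (A \<inter> B). \<Prod>i\<in>C. (x i)\<^sup>2 - 1))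
       = (q A * (\<Prod>i\<in>A. x i)) * (q B * (\<Prod>i\<in>B. x i))"
      using prod_sym_diff_inter[of A B x] by (simp add: sum_Pow_prod_centred_squares(1) del: Pow_Int_eq)
  qed
  also have "\<dots> = (multilinear q I x)\<^sup>2"
    by (simp only: multilinear_def power2_eq_square sum_product)
  finally show ?thesis .
qed

text \<open>With \<open>V\<^sub>i\<close> the partial derivative in \<open>x\<^sub>i\<close>, the summand is half the mean square change of the polynomial
  when \<open>x\<^sub>i\<close> is replaced by an independent copy of mean \<open>0\<close> and variance \<open>1\<close>.\<close>

definition carre_du_champ :: "nat set \<Rightarrow> (nat set \<Rightarrow> real) \<Rightarrow> (nat \<Rightarrow> real) \<Rightarrow> real" where
  "carre_du_champ I q x = (\<Sum>i\<in>I. (1 + (x i)\<^sup>2) / 2 * (multilinear (partial_coeff i q) (I - {i}) x)\<^sup>2)"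

text \<open>Averaging over a coordinate annihilates the components that contain it, so the generator acts on the
  component \<open>S\<close> of \<open>q\<^sup>2\<close> as multiplication by \<open>-|S|\<close> and on \<open>q\<close> as multiplication by \<open>-d\<close>. The claim is the
  formula \<open>2 \<Gamma>(q) = L(q\<^sup>2) - 2 q L q\<close> for the carre du champ; it is verified monomial by monomial.\<close>

lemma carre_du_champ_component_sum:
  assumes I: "finite I" and q: "homogeneous d q"
  shows "(\<Sum>S\<in>Pow I. (2 * real d - real (card S)) * (\<Sum>D\<in>Pow S. square_coeff I q S D * component_term S D x))
     = 2 * carre_du_champ I q x"
proof -
  let ?a = "\<lambda>i A. if i \<in> A then q A * (\<Prod>j\<in>A - {i}. x j) else 0"
  have "(\<Sum>S\<in>Pow I. (2 * real d - real (card S)) * (\<Sum>D\<in>Pow S. square_coeff I q S D * component_term S D x))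
     = (\<Sum>A\<in>Pow I. \<Sum>B\<in>Pow I. q A * q B * ((\<Prod>i\<in>sym_diff A B. x i) *
            (\<Sum>C\<in>Pow (A \<inter> B). (2 * real d - real (card (sym_diff A B) + card C)) * (\<Prod>i\<in>C. (x i)\<^sup>2 - 1))))"
    by (rule sum_components[OF I, of "\<lambda>k. 2 * real d - real k" q x])
  also have "\<dots> = (\<Sum>A\<in>Pow I. \<Sum>B\<in>Pow I. \<Sum>i\<in>I. (1 + (x i)\<^sup>2) *
      (?a i A * ?a i B))"
  proof (intro sum.cong refl)
    fix A B assume AB: "A \<in> Pow I" "B \<in> Pow I"
    then have fin: "finite A" "finite B" using I by (auto intro: finite_subset)
    show "q A * q B * ((\<Prod>i\<in>sym_diff A B. x i) *
            (\<Sum>C\<in>Pow (A \<inter> B). (2 * real d - real (card (sym_diff A B) + card C)) * (\<Prod>i\<in>C. (x i)\<^sup>2 - 1)))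
       = (\<Sum>i\<in>I. (1 + (x i)\<^sup>2) *
      (?a i A * ?a i B))"
    proof (cases "q A = 0 \<or> q B = 0")
      case True
      have "(\<Sum>i\<in>I. (1 + (x i)\<^sup>2) *
        (?a i A * ?a i B)) = 0"
        by (rule sum.neutral) (use True in auto)
      moreover have "q A * q B = 0" using True by auto
      ultimately show ?thesis by (simp only: mult_zero_left)
    next
      case False
      then have c: "card A = d" "card B = d" using homogeneousD[OF q] by auto
      have "card (sym_diff A B) = card (A - B) + card (B - A)"
        using fin by (intro card_Un_disjoint) auto
      moreover have "card A = card (A - B) + card (A \<inter> B)" "card B = card (B - A) + card (A \<inter> B)"
        using card_Int_Diff[OF fin(1), of B] card_Int_Diff[OF fin(2), of A] unfolding Int_commute[of B A] by linarith+
      ultimately have cd: "2 * real d - real (card (sym_diff A B) + k) = 2 * real (card (A \<inter> B)) - real k" for k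
        using c by linarith
      have "(\<Prod>i\<in>sym_diff A B. x i) * (\<Sum>C\<in>Pow (A \<inter> B). (2 * real d - real (card (sym_diff A B) + card C)) * (\<Prod>i\<in>C. (x i)\<^sup>2 - 1))
        = (\<Sum>i\<in>A \<inter> B. (\<Prod>j\<in>sym_diff A B. x j) * ((1 + (x i)\<^sup>2) * (\<Prod>j\<in>A \<inter> B - {i}. (x j)\<^sup>2)))"
        unfolding cd using sum_Pow_prod_centred_squares(2)[of "A \<inter> B" x] fin by (simp add: sum_distrib_left)
      also have "\<dots> = (\<Sum>i\<in>A \<inter> B. (1 + (x i)\<^sup>2) * ((\<Prod>j\<in>A - {i}. x j) * (\<Prod>j\<in>B - {i}. x j)))"
      proof (intro sum.cong refl)
        fix i assume i: "i \<in> A \<inter> B"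
        then have "sym_diff (A - {i}) (B - {i}) = sym_diff A B" "(A - {i}) \<inter> (B - {i}) = A \<inter> B - {i}" by auto
        then show "(\<Prod>j\<in>sym_diff A B. x j) * ((1 + (x i)\<^sup>2) * (\<Prod>j\<in>A \<inter> B - {i}. (x j)\<^sup>2))
           = (1 + (x i)\<^sup>2) * ((\<Prod>j\<in>A - {i}. x j) * (\<Prod>j\<in>B - {i}. x j))"
          using prod_sym_diff_inter[of "A - {i}" "B - {i}" x] fin by simp
      qed
      also have "\<dots> = (\<Sum>i\<in>I. if i \<in> A \<inter> B then (1 + (x i)\<^sup>2) * ((\<Prod>j\<in>A - {i}. x j) * (\<Prod>j\<in>B - {i}. x j)) else 0)"
      proof -
        have e: "I \<inter> (A \<inter> B) = A \<inter> B" using AB by auto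
        show ?thesis by (subst sum.inter_restrict[OF I, symmetric]) (simp only: e)
      qed
      finally have "q A * q B * ((\<Prod>i\<in>sym_diff A B. x i) * (\<Sum>C\<in>Pow (A \<inter> B). (2 * real d - real (card (sym_diff A B) + card C)) * (\<Prod>i\<in>C. (x i)\<^sup>2 - 1)))
         = (\<Sum>i\<in>I. q A * q B * (if i \<in> A \<inter> B then (1 + (x i)\<^sup>2) * ((\<Prod>j\<in>A - {i}. x j) * (\<Prod>j\<in>B - {i}. x j)) else 0))"
        by (simp only: sum_distrib_left)
      also have "\<dots> = (\<Sum>i\<in>I. (1 + (x i)\<^sup>2) *
        (?a i A * ?a i B))"
        by (intro sum.cong refl) simp
      finally show ?thesis .
    qed
  qed
  also have "\<dots> = (\<Sum>A\<in>Pow I. \<Sum>i\<in>I. \<Sum>B\<in>Pow I. (1 + (x i)\<^sup>2) *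
      (?a i A * ?a i B))"
    by (rule sum.cong[OF refl], rule sum.swap)
  also have "\<dots> = (\<Sum>i\<in>I. \<Sum>A\<in>Pow I. \<Sum>B\<in>Pow I. (1 + (x i)\<^sup>2) *
      (?a i A * ?a i B))"
    by (rule sum.swap)
  also have "\<dots> = (\<Sum>i\<in>I. (1 + (x i)\<^sup>2) * (multilinear (partial_coeff i q) (I - {i}) x)\<^sup>2)"
  proof (intro sum.cong refl)
    fix i assume i: "i \<in> I"
    have "multilinear (partial_coeff i q) (I - {i}) x = (\<Sum>A\<in>Pow I. ?a i A)"
      unfolding multilinear_partial_eq[OF I i] by (rule sum.inter_filter) (use I in simp)
    then show "(\<Sum>A\<in>Pow I. \<Sum>B\<in>Pow I. (1 + (x i)\<^sup>2) *
      (?a i A * ?a i B))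
       = (1 + (x i)\<^sup>2) * (multilinear (partial_coeff i q) (I - {i}) x)\<^sup>2"
      unfolding power2_eq_square[of "multilinear _ _ _"] by (simp only: sum_product) (simp only: sum_distrib_left)
  qed
  also have "\<dots> = 2 * carre_du_champ I q x"
    unfolding carre_du_champ_def sum_distrib_left by (intro sum.cong refl) simp
  finally show ?thesis .
qed

section \<open>Moments of multilinear polynomials in independent variables\<close>

text \<open>Membership in \<open>L\<^sup>4\<close>. Every integrand below is bounded by products of at most four such functions, or
  separates into independent factors.\<close>

definition fourth_integrable :: "'a measure \<Rightarrow> ('a \<Rightarrow> real) \<Rightarrow> bool" where
  "fourth_integrable M Y \<longleftrightarrow> Y \<in> borel_measurable M \<and> integrable M (\<lambda>w. Y w ^ 4)"

context prob_space
begin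

lemma fourth_integrable_const: "fourth_integrable M (\<lambda>_. c)"
  by (simp add: fourth_integrable_def)

lemma fourth_integrable_cmult:
  "fourth_integrable M Y \<Longrightarrow> fourth_integrable M (\<lambda>w. c * Y w)"
  by (auto simp: fourth_integrable_def power_mult_distrib)

lemma add_power4_le: "(a + b) ^ 4 \<le> 8 * (a ^ 4 + b ^ 4)" for a b :: real
proof -
  have "(a + b)\<^sup>2 \<le> 2 * (a\<^sup>2 + b\<^sup>2)"
    using sum_squares_bound[of a b] by (simp add: power2_sum)
  then have "((a + b)\<^sup>2)\<^sup>2 \<le> (2 * (a\<^sup>2 + b\<^sup>2))\<^sup>2" by (intro power_mono) auto
  also have "\<dots> = 4 * (a\<^sup>2 + b\<^sup>2)\<^sup>2" by (simp only: power_mult_distrib) simp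
  also have "(a\<^sup>2 + b\<^sup>2)\<^sup>2 \<le> 2 * ((a\<^sup>2)\<^sup>2 + (b\<^sup>2)\<^sup>2)"
    using sum_squares_bound[of "a\<^sup>2" "b\<^sup>2"] by (simp add: power2_sum)
  finally show ?thesis by (simp add: power_mult[symmetric])
qed

lemma fourth_integrable_add:
  assumes "fourth_integrable M Y" "fourth_integrable M Z"
  shows "fourth_integrable M (\<lambda>w. Y w + Z w)"
  unfolding fourth_integrable_def
proof
  show m: "(\<lambda>w. Y w + Z w) \<in> borel_measurable M"
    using assms by (auto simp: fourth_integrable_def)
  show "integrable M (\<lambda>w. (Y w + Z w) ^ 4)"
  proof (rule Bochner_Integration.integrable_bound)
    show "integrable M (\<lambda>w. 8 * (Y w ^ 4 + Z w ^ 4))"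
      using assms by (simp add: fourth_integrable_def)
    show "AE w in M. norm ((Y w + Z w) ^ 4) \<le> norm (8 * (Y w ^ 4 + Z w ^ 4))"
      using add_power4_le by (intro AE_I2) (simp add: power_even_abs)
  qed (use m in measurable)
qed

lemma fourth_integrable_sum:
  assumes "\<And>k. k \<in> K \<Longrightarrow> fourth_integrable M (Y k)"
  shows "fourth_integrable M (\<lambda>w. \<Sum>k\<in>K. Y k w)"
  using assms
proof (induction K rule: infinite_finite_induct)
  case (insert k K)
  then show ?case by (simp add: fourth_integrable_add)
qed (simp_all add: fourth_integrable_const)

lemma power_mult_le_fourth:
  fixes a b c :: real
  assumes "j + k + l \<le> 4"
  shows "\<bar>a\<bar> ^ j * \<bar>b\<bar> ^ k * \<bar>c\<bar> ^ l \<le> 1 + a ^ 4 + b ^ 4 + c ^ 4"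
proof -
  define m where "m = max 1 (max \<bar>a\<bar> (max \<bar>b\<bar> \<bar>c\<bar>))"
  have "\<bar>a\<bar> ^ j * \<bar>b\<bar> ^ k * \<bar>c\<bar> ^ l \<le> m ^ j * m ^ k * m ^ l"
    by (intro mult_mono power_mono mult_nonneg_nonneg) (simp_all add: m_def le_max_iff_disj)
  also have "\<dots> = m ^ (j + k + l)" by (simp add: power_add)
  also have "\<dots> \<le> m ^ 4" using assms by (intro power_increasing) (auto simp: m_def)
  also have "m ^ 4 \<le> 1 + a ^ 4 + b ^ 4 + c ^ 4"
  proof -
    have "m \<in> {1, \<bar>a\<bar>, \<bar>b\<bar>, \<bar>c\<bar>}" by (auto simp: m_def max_def)
    moreover have "0 \<le> a ^ 4" "0 \<le> b ^ 4" "0 \<le> c ^ 4" by auto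
    ultimately show ?thesis by (auto simp: power_even_abs)
  qed
  finally show ?thesis .
qed

lemma fourth_integrable_mult:
  assumes Y: "fourth_integrable M Y1" "fourth_integrable M Y2" "fourth_integrable M Y3"
    and "j + k + l \<le> 4"
  shows "integrable M (\<lambda>w. Y1 w ^ j * Y2 w ^ k * Y3 w ^ l)"
proof (rule Bochner_Integration.integrable_bound)
  show "integrable M (\<lambda>w. 1 + Y1 w ^ 4 + Y2 w ^ 4 + Y3 w ^ 4)"
    using Y by (simp add: fourth_integrable_def)
  show "(\<lambda>w. Y1 w ^ j * Y2 w ^ k * Y3 w ^ l) \<in> borel_measurable M"
    using Y by (auto simp: fourth_integrable_def)
  show "AE w in M. norm (Y1 w ^ j * Y2 w ^ k * Y3 w ^ l) \<le> norm (1 + Y1 w ^ 4 + Y2 w ^ 4 + Y3 w ^ 4)"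
    using power_mult_le_fourth[OF assms(4)] by (intro AE_I2) (simp add: abs_mult power_abs order_trans[OF _ abs_ge_self])
qed

lemma fourth_integrable_mult2:
  assumes "fourth_integrable M Y1" "fourth_integrable M Y2" "j + k \<le> 4"
  shows "integrable M (\<lambda>w. Y1 w ^ j * Y2 w ^ k)"
  using fourth_integrable_mult[OF assms(1,2) fourth_integrable_const[of 1], of j k 0] assms(3) by simp

lemma fourth_integrable_power:
  assumes "fourth_integrable M Y" "k \<le> 4"
  shows "integrable M (\<lambda>w. Y w ^ k)"
  using fourth_integrable_mult2[OF assms(1) fourth_integrable_const[of 1], of k 0] assms(2) by simp

lemma cauchy_schwarz_expectation:
  fixes Y Z :: "'a \<Rightarrow> real"
  assumes YZ: "integrable M (\<lambda>w. Y w * Z w)" and Y: "integrable M (\<lambda>w. (Y w)\<^sup>2)" and Z: "integrable M (\<lambda>w. (Z w)\<^sup>2)"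
  shows "(expectation (\<lambda>w. Y w * Z w))\<^sup>2 \<le> expectation (\<lambda>w. (Y w)\<^sup>2) * expectation (\<lambda>w. (Z w)\<^sup>2)"
proof -
  let ?a = "expectation (\<lambda>w. (Y w)\<^sup>2)" and ?b = "expectation (\<lambda>w. Y w * Z w)" and ?c = "expectation (\<lambda>w. (Z w)\<^sup>2)"
  have quad: "0 \<le> s\<^sup>2 * ?a - 2 * s * t * ?b + t\<^sup>2 * ?c" for s t
  proof -
    have "0 \<le> expectation (\<lambda>w. (s * Y w - t * Z w)\<^sup>2)" by simp
    also have "(\<lambda>w. (s * Y w - t * Z w)\<^sup>2) = (\<lambda>w. s\<^sup>2 * (Y w)\<^sup>2 - 2 * s * t * (Y w * Z w) + t\<^sup>2 * (Z w)\<^sup>2)"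
      by (rule ext) (simp add: power2_eq_square algebra_simps)
    also have "expectation \<dots> = s\<^sup>2 * ?a - 2 * s * t * ?b + t\<^sup>2 * ?c" using YZ Y Z by simp
    finally show ?thesis .
  qed
  have c0: "?c \<ge> 0" by simp
  show ?thesis
  proof (cases "?c = 0")
    case True
    have "?b = 0"
    proof (rule ccontr)
      assume b: "?b \<noteq> 0"
      \<comment> \<open>For ?c = 0 the quadratic form is affine in t, hence negative for this t unless ?b = 0.\<close>
      have "0 \<le> ?a - 2 * ((?a + 1) / (2 * ?b)) * ?b" using quad[of 1 "(?a + 1) / (2 * ?b)"] True by simp
      also have "\<dots> = -1" using b by (simp add: field_simps)
      finally show False by simp
    qed
    then show ?thesis using True by simp
  next
    case False
    with c0 have "?c > 0" by (metis order.not_eq_order_implies_strict)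
    moreover have "0 \<le> ?c * (?c * ?a - ?b\<^sup>2)" using quad[of ?c ?b] by (simp add: power2_eq_square algebra_simps)
    ultimately have "0 \<le> ?c * ?a - ?b\<^sup>2" by (simp add: zero_le_mult_iff)
    then show ?thesis by (simp add: mult.commute)
  qed
qed

end

locale independent_fourth_moments = prob_space M for M :: "'a measure" +
  fixes X :: "nat \<Rightarrow> 'a \<Rightarrow> real" and I :: "nat set" and \<beta> :: real
  assumes finite_I: "finite I"
    and indep: "indep_vars (\<lambda>_. borel) X I"
    and mean: "\<And>i. i \<in> I \<Longrightarrow> expectation (X i) = 0"
    and second_moment: "\<And>i. i \<in> I \<Longrightarrow> expectation (\<lambda>w. X i w ^ 2) = 1"
    and fourth_moment_integrable: "\<And>i. i \<in> I \<Longrightarrow> integrable M (\<lambda>w. X i w ^ 4)"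
    and fourth_moment: "\<And>i. i \<in> I \<Longrightarrow> expectation (\<lambda>w. X i w ^ 4) \<le> \<beta>"
    and one_le_\<beta>: "1 \<le> \<beta>"
begin

definition chaos :: "(nat set \<Rightarrow> real) \<Rightarrow> nat set \<Rightarrow> 'a \<Rightarrow> real" where
  "chaos c J w = multilinear c J (\<lambda>i. X i w)"

lemma X_measurable [measurable]: "i \<in> I \<Longrightarrow> X i \<in> borel_measurable M"
  using indep by (auto simp: indep_vars_def)

lemma X_fourth: "i \<in> I \<Longrightarrow> fourth_integrable M (X i)"
  by (simp add: fourth_integrable_def fourth_moment_integrable X_measurable)

lemma indep_split:
  assumes i: "i \<in> I" "i \<notin> J" "J \<subseteq> I"
    and R: "R \<in> borel_measurable (\<Pi>\<^sub>M i\<in>J. borel)" "\<And>x. R (restrict x J) = R x"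
  shows "indep_var borel (X i) borel (\<lambda>w. R (\<lambda>i. X i w) :: real)"
proof -
  have "indep_var borel ((\<lambda>x. x i) \<circ> (\<lambda>w. restrict (\<lambda>i. X i w) {i})) borel (R \<circ> (\<lambda>w. restrict (\<lambda>i. X i w) J))"
    by (rule indep_var_compose[OF indep_var_restrict[OF indep, of "{i}" J]]) (use i R(1) in auto)
  also have "(\<lambda>x. x i) \<circ> (\<lambda>w. restrict (\<lambda>i. X i w) {i}) = X i" by auto
  also have "R \<circ> (\<lambda>w. restrict (\<lambda>i. X i w) J) = (\<lambda>w. R (\<lambda>i. X i w))" using R(2) by (auto simp: fun_eq_iff)
  finally show ?thesis .
qed

lemma expectation_split:
  fixes p :: "real \<Rightarrow> real" and R :: "(nat \<Rightarrow> real) \<Rightarrow> real"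
  assumes i: "i \<in> I" "i \<notin> J" "J \<subseteq> I"
    and R: "R \<in> borel_measurable (\<Pi>\<^sub>M i\<in>J. borel)" "\<And>x. R (restrict x J) = R x"
    and p: "p \<in> borel_measurable borel"
    and int: "integrable M (\<lambda>w. p (X i w))" "integrable M (\<lambda>w. R (\<lambda>i. X i w))"
  shows "expectation (\<lambda>w. p (X i w) * R (\<lambda>i. X i w)) = expectation (\<lambda>w. p (X i w)) * expectation (\<lambda>w. R (\<lambda>i. X i w))"
    and "integrable M (\<lambda>w. p (X i w) * R (\<lambda>i. X i w))"
proof -
  have "indep_var borel (p \<circ> X i) borel ((\<lambda>x. x) \<circ> (\<lambda>w. R (\<lambda>i. X i w)))"
    by (rule indep_var_compose[OF indep_split[OF i R]]) (use p in auto)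
  then have *: "indep_var borel (\<lambda>w. p (X i w)) borel (\<lambda>w. R (\<lambda>i. X i w))" by (simp add: comp_def)
  show "expectation (\<lambda>w. p (X i w) * R (\<lambda>i. X i w)) = expectation (\<lambda>w. p (X i w)) * expectation (\<lambda>w. R (\<lambda>i. X i w))"
    by (rule indep_var_lebesgue_integral[OF * int])
  show "integrable M (\<lambda>w. p (X i w) * R (\<lambda>i. X i w))"
    by (rule indep_var_integrable[OF * int])
qed

lemma chaos_fourth_integrable:
  assumes "J \<subseteq> I"
  shows "fourth_integrable M (chaos c J)"
proof -
  have "fourth_integrable M (\<lambda>w. \<Prod>i\<in>A. X i w)" if A: "A \<in> Pow J" for A
  proof -
    have A': "A \<subseteq> I" "finite A" using A assms finite_I by (auto intro: finite_subset)
    show ?thesis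
    proof (cases "A = {}")
      case False
      have "indep_vars (\<lambda>_. borel) (\<lambda>i w. X i w ^ 4) A"
        by (rule indep_vars_compose2[OF indep_vars_subset[OF indep A'(1)]]) simp
      then have "integrable M (\<lambda>w. \<Prod>i\<in>A. X i w ^ 4)"
        using A' fourth_moment_integrable by (intro indep_vars_integrable) auto
      moreover have "(\<lambda>w. \<Prod>i\<in>A. X i w) \<in> borel_measurable M" using A' by (intro borel_measurable_prod) auto
      ultimately show ?thesis by (simp add: fourth_integrable_def prod_power_distrib)
    qed (simp add: fourth_integrable_const)
  qed
  then have "fourth_integrable M (\<lambda>w. \<Sum>A\<in>Pow J. c A * (\<Prod>i\<in>A. X i w))"
    by (intro fourth_integrable_sum fourth_integrable_cmult) auto
  then show ?thesis by (simp add: chaos_def[abs_def] multilinear_def)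
qed

text \<open>The integral is expressed with \<open>has_bochner_integral\<close>, so that integrability and value are propagated
  through linear combinations together.\<close>

lemma moment_split:
  assumes i: "i \<in> I" "i \<notin> J" "J \<subseteq> I" and jk: "j + k \<le> 4" "l \<le> 4"
  shows "has_bochner_integral M (\<lambda>w. X i w ^ l * (chaos u J w ^ j * chaos v J w ^ k))
       (expectation (\<lambda>w. X i w ^ l) * expectation (\<lambda>w. chaos u J w ^ j * chaos v J w ^ k))"
proof -
  have R: "(\<lambda>x. multilinear u J x ^ j * multilinear v J x ^ k) \<in> borel_measurable (\<Pi>\<^sub>M i\<in>J. borel)"
    by measurable
  have int: "integrable M (\<lambda>w. X i w ^ l)" by (rule fourth_integrable_power[OF X_fourth[OF i(1)] jk(2)])
  have int2: "integrable M (\<lambda>w. multilinear u J (\<lambda>i. X i w) ^ j * multilinear v J (\<lambda>i. X i w) ^ k)"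
    using fourth_integrable_mult2[OF chaos_fourth_integrable[OF i(3)] chaos_fourth_integrable[OF i(3)] jk(1)] by (simp add: chaos_def)
  note * = expectation_split[OF i R, where p="\<lambda>x. x ^ l", OF _ _ int int2]
  show ?thesis
    using *(1) *(2) by (simp add: has_bochner_integral_iff chaos_def multilinear_restrict)
qed

abbreviation third_moment :: "nat \<Rightarrow> real" where "third_moment i \<equiv> expectation (\<lambda>w. X i w ^ 3)"
abbreviation fourth_moment_of :: "nat \<Rightarrow> real" where "fourth_moment_of i \<equiv> expectation (\<lambda>w. X i w ^ 4)"

lemma has_bochner_integral_eqI:
  "has_bochner_integral M f a \<Longrightarrow> (\<And>w. f w = g w) \<Longrightarrow> a = b \<Longrightarrow> has_bochner_integral M g b"
  using ext[of f g] by simp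

text \<open>Expanding in powers of \<open>X\<^sub>i\<close>, with \<open>E X\<^sub>i = 0\<close> and \<open>E X\<^sub>i\<^sup>2 = 1\<close>. The first and the second triple are the two
  sides of the integration by parts formulas for \<open>Q\<^sup>k\<close>: they agree up to the factor \<open>k\<close> when \<open>k \<le> 2\<close>, and
  up to a multiple of \<open>E V\<^sup>4\<close> when \<open>k = 3\<close>.\<close>

lemma mixed_moments:
  fixes u v :: "nat set \<Rightarrow> real"
  assumes i: "i \<in> I" "i \<notin> J" "J \<subseteq> I"
  defines "U \<equiv> chaos u J" and "V \<equiv> chaos v J"
  defines "Q \<equiv> \<lambda>w. U w + X i w * V w"
  shows "has_bochner_integral M (\<lambda>w. X i w * V w * Q w) (expectation (\<lambda>w. V w ^ 2))"
    and "has_bochner_integral M (\<lambda>w. X i w * V w * Q w ^ 2)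
          (2 * expectation (\<lambda>w. U w * V w ^ 2) + third_moment i * expectation (\<lambda>w. V w ^ 3))"
    and "has_bochner_integral M (\<lambda>w. X i w * V w * Q w ^ 3)
          (3 * expectation (\<lambda>w. U w ^ 2 * V w ^ 2) + 3 * (third_moment i * expectation (\<lambda>w. U w * V w ^ 3))
           + fourth_moment_of i * expectation (\<lambda>w. V w ^ 4))"
    and "has_bochner_integral M (\<lambda>w. (1 + X i w ^ 2) / 2 * V w ^ 2) (expectation (\<lambda>w. V w ^ 2))"
    and "has_bochner_integral M (\<lambda>w. (1 + X i w ^ 2) / 2 * V w ^ 2 * Q w)
          (expectation (\<lambda>w. U w * V w ^ 2) + third_moment i * expectation (\<lambda>w. V w ^ 3) / 2)"
    and "has_bochner_integral M (\<lambda>w. (1 + X i w ^ 2) / 2 * V w ^ 2 * Q w ^ 2)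
          (expectation (\<lambda>w. U w ^ 2 * V w ^ 2) + third_moment i * expectation (\<lambda>w. U w * V w ^ 3)
           + (1 + fourth_moment_of i) / 2 * expectation (\<lambda>w. V w ^ 4))"
    and "has_bochner_integral M (\<lambda>w. Q w ^ 2) (expectation (\<lambda>w. U w ^ 2) + expectation (\<lambda>w. V w ^ 2))"
    and "has_bochner_integral M (\<lambda>w. Q w ^ 4)
          (expectation (\<lambda>w. U w ^ 4) + 6 * expectation (\<lambda>w. U w ^ 2 * V w ^ 2)
           + 4 * (third_moment i * expectation (\<lambda>w. U w * V w ^ 3)) + fourth_moment_of i * expectation (\<lambda>w. V w ^ 4))"
proof -
  define T where "T l j k w = X i w ^ l * (U w ^ j * V w ^ k)" for l j k w
  define e where "e j k = expectation (\<lambda>w. U w ^ j * V w ^ k)" for j k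
  define m where "m l = expectation (\<lambda>w. X i w ^ l)" for l
  have T: "has_bochner_integral M (T l j k) (m l * e j k)" if "j + k \<le> 4" "l \<le> 4" for l j k
    using moment_split[OF i that, of u v] by (simp add: T_def[abs_def] e_def m_def U_def V_def)
  have m: "m 0 = 1" "m (Suc 0) = 0" "m 2 = 1"
    using mean[OF i(1)] second_moment[OF i(1)] prob_space by (simp_all add: m_def)
  note intros = has_bochner_integral_add has_bochner_integral_mult_right T
  note expand = T_def Q_def eval_nat_numeral field_simps
  have *: "has_bochner_integral M (\<lambda>w. T 1 1 1 w + T 2 0 2 w)
      (m 1 * e 1 1 + m 2 * e 0 2)"
    by (intro intros) auto
  show "has_bochner_integral M (\<lambda>w. X i w * V w * Q w) (expectation (\<lambda>w. V w ^ 2))"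
    by (rule has_bochner_integral_eqI[OF *]) (simp add: expand, simp add: m e_def m_def[symmetric] field_simps)
  have *: "has_bochner_integral M (\<lambda>w. T 1 2 1 w + 2 * T 2 1 2 w + T 3 0 3 w)
      (m 1 * e 2 1 + 2 * (m 2 * e 1 2) + m 3 * e 0 3)"
    by (intro intros) auto
  show "has_bochner_integral M (\<lambda>w. X i w * V w * Q w ^ 2)
          (2 * expectation (\<lambda>w. U w * V w ^ 2) + third_moment i * expectation (\<lambda>w. V w ^ 3))"
    by (rule has_bochner_integral_eqI[OF *]) (simp add: expand, simp add: m e_def m_def[symmetric] field_simps)
  have *: "has_bochner_integral M (\<lambda>w. T 1 3 1 w + 3 * T 2 2 2 w + 3 * T 3 1 3 w + T 4 0 4 w)
      (m 1 * e 3 1 + 3 * (m 2 * e 2 2) + 3 * (m 3 * e 1 3) + m 4 * e 0 4)"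
    by (intro intros) auto
  show "has_bochner_integral M (\<lambda>w. X i w * V w * Q w ^ 3)
          (3 * expectation (\<lambda>w. U w ^ 2 * V w ^ 2) + 3 * (third_moment i * expectation (\<lambda>w. U w * V w ^ 3))
           + fourth_moment_of i * expectation (\<lambda>w. V w ^ 4))"
    by (rule has_bochner_integral_eqI[OF *]) (simp add: expand, simp add: m e_def m_def[symmetric] field_simps)
  have *: "has_bochner_integral M (\<lambda>w. 1 / 2 * T 0 0 2 w + 1 / 2 * T 2 0 2 w)
      (1 / 2 * (m 0 * e 0 2) + 1 / 2 * (m 2 * e 0 2))"
    by (intro intros) auto
  show "has_bochner_integral M (\<lambda>w. (1 + X i w ^ 2) / 2 * V w ^ 2) (expectation (\<lambda>w. V w ^ 2))"
    by (rule has_bochner_integral_eqI[OF *]) (simp add: expand, simp add: m e_def m_def[symmetric] field_simps)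
  have *: "has_bochner_integral M (\<lambda>w. 1 / 2 * T 0 1 2 w + 1 / 2 * T 1 0 3 w + 1 / 2 * T 2 1 2 w + 1 / 2 * T 3 0 3 w)
      (1 / 2 * (m 0 * e 1 2) + 1 / 2 * (m 1 * e 0 3) + 1 / 2 * (m 2 * e 1 2) + 1 / 2 * (m 3 * e 0 3))"
    by (intro intros) auto
  show "has_bochner_integral M (\<lambda>w. (1 + X i w ^ 2) / 2 * V w ^ 2 * Q w)
          (expectation (\<lambda>w. U w * V w ^ 2) + third_moment i * expectation (\<lambda>w. V w ^ 3) / 2)"
    by (rule has_bochner_integral_eqI[OF *]) (simp add: expand, simp add: m e_def m_def[symmetric] field_simps)
  have *: "has_bochner_integral M (\<lambda>w. 1 / 2 * T 0 2 2 w + T 1 1 3 w + 1 / 2 * T 2 0 4 w + 1 / 2 * T 2 2 2 w + T 3 1 3 w + 1 / 2 * T 4 0 4 w)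
      (1 / 2 * (m 0 * e 2 2) + m 1 * e 1 3 + 1 / 2 * (m 2 * e 0 4) + 1 / 2 * (m 2 * e 2 2) + m 3 * e 1 3 + 1 / 2 * (m 4 * e 0 4))"
    by (intro intros) auto
  show "has_bochner_integral M (\<lambda>w. (1 + X i w ^ 2) / 2 * V w ^ 2 * Q w ^ 2)
          (expectation (\<lambda>w. U w ^ 2 * V w ^ 2) + third_moment i * expectation (\<lambda>w. U w * V w ^ 3)
           + (1 + fourth_moment_of i) / 2 * expectation (\<lambda>w. V w ^ 4))"
    by (rule has_bochner_integral_eqI[OF *]) (simp add: expand, simp add: m e_def m_def[symmetric] field_simps)
  have *: "has_bochner_integral M (\<lambda>w. T 0 2 0 w + 2 * T 1 1 1 w + T 2 0 2 w)
      (m 0 * e 2 0 + 2 * (m 1 * e 1 1) + m 2 * e 0 2)"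
    by (intro intros) auto
  show "has_bochner_integral M (\<lambda>w. Q w ^ 2) (expectation (\<lambda>w. U w ^ 2) + expectation (\<lambda>w. V w ^ 2))"
    by (rule has_bochner_integral_eqI[OF *]) (simp add: expand, simp add: m e_def m_def[symmetric] field_simps)
  have *: "has_bochner_integral M (\<lambda>w. T 0 4 0 w + 4 * T 1 3 1 w + 6 * T 2 2 2 w + 4 * T 3 1 3 w + T 4 0 4 w)
      (m 0 * e 4 0 + 4 * (m 1 * e 3 1) + 6 * (m 2 * e 2 2) + 4 * (m 3 * e 1 3) + m 4 * e 0 4)"
    by (intro intros) auto
  show "has_bochner_integral M (\<lambda>w. Q w ^ 4)
          (expectation (\<lambda>w. U w ^ 4) + 6 * expectation (\<lambda>w. U w ^ 2 * V w ^ 2)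
           + 4 * (third_moment i * expectation (\<lambda>w. U w * V w ^ 3)) + fourth_moment_of i * expectation (\<lambda>w. V w ^ 4))"
    by (rule has_bochner_integral_eqI[OF *]) (simp add: expand, simp add: m e_def m_def[symmetric] field_simps)
qed

lemma chaos_insert: "j \<notin> J \<Longrightarrow> J \<subseteq> I \<Longrightarrow> chaos c (insert j J) w = chaos c J w + X j w * chaos (partial_coeff j c) J w"
  using finite_subset[OF _ finite_I, of J] by (simp add: chaos_def multilinear_insert)

lemma expectation_chaos_square:
  assumes "J \<subseteq> I"
  shows "expectation (\<lambda>w. chaos c J w ^ 2) = (\<Sum>A\<in>Pow J. (c A)\<^sup>2)"
proof -
  have "finite J" using assms finite_I by (rule finite_subset)
  then show ?thesis using assms
  proof (induction J arbitrary: c)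
    case empty
    then show ?case using prob_space by (simp add: chaos_def)
  next
    case (insert j J)
    have j: "j \<in> I" "j \<notin> J" "J \<subseteq> I" using insert by auto
    have "expectation (\<lambda>w. chaos c (insert j J) w ^ 2)
        = expectation (\<lambda>w. chaos c J w ^ 2) + expectation (\<lambda>w. chaos (partial_coeff j c) J w ^ 2)"
      using mixed_moments(7)[OF j] by (simp add: chaos_insert[OF j(2,3)] has_bochner_integral_iff)
    also have "\<dots> = (\<Sum>A\<in>Pow (insert j J). (c A)\<^sup>2)"
      using insert j by (simp add: sum_Pow_insert)
    finally show ?case .
  qed
qed

lemma third_moment_square_le: "i \<in> I \<Longrightarrow> (third_moment i)\<^sup>2 \<le> \<beta>"
proof -
  assume i: "i \<in> I"
  have "(expectation (\<lambda>w. X i w * (X i w)\<^sup>2))\<^sup>2 \<le> expectation (\<lambda>w. (X i w)\<^sup>2) * expectation (\<lambda>w. ((X i w)\<^sup>2)\<^sup>2)"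
    using fourth_integrable_power[OF X_fourth[OF i], of 3] fourth_integrable_power[OF X_fourth[OF i], of 2]
      fourth_integrable_power[OF X_fourth[OF i], of 4]
    by (intro cauchy_schwarz_expectation) (simp_all add: power_mult[symmetric] power_Suc[symmetric] del: power_Suc)
  then show ?thesis
    using second_moment[OF i] fourth_moment[OF i]
    by (simp add: power_mult[symmetric] power_Suc[symmetric] del: power_Suc)
qed

lemma one_le_fourth_moment: "i \<in> I \<Longrightarrow> 1 \<le> fourth_moment_of i"
proof -
  assume i: "i \<in> I"
  have "(expectation (\<lambda>w. 1 * (X i w)\<^sup>2))\<^sup>2 \<le> expectation (\<lambda>w. 1\<^sup>2) * expectation (\<lambda>w. ((X i w)\<^sup>2)\<^sup>2)"
    using fourth_integrable_power[OF X_fourth[OF i], of 2] fourth_integrable_power[OF X_fourth[OF i], of 4]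
    by (intro cauchy_schwarz_expectation) (simp_all add: power_mult[symmetric])
  then show ?thesis using second_moment[OF i] prob_space by (simp add: power_mult[symmetric])
qed

text \<open>Induction on the variables. With \<open>P = U + X\<^sub>j V\<close>, the skewness term is absorbed by
  \<open>4 \<gamma> U V\<^sup>3 \<le> 2 U\<^sup>2 V\<^sup>2 + 2 \<gamma>\<^sup>2 V\<^sup>4\<close>, where \<open>\<gamma>\<^sup>2 \<le> \<beta>\<close>, so that
  \<open>E P\<^sup>4 \<le> E U\<^sup>4 + 8 E U\<^sup>2 V\<^sup>2 + 3 \<beta> E V\<^sup>4\<close>. Because \<open>V\<close> has smaller degree, each power of \<open>16 \<beta> \<ge> 16\<close> gained
  from it pays for the factors \<open>8\<close> and \<open>3 \<beta>\<close>.\<close>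

lemma hypercontractivity:
  assumes "J \<subseteq> I" and "\<And>A. A \<subseteq> J \<Longrightarrow> card A > n \<Longrightarrow> c A = 0"
  shows "expectation (\<lambda>w. chaos c J w ^ 4) \<le> (16 * \<beta>) ^ n * (expectation (\<lambda>w. chaos c J w ^ 2))\<^sup>2"
proof -
  define \<rho> where "\<rho> = 16 * \<beta>"
  have \<rho>: "\<rho> \<ge> 16" "3 * \<beta> \<le> \<rho>" using one_le_\<beta> by (auto simp: \<rho>_def)
  have "finite J" using assms finite_I by (auto intro: finite_subset)
  then have "expectation (\<lambda>w. chaos c J w ^ 4) \<le> \<rho> ^ n * (expectation (\<lambda>w. chaos c J w ^ 2))\<^sup>2"
    using assms
  proof (induction J arbitrary: c n)
    case empty
    have "1 * c {} ^ 4 \<le> \<rho> ^ n * c {} ^ 4"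
      using \<rho> by (intro mult_right_mono one_le_power) auto
    then show ?case using prob_space by (simp add: chaos_def power_mult[symmetric])
  next
    case (insert j J)
    let ?v = "partial_coeff j c"
    let ?U = "chaos c J" and ?V = "chaos ?v J"
    have j: "j \<in> I" "J \<subseteq> I" "finite J" "j \<notin> J" using insert by auto
    have eq: "chaos c (insert j J) = (\<lambda>w. ?U w + X j w * ?V w)"
      using chaos_insert[OF j(4,2)] by (rule ext)
    define u v where uv: "u = expectation (\<lambda>w. ?U w ^ 2)" "v = expectation (\<lambda>w. ?V w ^ 2)"
    have uv0: "u \<ge> 0" "v \<ge> 0" by (auto simp: uv)
    have sq: "expectation (\<lambda>w. chaos c (insert j J) w ^ 2) = u + v"
      using j by (simp add: uv expectation_chaos_square sum_Pow_insert)
    have dU: "c A = 0" if "A \<subseteq> J" "card A > n" for A using insert.prems(2)[of A] that by auto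
    have U4: "expectation (\<lambda>w. ?U w ^ 4) \<le> \<rho> ^ n * u\<^sup>2"
      unfolding uv using dU j by (intro insert.IH) auto
    have card': "card (insert j A) = Suc (card A)" if "A \<subseteq> J" for A
      using that j by (subst card_insert_disjoint) (auto intro: finite_subset)
    show ?case
    proof (cases n)
      case 0
      then have "?v A = 0" if "A \<in> Pow J" for A
        using insert.prems(2)[of "insert j A"] card'[of A] that by auto
      then have "?V w = 0" for w by (simp add: chaos_def multilinear_def)
      then have "expectation (\<lambda>w. chaos c (insert j J) w ^ 4) = expectation (\<lambda>w. ?U w ^ 4)" by (simp add: eq)
      also have "\<dots> \<le> \<rho> ^ n * u\<^sup>2" by (rule U4)
      also have "\<dots> \<le> \<rho> ^ n * (u + v)\<^sup>2" using uv0 \<rho> by (intro mult_left_mono power_mono) auto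
      finally show ?thesis by (simp add: sq)
    next
      case (Suc m)
      have dV: "?v A = 0" if "A \<subseteq> J" "card A > m" for A
        using insert.prems(2)[of "insert j A"] card'[of A] that Suc by auto
      have V4: "expectation (\<lambda>w. ?V w ^ 4) \<le> \<rho> ^ m * v\<^sup>2"
        unfolding uv using dV j by (intro insert.IH) auto
      note L = chaos_fourth_integrable[OF j(2)]
      have iUV: "integrable M (\<lambda>w. ?U w ^ k * ?V w ^ l)" if "k + l \<le> 4" for k l
        by (rule fourth_integrable_mult2[OF L L that])
      have cross: "expectation (\<lambda>w. ?U w ^ 2 * ?V w ^ 2) \<le> \<rho> ^ n * (u * v) / 4"
      proof (rule power2_le_imp_le)
        have "(expectation (\<lambda>w. ?U w ^ 2 * ?V w ^ 2))\<^sup>2 \<le> expectation (\<lambda>w. (?U w ^ 2)\<^sup>2) * expectation (\<lambda>w. (?V w ^ 2)\<^sup>2)"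
          using iUV[of 2 2] iUV[of 4 0] iUV[of 0 4]
          by (intro cauchy_schwarz_expectation) (simp_all add: power_mult[symmetric])
        also have "\<dots> = expectation (\<lambda>w. ?U w ^ 4) * expectation (\<lambda>w. ?V w ^ 4)"
          by (simp add: power_mult[symmetric])
        also have "\<dots> \<le> (\<rho> ^ n * u\<^sup>2) * (\<rho> ^ m * v\<^sup>2)"
          using U4 V4 \<rho> by (intro mult_mono) auto
        also have "\<dots> = \<rho> ^ n * \<rho> ^ m * (u * v)\<^sup>2 * 1" by (simp add: power_mult_distrib)
        also have "\<dots> \<le> \<rho> ^ n * \<rho> ^ m * (u * v)\<^sup>2 * (\<rho> / 16)"
          using \<rho> by (intro mult_left_mono) auto
        also have "\<dots> = (\<rho> ^ n * (u * v) / 4)\<^sup>2"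
          by (simp add: Suc power2_eq_square)
        finally show "(expectation (\<lambda>w. ?U w ^ 2 * ?V w ^ 2))\<^sup>2 \<le> (\<rho> ^ n * (u * v) / 4)\<^sup>2" .
        show "0 \<le> \<rho> ^ n * (u * v) / 4" using \<rho> uv0 by simp
      qed
      have skew: "4 * (third_moment j * expectation (\<lambda>w. ?U w * ?V w ^ 3))
          \<le> 2 * expectation (\<lambda>w. ?U w ^ 2 * ?V w ^ 2) + 2 * \<beta> * expectation (\<lambda>w. ?V w ^ 4)"
      proof -
        let ?g = "third_moment j"
        have "expectation (\<lambda>w. 4 * ?g * (?U w ^ 1 * ?V w ^ 3)) \<le> expectation (\<lambda>w. 2 * (?U w ^ 2 * ?V w ^ 2) + 2 * ?g\<^sup>2 * (?U w ^ 0 * ?V w ^ 4))"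
        proof (rule integral_mono)
          fix w
          \<comment> \<open>Completing the square keeps the skewness term free of absolute values.\<close>
          have "0 \<le> 2 * ?V w ^ 2 * (?U w - ?g * ?V w)\<^sup>2" by simp
          then show "4 * ?g * (?U w ^ 1 * ?V w ^ 3) \<le> 2 * (?U w ^ 2 * ?V w ^ 2) + 2 * ?g\<^sup>2 * (?U w ^ 0 * ?V w ^ 4)"
            by (simp add: eval_nat_numeral algebra_simps)
        qed (intro Bochner_Integration.integrable_add integrable_mult_right iUV; simp)+
        also have "\<dots> = 2 * expectation (\<lambda>w. ?U w ^ 2 * ?V w ^ 2) + 2 * ?g\<^sup>2 * expectation (\<lambda>w. ?V w ^ 4)"
          using iUV[of 2 2] iUV[of 0 4] by simp
        also have "\<dots> \<le> 2 * expectation (\<lambda>w. ?U w ^ 2 * ?V w ^ 2) + 2 * \<beta> * expectation (\<lambda>w. ?V w ^ 4)"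
          using third_moment_square_le[OF j(1)] by (intro add_left_mono mult_right_mono) auto
        finally show ?thesis by simp
      qed
      have "expectation (\<lambda>w. chaos c (insert j J) w ^ 4) = expectation (\<lambda>w. ?U w ^ 4) + 6 * expectation (\<lambda>w. ?U w ^ 2 * ?V w ^ 2)
         + 4 * (third_moment j * expectation (\<lambda>w. ?U w * ?V w ^ 3)) + fourth_moment_of j * expectation (\<lambda>w. ?V w ^ 4)"
        unfolding eq using mixed_moments(8)[OF j(1,4,2), of c ?v] by (simp add: has_bochner_integral_iff)
      also have "\<dots> \<le> expectation (\<lambda>w. ?U w ^ 4) + 8 * expectation (\<lambda>w. ?U w ^ 2 * ?V w ^ 2) + 3 * \<beta> * expectation (\<lambda>w. ?V w ^ 4)"
        using skew mult_right_mono[OF fourth_moment[OF j(1)], of "expectation (\<lambda>w. ?V w ^ 4)"] by simp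
      also have "\<dots> \<le> \<rho> ^ n * u\<^sup>2 + 8 * (\<rho> ^ n * (u * v) / 4) + \<rho> * (\<rho> ^ m * v\<^sup>2)"
        using U4 V4 cross \<rho> by (intro add_mono mult_mono mult_left_mono) auto
      also have "\<dots> = \<rho> ^ n * (u + v)\<^sup>2" by (simp add: Suc power2_sum algebra_simps)
      finally show ?thesis by (simp add: sq)
    qed
  qed
  then show ?thesis by (simp add: \<rho>_def)
qed

end

section \<open>The carre du champ of a homogeneous sum\<close>

lemma has_bochner_integral_orthogonal_sum:
  fixes f :: "'k \<Rightarrow> 'a \<Rightarrow> real"
  assumes F: "finite F"
    and orth: "\<And>S T. S \<in> F \<Longrightarrow> T \<in> F \<Longrightarrow> S \<noteq> T \<Longrightarrow> has_bochner_integral M (\<lambda>w. f S w * f T w) 0"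
    and int: "\<And>S. S \<in> F \<Longrightarrow> integrable M (\<lambda>w. f S w * f S w)"
  shows "has_bochner_integral M (\<lambda>w. (\<Sum>S\<in>F. a S * f S w) * (\<Sum>S\<in>F. b S * f S w))
     (\<Sum>S\<in>F. a S * b S * (\<integral>w. f S w ^ 2 \<partial>M))"
proof -
  have "has_bochner_integral M (\<lambda>w. \<Sum>S\<in>F. \<Sum>T\<in>F. a S * b T * (f S w * f T w))
     (\<Sum>S\<in>F. \<Sum>T\<in>F. a S * b T * (if S = T then (\<integral>w. f S w ^ 2 \<partial>M) else 0))"
    using orth int
    by (intro has_bochner_integral_sum has_bochner_integral_mult_right)
       (auto simp: has_bochner_integral_iff power2_eq_square)
  moreover have "(\<Sum>S\<in>F. \<Sum>T\<in>F. a S * b T * (f S w * f T w)) = (\<Sum>S\<in>F. a S * f S w) * (\<Sum>S\<in>F. b S * f S w)" for w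
    unfolding sum_product by (intro sum.cong refl) simp
  moreover have "(\<Sum>S\<in>F. \<Sum>T\<in>F. a S * b T * (if S = T then (\<integral>w. f S w ^ 2 \<partial>M) else 0))
     = (\<Sum>S\<in>F. a S * b S * (\<integral>w. f S w ^ 2 \<partial>M))"
  proof (rule sum.cong[OF refl])
    fix S assume S: "S \<in> F"
    have "(\<Sum>T\<in>F. a S * b T * (if S = T then (\<integral>w. f S w ^ 2 \<partial>M) else 0))
      = (\<Sum>T\<in>F. if S = T then a S * b T * (\<integral>w. f S w ^ 2 \<partial>M) else 0)"
      by (rule sum.cong[OF refl]) simp
    then show "(\<Sum>T\<in>F. a S * b T * (if S = T then (\<integral>w. f S w ^ 2 \<partial>M) else 0))
      = a S * b S * (\<integral>w. f S w ^ 2 \<partial>M)"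
      using S F by simp
  qed
  ultimately show ?thesis by simp
qed

text \<open>The one-variable factors of a component term, with value \<open>1\<close> outside \<open>S\<close>.\<close>

definition component_factor :: "nat set \<Rightarrow> nat set \<Rightarrow> nat \<Rightarrow> real \<Rightarrow> real" where
  "component_factor S D i t = (if i \<in> D then t else if i \<in> S then t\<^sup>2 - 1 else 1)"

lemma component_term_eq_prod:
  assumes "finite I" "D \<subseteq> S" "S \<subseteq> I"
  shows "component_term S D x = (\<Prod>i\<in>I. component_factor S D i (x i))"
proof -
  have "(\<Prod>i\<in>I. component_factor S D i (x i)) = (\<Prod>i\<in>S. component_factor S D i (x i))"
    using assms by (intro prod.mono_neutral_right) (auto simp: component_factor_def)
  also have "\<dots> = (\<Prod>i\<in>S - D. component_factor S D i (x i)) * (\<Prod>i\<in>D. component_factor S D i (x i))"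
    using assms by (intro prod.subset_diff) (auto intro: finite_subset)
  also have "(\<Prod>i\<in>S - D. component_factor S D i (x i)) = (\<Prod>i\<in>S - D. (x i)\<^sup>2 - 1)"
    by (intro prod.cong) (auto simp: component_factor_def)
  also have "(\<Prod>i\<in>D. component_factor S D i (x i)) = (\<Prod>i\<in>D. x i)"
    by (intro prod.cong) (auto simp: component_factor_def)
  finally show ?thesis by (simp add: component_term_def)
qed

context independent_fourth_moments
begin

text \<open>If \<open>S \<noteq> S'\<close>, some variable occurs in only one of the terms, through a centred factor.\<close>

lemma component_term_product:
  assumes "D \<subseteq> S" "S \<subseteq> I" "D' \<subseteq> S'" "S' \<subseteq> I"
  shows "integrable M (\<lambda>w. component_term S D (\<lambda>i. X i w) * component_term S' D' (\<lambda>i. X i w))" (is "integrable M ?f")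
    and "S \<noteq> S' \<Longrightarrow> expectation (\<lambda>w. component_term S D (\<lambda>i. X i w) * component_term S' D' (\<lambda>i. X i w)) = 0"
proof -
  define p where "p = (\<lambda>i t. component_factor S D i t * component_factor S' D' i t)"
  have eq: "?f = (\<lambda>w. \<Prod>i\<in>I. p i (X i w))"
    by (rule ext) (simp add: component_term_eq_prod[OF finite_I assms(1,2)] component_term_eq_prod[OF finite_I assms(3,4)] p_def prod.distrib)
  have pm: "p i \<in> borel_measurable borel" for i
    unfolding p_def component_factor_def by measurable
  have ind: "indep_vars (\<lambda>_. borel) (\<lambda>i w. p i (X i w)) I"
    by (rule indep_vars_compose2[OF indep]) (rule pm)
  have int: "integrable M (\<lambda>w. p i (X i w))" if i: "i \<in> I" for i
  proof -
    note L = X_fourth[OF i]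
    have "integrable M (\<lambda>w. X i w ^ k)" if "k \<le> 4" for k by (rule fourth_integrable_power[OF L that])
    from this[of 1] this[of 2] this[of 3] this[of 4]
    show ?thesis
      unfolding p_def component_factor_def
      by (cases "i \<in> D"; cases "i \<in> S"; cases "i \<in> D'"; cases "i \<in> S'")
         (simp_all add: algebra_simps power2_eq_square power3_eq_cube power4_eq_xxxx)
  qed
  show "integrable M ?f" unfolding eq by (cases "I = {}") (use ind int finite_I in \<open>auto intro!: indep_vars_integrable\<close>)
  assume ne: "S \<noteq> S'"
  then obtain i where i: "i \<in> I" and iS: "(i \<in> S \<and> i \<notin> S') \<or> (i \<in> S' \<and> i \<notin> S)" using assms by blast
  have "expectation (\<lambda>w. p i (X i w)) = 0"
  proof -
    have "p i = (\<lambda>t. t) \<or> p i = (\<lambda>t. t\<^sup>2 - 1)"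
      using iS assms unfolding p_def component_factor_def by (cases "i \<in> D"; cases "i \<in> D'") auto
    then show ?thesis
    proof
      assume "p i = (\<lambda>t. t\<^sup>2 - 1)"
      moreover have "integrable M (\<lambda>w. (X i w)\<^sup>2)" using fourth_integrable_power[OF X_fourth[OF i], of 2] by simp
      ultimately show ?thesis using second_moment[OF i] prob_space by simp
    qed (simp add: mean[OF i])
  qed
  moreover have "expectation ?f = (\<Prod>i\<in>I. expectation (\<lambda>w. p i (X i w)))"
    unfolding eq using ind int finite_I i by (intro indep_vars_lebesgue_integral) auto
  ultimately show "expectation ?f = 0" using i finite_I by auto
qed

end

text \<open>From here on \<open>Q\<close> is a homogeneous polynomial of degree \<open>d\<close> in the independent variables, with variance
  \<open>\<sigma>\<close>; in the application \<open>\<sigma> = 2 \<nu>\<close>.\<close>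

locale homogeneous_chaos = independent_fourth_moments +
  fixes d :: nat and q :: "nat set \<Rightarrow> real"
  assumes homogeneous: "homogeneous d q" and two_le_d: "2 \<le> d"
begin

definition Q :: "'a \<Rightarrow> real" where "Q = chaos q I"
definition U :: "nat \<Rightarrow> 'a \<Rightarrow> real" where "U i = chaos q (I - {i})"
definition V :: "nat \<Rightarrow> 'a \<Rightarrow> real" where "V i = chaos (partial_coeff i q) (I - {i})"
abbreviation energy :: "nat \<Rightarrow> real" where "energy i \<equiv> expectation (\<lambda>w. V i w ^ 2)"
definition \<Gamma> :: "'a \<Rightarrow> real" where "\<Gamma> w = carre_du_champ I q (\<lambda>i. X i w)"
definition \<sigma> :: real where "\<sigma> = (\<Sum>A\<in>Pow I. (q A)\<^sup>2)"

lemma Q_split: "i \<in> I \<Longrightarrow> Q = (\<lambda>w. U i w + X i w * V i w)"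
  unfolding Q_def U_def V_def chaos_def by (rule ext) (rule multilinear_split[OF finite_I])

lemma \<Gamma>_eq: "\<Gamma> w = (\<Sum>i\<in>I. (1 + (X i w)\<^sup>2) / 2 * (V i w)\<^sup>2)"
  by (simp add: \<Gamma>_def carre_du_champ_def V_def chaos_def)

lemma euler: "(\<Sum>i\<in>I. X i w * V i w) = real d * Q w"
  unfolding Q_def V_def chaos_def by (rule euler_identity[OF finite_I homogeneous])

lemma Q_fourth: "fourth_integrable M Q" unfolding Q_def by (rule chaos_fourth_integrable) simp
lemma V_fourth: "fourth_integrable M (V i)" unfolding V_def by (rule chaos_fourth_integrable) simp
lemma U_fourth: "fourth_integrable M (U i)" unfolding U_def by (rule chaos_fourth_integrable) simp

lemma expectation_V_square:
  assumes i: "i \<in> I"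
  shows "energy i = (\<Sum>A | A \<in> Pow I \<and> i \<in> A. (q A)\<^sup>2)"
  unfolding V_def expectation_chaos_square[OF Diff_subset]
  by (rule sum.reindex_bij_witness[where i="\<lambda>A. A - {i}" and j="insert i"]) (use i in auto)

lemma sum_V_square: "(\<Sum>i\<in>I. energy i) = real d * \<sigma>"
proof -
  have "(\<Sum>i\<in>I. energy i) = (\<Sum>i\<in>I. \<Sum>A | A \<in> Pow I \<and> i \<in> A. (q A)\<^sup>2)"
    by (intro sum.cong refl expectation_V_square)
  also have "\<dots> = (\<Sum>A\<in>Pow I. real (card A) * (q A * q A))"
    unfolding sum_Pow_mem_swap[OF finite_I] by (simp add: power2_eq_square)
  also have "\<dots> = real d * \<sigma>"
    unfolding sum_card_homogeneous[OF homogeneous] \<sigma>_def by (simp add: power2_eq_square)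
  finally show ?thesis .
qed

lemma expectation_Q_square: "expectation (\<lambda>w. Q w ^ 2) = \<sigma>"
  unfolding Q_def \<sigma>_def by (rule expectation_chaos_square) simp

text \<open>Multiply Euler's identity \<open>\<Sum>\<^sub>i X\<^sub>i V\<^sub>i = d Q\<close> by powers of \<open>Q\<close> and compare, coordinate by coordinate, the
  moments of \<open>X\<^sub>i V\<^sub>i Q\<^sup>k\<close> with those of \<open>(1 + X\<^sub>i\<^sup>2) / 2 * V\<^sub>i\<^sup>2 Q\<^bsup>k-1\<^esup>\<close>.\<close>

lemma moment_recursions:
  shows "has_bochner_integral M Q 0"
    and "has_bochner_integral M \<Gamma> (real d * \<sigma>)"
    and "has_bochner_integral M (\<lambda>w. \<Gamma> w * Q w) (real d / 2 * expectation (\<lambda>w. Q w ^ 3))"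
    and "has_bochner_integral M (\<lambda>w. \<Gamma> w * Q w ^ 2)
      (real d / 3 * expectation (\<lambda>w. Q w ^ 4)
        + (\<Sum>i\<in>I. (3 + fourth_moment_of i) / 6 * expectation (\<lambda>w. V i w ^ 4)))"
proof -
  have d0: "real d > 0" using two_le_d by simp
  have iQ: "integrable M (\<lambda>w. Q w ^ k)" if "k \<le> 4" for k by (rule fourth_integrable_power[OF Q_fourth that])
  have E1: "has_bochner_integral M (\<lambda>w. X i w * V i w) 0" if "i \<in> I" for i
    using moment_split[OF that _ Diff_subset, of "{i}" 0 1 1 q "partial_coeff i q", folded U_def V_def] mean[OF that] by simp
  have "has_bochner_integral M (\<lambda>w. \<Sum>i\<in>I. X i w * V i w) (\<Sum>i\<in>I. 0)"
    by (intro has_bochner_integral_sum E1)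
  then have "has_bochner_integral M (\<lambda>w. 1 / real d * (real d * Q w)) (1 / real d * 0)"
    unfolding euler by (intro has_bochner_integral_mult_right) simp
  then show "has_bochner_integral M Q 0" using d0 by simp
  have s1: "has_bochner_integral M (\<lambda>w. X i w * V i w * Q w ^ 2)
          (2 * expectation (\<lambda>w. U i w * V i w ^ 2) + third_moment i * expectation (\<lambda>w. V i w ^ 3))"
    and s2: "has_bochner_integral M (\<lambda>w. X i w * V i w * Q w ^ 3)
          (3 * expectation (\<lambda>w. U i w ^ 2 * V i w ^ 2) + 3 * (third_moment i * expectation (\<lambda>w. U i w * V i w ^ 3))
           + fourth_moment_of i * expectation (\<lambda>w. V i w ^ 4))"
    and s3: "has_bochner_integral M (\<lambda>w. (1 + X i w ^ 2) / 2 * V i w ^ 2) (energy i)"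
    and s4: "has_bochner_integral M (\<lambda>w. (1 + X i w ^ 2) / 2 * V i w ^ 2 * Q w)
          (expectation (\<lambda>w. U i w * V i w ^ 2) + third_moment i * expectation (\<lambda>w. V i w ^ 3) / 2)"
    and s5: "has_bochner_integral M (\<lambda>w. (1 + X i w ^ 2) / 2 * V i w ^ 2 * Q w ^ 2)
          (expectation (\<lambda>w. U i w ^ 2 * V i w ^ 2) + third_moment i * expectation (\<lambda>w. U i w * V i w ^ 3)
           + (1 + fourth_moment_of i) / 2 * expectation (\<lambda>w. V i w ^ 4))" if "i \<in> I" for i
    using mixed_moments(2,3,5,6)[of i "I - {i}" "partial_coeff i q" q, folded U_def V_def]
      mixed_moments(4)[of i "I - {i}" "partial_coeff i q", folded V_def] that
    by (simp_all add: Q_split[OF that])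
  have "has_bochner_integral M (\<lambda>w. \<Sum>i\<in>I. (1 + X i w ^ 2) / 2 * V i w ^ 2) (\<Sum>i\<in>I. energy i)"
    by (intro has_bochner_integral_sum s3)
  then show "has_bochner_integral M \<Gamma> (real d * \<sigma>)"
    unfolding sum_V_square \<Gamma>_eq[symmetric] .
  have "has_bochner_integral M (\<lambda>w. \<Sum>i\<in>I. X i w * V i w * Q w ^ 2)
      (\<Sum>i\<in>I. 2 * expectation (\<lambda>w. U i w * V i w ^ 2) + third_moment i * expectation (\<lambda>w. V i w ^ 3))"
    by (intro has_bochner_integral_sum s1)
  then have e3: "real d * expectation (\<lambda>w. Q w ^ 3)
      = (\<Sum>i\<in>I. 2 * expectation (\<lambda>w. U i w * V i w ^ 2) + third_moment i * expectation (\<lambda>w. V i w ^ 3))"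
    using iQ[of 3] unfolding sum_distrib_right[symmetric] euler
    by (simp add: has_bochner_integral_iff power3_eq_cube power2_eq_square mult.assoc)
  have "has_bochner_integral M (\<lambda>w. \<Sum>i\<in>I. (1 + X i w ^ 2) / 2 * V i w ^ 2 * Q w)
     (\<Sum>i\<in>I. expectation (\<lambda>w. U i w * V i w ^ 2) + third_moment i * expectation (\<lambda>w. V i w ^ 3) / 2)"
    by (intro has_bochner_integral_sum s4)
  moreover have "(\<Sum>i\<in>I. expectation (\<lambda>w. U i w * V i w ^ 2) + third_moment i * expectation (\<lambda>w. V i w ^ 3) / 2)
     = real d / 2 * expectation (\<lambda>w. Q w ^ 3)"
    using e3 by (simp add: sum.distrib sum_divide_distrib[symmetric] sum_distrib_left[symmetric])
  ultimately show "has_bochner_integral M (\<lambda>w. \<Gamma> w * Q w) (real d / 2 * expectation (\<lambda>w. Q w ^ 3))"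
    unfolding sum_distrib_right[symmetric] \<Gamma>_eq by simp
  have "has_bochner_integral M (\<lambda>w. \<Sum>i\<in>I. X i w * V i w * Q w ^ 3)
      (\<Sum>i\<in>I. 3 * expectation (\<lambda>w. U i w ^ 2 * V i w ^ 2) + 3 * (third_moment i * expectation (\<lambda>w. U i w * V i w ^ 3))
           + fourth_moment_of i * expectation (\<lambda>w. V i w ^ 4))"
    by (intro has_bochner_integral_sum s2)
  then have e4: "real d * expectation (\<lambda>w. Q w ^ 4)
      = (\<Sum>i\<in>I. 3 * expectation (\<lambda>w. U i w ^ 2 * V i w ^ 2) + 3 * (third_moment i * expectation (\<lambda>w. U i w * V i w ^ 3))
           + fourth_moment_of i * expectation (\<lambda>w. V i w ^ 4))"
    using iQ[of 4] unfolding sum_distrib_right[symmetric] euler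
    by (simp add: has_bochner_integral_iff power3_eq_cube power4_eq_xxxx mult.assoc)
  have "has_bochner_integral M (\<lambda>w. \<Sum>i\<in>I. (1 + X i w ^ 2) / 2 * V i w ^ 2 * Q w ^ 2)
     (\<Sum>i\<in>I. expectation (\<lambda>w. U i w ^ 2 * V i w ^ 2) + third_moment i * expectation (\<lambda>w. U i w * V i w ^ 3)
           + (1 + fourth_moment_of i) / 2 * expectation (\<lambda>w. V i w ^ 4))"
    by (intro has_bochner_integral_sum s5)
  moreover have "(\<Sum>i\<in>I. expectation (\<lambda>w. U i w ^ 2 * V i w ^ 2) + third_moment i * expectation (\<lambda>w. U i w * V i w ^ 3)
           + (1 + fourth_moment_of i) / 2 * expectation (\<lambda>w. V i w ^ 4))
     = real d / 3 * expectation (\<lambda>w. Q w ^ 4)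
        + (\<Sum>i\<in>I. (3 + fourth_moment_of i) / 6 * expectation (\<lambda>w. V i w ^ 4))"
  proof -
    have "(\<Sum>i\<in>I. expectation (\<lambda>w. U i w ^ 2 * V i w ^ 2) + third_moment i * expectation (\<lambda>w. U i w * V i w ^ 3)
           + (1 + fourth_moment_of i) / 2 * expectation (\<lambda>w. V i w ^ 4))
      = (\<Sum>i\<in>I. 1 / 3 * (3 * expectation (\<lambda>w. U i w ^ 2 * V i w ^ 2) + 3 * (third_moment i * expectation (\<lambda>w. U i w * V i w ^ 3))
           + fourth_moment_of i * expectation (\<lambda>w. V i w ^ 4)) + (3 + fourth_moment_of i) / 6 * expectation (\<lambda>w. V i w ^ 4))"
      by (intro sum.cong refl) (simp add: field_simps)
    also have "\<dots> = 1 / 3 * (real d * expectation (\<lambda>w. Q w ^ 4))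
        + (\<Sum>i\<in>I. (3 + fourth_moment_of i) / 6 * expectation (\<lambda>w. V i w ^ 4))"
      unfolding sum.distrib sum_distrib_left[symmetric] e4 ..
    finally show ?thesis by simp
  qed
  ultimately show "has_bochner_integral M (\<lambda>w. \<Gamma> w * Q w ^ 2)
      (real d / 3 * expectation (\<lambda>w. Q w ^ 4)
        + (\<Sum>i\<in>I. (3 + fourth_moment_of i) / 6 * expectation (\<lambda>w. V i w ^ 4)))"
    unfolding sum_distrib_right[symmetric] \<Gamma>_eq by simp
qed

text \<open>For \<open>\<sigma> = 2 \<nu>\<close>, the discrepancy is the difference between \<open>\<Gamma> / d\<close> and the Stein kernel \<open>2 (x + \<nu>)\<close> of the
  centred chi-square law, evaluated at \<open>Q\<close>; \<open>centred_square\<close> is the function from which it arises by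
  scaling components.\<close>

definition discrepancy :: "'a \<Rightarrow> real" where "discrepancy w = \<Gamma> w / real d - 2 * Q w - \<sigma>"
definition centred_square :: "'a \<Rightarrow> real" where "centred_square w = (Q w)\<^sup>2 - 4 * Q w - \<sigma>"

lemma expectation_centred_square_discrepancy:
  "expectation (\<lambda>w. centred_square w * discrepancy w)
     = (expectation (\<lambda>w. Q w ^ 4) - 12 * expectation (\<lambda>w. Q w ^ 3) - 3 * \<sigma>\<^sup>2 + 24 * \<sigma>) / 3
       + (\<Sum>i\<in>I. (3 + fourth_moment_of i) / (6 * real d) * expectation (\<lambda>w. V i w ^ 4))"
proof -
  have d0: "real d > 0" using two_le_d by simp
  note mr = moment_recursions
  have iQ: "has_bochner_integral M (\<lambda>w. Q w ^ k) (expectation (\<lambda>w. Q w ^ k))" if "k \<le> 4" for k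
    using fourth_integrable_power[OF Q_fourth that] by (simp add: has_bochner_integral_iff)
  have one: "has_bochner_integral M (\<lambda>_. 1 :: real) 1" using prob_space by (simp add: has_bochner_integral_iff)
  let ?s = "\<Sum>i\<in>I. (3 + fourth_moment_of i) / 6 * expectation (\<lambda>w. V i w ^ 4)"
  have "has_bochner_integral M (\<lambda>w. 1 / real d * (\<Gamma> w * Q w ^ 2) + (- (4 / real d)) * (\<Gamma> w * Q w) + (- (\<sigma> / real d)) * \<Gamma> w
       + (-2) * Q w ^ 3 + (8 - \<sigma>) * Q w ^ 2 + (6 * \<sigma>) * Q w + \<sigma>\<^sup>2 * 1)
     (1 / real d * (real d / 3 * expectation (\<lambda>w. Q w ^ 4) + ?s) + (- (4 / real d)) * (real d / 2 * expectation (\<lambda>w. Q w ^ 3))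
       + (- (\<sigma> / real d)) * (real d * \<sigma>) + (-2) * expectation (\<lambda>w. Q w ^ 3) + (8 - \<sigma>) * expectation (\<lambda>w. Q w ^ 2) + (6 * \<sigma>) * 0 + \<sigma>\<^sup>2 * 1)"
    by (intro has_bochner_integral_add has_bochner_integral_mult_right mr iQ one) simp_all
  moreover have "1 / real d * (\<Gamma> w * Q w ^ 2) + (- (4 / real d)) * (\<Gamma> w * Q w) + (- (\<sigma> / real d)) * \<Gamma> w
       + (-2) * Q w ^ 3 + (8 - \<sigma>) * Q w ^ 2 + (6 * \<sigma>) * Q w + \<sigma>\<^sup>2 * 1 = centred_square w * discrepancy w" for w
    unfolding centred_square_def discrepancy_def using d0 by (simp add: field_simps power2_eq_square power3_eq_cube)
  ultimately have "expectation (\<lambda>w. centred_square w * discrepancy w)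
     = 1 / real d * (real d / 3 * expectation (\<lambda>w. Q w ^ 4) + ?s) + (- (4 / real d)) * (real d / 2 * expectation (\<lambda>w. Q w ^ 3))
       + (- (\<sigma> / real d)) * (real d * \<sigma>) + (-2) * expectation (\<lambda>w. Q w ^ 3) + (8 - \<sigma>) * expectation (\<lambda>w. Q w ^ 2) + (6 * \<sigma>) * 0 + \<sigma>\<^sup>2 * 1"
    by (simp add: has_bochner_integral_iff)
  also have "\<dots> = (expectation (\<lambda>w. Q w ^ 4) - 12 * expectation (\<lambda>w. Q w ^ 3) - 3 * \<sigma>\<^sup>2 + 24 * \<sigma>) / 3 + 1 / real d * ?s"
    unfolding expectation_Q_square using d0 by (simp add: field_simps power2_eq_square)
  also have "1 / real d * ?s = (\<Sum>i\<in>I. (3 + fourth_moment_of i) / (6 * real d) * expectation (\<lambda>w. V i w ^ 4))"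
    unfolding sum_distrib_left using d0 by (intro sum.cong refl) (simp add: field_simps)
  finally show ?thesis .
qed

end

section \<open>The spectral gap and the fourth moment\<close>

context homogeneous_chaos
begin

definition component_coeff :: "nat set \<Rightarrow> nat set \<Rightarrow> real" where
  "component_coeff S D = square_coeff I q S D - (if D = S then 4 * q S else 0) - (if S = {} then \<sigma> else 0)"

text \<open>The components of \<open>Q\<^sup>2 - 4 Q - \<sigma>\<close>: the monomials of \<open>Q\<close> are their own components.\<close>

definition component :: "nat set \<Rightarrow> 'a \<Rightarrow> real" where
  "component S w = (\<Sum>D\<in>Pow S. component_coeff S D * component_term S D (\<lambda>i. X i w))"

lemma component_eq:
  assumes "S \<in> Pow I"
  shows "component S w = (\<Sum>D\<in>Pow S. square_coeff I q S D * component_term S D (\<lambda>i. X i w))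
      - 4 * (q S * (\<Prod>i\<in>S. X i w)) - (if S = {} then \<sigma> else 0)"
proof -
  have fS: "finite (Pow S)" using assms finite_I by (auto intro: finite_subset)
  have "component S w = (\<Sum>D\<in>Pow S. square_coeff I q S D * component_term S D (\<lambda>i. X i w))
      - (\<Sum>D\<in>Pow S. if D = S then 4 * q S * component_term S D (\<lambda>i. X i w) else 0)
      - (\<Sum>D\<in>Pow S. if S = {} then \<sigma> * component_term S D (\<lambda>i. X i w) else 0)"
    unfolding component_def component_coeff_def sum_subtractf[symmetric]
    by (intro sum.cong refl) (simp add: algebra_simps)
  moreover have "(\<Sum>D\<in>Pow S. if D = S then 4 * q S * component_term S D (\<lambda>i. X i w) else 0) = 4 * (q S * (\<Prod>i\<in>S. X i w))"
    using fS by (simp add: component_term_def)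
  moreover have "(\<Sum>D\<in>Pow S. if S = {} then \<sigma> * component_term S D (\<lambda>i. X i w) else 0) = (if S = {} then \<sigma> else 0)"
    by (cases "S = {}") (simp_all add: component_term_def)
  ultimately show ?thesis by simp
qed

definition eigenvalue :: "nat set \<Rightarrow> real" where "eigenvalue S = 1 - real (card S) / (2 * real d)"

text \<open>On the components of \<open>Q\<close>, where \<open>|S| = d\<close>, the eigenvalue is \<open>1/2\<close>; this is how \<open>4 Q\<close> becomes \<open>2 Q\<close>.\<close>

lemma sum_component: "(\<Sum>S\<in>Pow I. component S w) = centred_square w"
  and sum_eigenvalue_component: "(\<Sum>S\<in>Pow I. eigenvalue S * component S w) = discrepancy w"
proof -
  let ?x = "\<lambda>i. X i w"
  have d0: "real d > 0" using two_le_d by simp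
  have fin: "finite (Pow I)" using finite_I by simp
  have *: "(\<Sum>S\<in>Pow I. a S * component S w) = (\<Sum>S\<in>Pow I. a S * (\<Sum>D\<in>Pow S. square_coeff I q S D * component_term S D ?x))
     - 4 * (\<Sum>S\<in>Pow I. a S * (q S * (\<Prod>i\<in>S. X i w))) - a {} * \<sigma>" for a
  proof -
    have "(\<Sum>S\<in>Pow I. a S * component S w) = (\<Sum>S\<in>Pow I. a S * (\<Sum>D\<in>Pow S. square_coeff I q S D * component_term S D ?x)
      - 4 * (a S * (q S * (\<Prod>i\<in>S. X i w))) - (if S = {} then a {} * \<sigma> else 0))"
      by (intro sum.cong refl) (simp add: component_eq right_diff_distrib)
    also have "\<dots> = (\<Sum>S\<in>Pow I. a S * (\<Sum>D\<in>Pow S. square_coeff I q S D * component_term S D ?x))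
     - 4 * (\<Sum>S\<in>Pow I. a S * (q S * (\<Prod>i\<in>S. X i w))) - (\<Sum>S\<in>Pow I. if S = {} then a {} * \<sigma> else 0)"
      by (simp only: sum_subtractf sum_distrib_left)
    also have "(\<Sum>S\<in>Pow I. if S = {} then a {} * \<sigma> else 0) = a {} * \<sigma>" using fin by simp
    finally show ?thesis .
  qed
  have Q1: "(\<Sum>S\<in>Pow I. q S * (\<Prod>i\<in>S. X i w)) = Q w" by (simp add: Q_def chaos_def multilinear_def)
  show "(\<Sum>S\<in>Pow I. component S w) = centred_square w"
    using *[of "\<lambda>_. 1"] square_component_sum[OF finite_I, of q ?x]
    unfolding centred_square_def by (simp add: Q1) (simp add: Q_def chaos_def)
  have Q2: "(\<Sum>S\<in>Pow I. eigenvalue S * (q S * (\<Prod>i\<in>S. X i w))) = Q w / 2"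
  proof -
    have "(\<Sum>S\<in>Pow I. eigenvalue S * (q S * (\<Prod>i\<in>S. X i w))) = (\<Sum>S\<in>Pow I. 1 / 2 * (q S * (\<Prod>i\<in>S. X i w)))"
    proof (rule sum.cong[OF refl])
      fix S
      show "eigenvalue S * (q S * (\<Prod>i\<in>S. X i w)) = 1 / 2 * (q S * (\<Prod>i\<in>S. X i w))"
        using homogeneousD[OF homogeneous, of S] d0 by (cases "q S = 0") (auto simp: eigenvalue_def)
    qed
    then show ?thesis unfolding sum_distrib_left[symmetric] Q1 by simp
  qed
  have ev: "eigenvalue S = 1 / (2 * real d) * (2 * real d - real (card S))" for S
    using d0 by (simp add: eigenvalue_def field_simps)
  have G: "(\<Sum>S\<in>Pow I. eigenvalue S * (\<Sum>D\<in>Pow S. square_coeff I q S D * component_term S D ?x)) = \<Gamma> w / real d"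
  proof -
    have "(\<Sum>S\<in>Pow I. eigenvalue S * (\<Sum>D\<in>Pow S. square_coeff I q S D * component_term S D ?x))
       = (\<Sum>S\<in>Pow I. 1 / (2 * real d) * ((2 * real d - real (card S)) * (\<Sum>D\<in>Pow S. square_coeff I q S D * component_term S D ?x)))"
      unfolding ev mult.assoc ..
    also have "\<dots> = 1 / (2 * real d) * (2 * carre_du_champ I q ?x)"
      unfolding sum_distrib_left[symmetric] carre_du_champ_component_sum[OF finite_I homogeneous] ..
    finally show ?thesis by (simp add: \<Gamma>_def)
  qed
  show "(\<Sum>S\<in>Pow I. eigenvalue S * component S w) = discrepancy w"
    unfolding * Q2 G discrepancy_def by (simp add: eigenvalue_def)
qed

lemma component_product:
  assumes S: "S \<in> Pow I" "T \<in> Pow I"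
  shows "integrable M (\<lambda>w. component S w * component T w)"
    and "S \<noteq> T \<Longrightarrow> expectation (\<lambda>w. component S w * component T w) = 0"
proof -
  let ?t = "\<lambda>S D w. component_term S D (\<lambda>i. X i w)"
  have eq: "component S w * component T w = (\<Sum>D\<in>Pow S. \<Sum>E\<in>Pow T. component_coeff S D * component_coeff T E * (?t S D w * ?t T E w))" for w
    unfolding component_def sum_product by (intro sum.cong refl) simp
  have int: "integrable M (\<lambda>w. ?t S D w * ?t T E w)" if "D \<in> Pow S" "E \<in> Pow T" for D E
    using component_term_product(1)[of D S E T] that S by auto
  show "integrable M (\<lambda>w. component S w * component T w)"
    unfolding eq by (intro Bochner_Integration.integrable_sum integrable_mult_right int)
  assume ne: "S \<noteq> T"
  have "has_bochner_integral M (\<lambda>w. ?t S D w * ?t T E w) 0" if "D \<in> Pow S" "E \<in> Pow T" for D E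
    using component_term_product(2)[OF _ _ _ _ ne, of D E] int[OF that] that S by (simp add: has_bochner_integral_iff)
  then have "has_bochner_integral M (\<lambda>w. component S w * component T w) (\<Sum>D\<in>Pow S. \<Sum>E\<in>Pow T. component_coeff S D * component_coeff T E * 0)"
    unfolding eq by (intro has_bochner_integral_sum has_bochner_integral_mult_right)
  then show "expectation (\<lambda>w. component S w * component T w) = 0" by (simp add: has_bochner_integral_iff)
qed

lemma q_eq_0: "card A \<noteq> d \<Longrightarrow> q A = 0"
  using homogeneous by (auto simp: homogeneous_def)

lemma square_coeff_empty:
  assumes "S \<in> Pow I"
  shows "square_coeff I q S {} = (\<Sum>A\<in>Pow I. if S \<subseteq> A then (q A)\<^sup>2 else 0)"
  unfolding square_coeff_def
proof (rule sum.cong[OF refl])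
  fix A assume A: "A \<in> Pow I"
  have "(\<Sum>B\<in>Pow I. if {} = sym_diff A B \<and> S \<subseteq> A \<union> B then q A * q B else 0)
      = (\<Sum>B\<in>Pow I. if B = A then (if S \<subseteq> A then q A * q A else 0) else 0)"
    by (rule sum.cong[OF refl]) auto
  then show "(\<Sum>B\<in>Pow I. if {} = sym_diff A B \<and> S \<subseteq> A \<union> B then q A * q B else 0) = (if S \<subseteq> A then (q A)\<^sup>2 else 0)"
    using A finite_I by (simp add: power2_eq_square)
qed

lemma component_empty: "component {} w = 0"
proof -
  have "q {} = 0" using two_le_d by (intro q_eq_0) auto
  then show ?thesis
    using square_coeff_empty[of "{}"] by (simp add: component_def component_coeff_def \<sigma>_def)
qed

text \<open>Two sets of the same size never differ in exactly one point, so only the diagonal pairs \<open>A = B\<close>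
  contribute.\<close>

lemma component_singleton:
  assumes i: "i \<in> I"
  shows "component {i} w = energy i * ((X i w)\<^sup>2 - 1)"
proof -
  have q0: "q {i} = 0" using two_le_d by (intro q_eq_0) auto
  have "square_coeff I q {i} {i} = 0"
    unfolding square_coeff_def
  proof (intro sum.neutral ballI)
    fix A B assume AB: "A \<in> Pow I" "B \<in> Pow I"
    have fin: "finite A" "finite B" using AB finite_I by (auto intro: finite_subset)
    show "(if {i} = sym_diff A B \<and> {i} \<subseteq> A \<union> B then q A * q B else 0) = 0"
    proof (cases "{i} = sym_diff A B \<and> card A = card B")
      case True
      have "card A = card (A \<inter> B) + card (A - B)" "card B = card (A \<inter> B) + card (B - A)"
        using card_Int_Diff[OF fin(1), of B] card_Int_Diff[OF fin(2), of A] by (simp_all add: Int_commute)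
      moreover have "card (sym_diff A B) = card (A - B) + card (B - A)"
        using fin by (intro card_Un_disjoint) auto
      moreover have "card (sym_diff A B) = 1" using True by (metis card_1_singleton_iff One_nat_def)
      ultimately have False using True by presburger
      then show ?thesis ..
    next
      case False
      show ?thesis
      proof (cases "card A = card B")
        case True
        with False have "{i} \<noteq> sym_diff A B" by simp
        then show ?thesis by simp
      next
        case False
        then have "q A * q B = 0" using q_eq_0[of A] q_eq_0[of B] by (cases "card A = d") simp_all
        then show ?thesis by simp
      qed
    qed
  qed
  moreover have "square_coeff I q {i} {} = energy i"
  proof -
    have "square_coeff I q {i} {} = (\<Sum>A\<in>Pow I. if i \<in> A then (q A)\<^sup>2 else 0)"
      using square_coeff_empty[of "{i}"] i by simp
    also have "\<dots> = (\<Sum>A | A \<in> Pow I \<and> i \<in> A. (q A)\<^sup>2)"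
      by (rule sum.inter_filter[symmetric]) (use finite_I in simp)
    finally show ?thesis by (simp only: expectation_V_square[OF i])
  qed
  moreover have "Pow {i} = {{}, {i}}" by auto
  ultimately show ?thesis
    using q0 by (simp add: component_def component_coeff_def component_term_def)
qed

lemma component_eq_0_of_card_gt:
  assumes S: "S \<in> Pow I" "card S > 2 * d"
  shows "component S w = 0"
proof -
  have "q S = 0" using S two_le_d by (intro q_eq_0) auto
  moreover have "square_coeff I q S D = 0" for D
    unfolding square_coeff_def
  proof (intro sum.neutral ballI)
    fix A B assume AB: "A \<in> Pow I" "B \<in> Pow I"
    have fin: "finite A" "finite B" using AB finite_I by (auto intro: finite_subset)
    show "(if D = sym_diff A B \<and> S \<subseteq> A \<union> B then q A * q B else 0) = 0"
    proof (cases "card A = d \<and> card B = d")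
      case True
      have "\<not> S \<subseteq> A \<union> B"
      proof
        assume "S \<subseteq> A \<union> B"
        then have "card S \<le> card (A \<union> B)" using fin by (intro card_mono) auto
        also have "\<dots> \<le> card A + card B" by (rule card_Un_le)
        finally show False using True S by simp
      qed
      then show ?thesis by simp
    qed (auto simp: q_eq_0)
  qed
  moreover have "S \<noteq> {}" using S by auto
  ultimately have "component_coeff S D = 0" for D by (simp add: component_coeff_def)
  then show ?thesis by (simp add: component_def)
qed

text \<open>By orthogonality both sides are sums over \<open>S\<close>, with coefficients \<open>t\<^sub>S\<^sup>2\<close> and \<open>t\<^sub>S\<close>, and
  \<open>t\<^sub>S\<^sup>2 \<le> (d - 1) / d * t\<^sub>S\<close> for \<open>2 \<le> |S| \<le> 2 d\<close>. For \<open>|S| = 1\<close> this fails by at most \<open>1 / (2 d)\<close>, which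
  produces the last term.\<close>

lemma spectral_gap_bound:
  shows "integrable M (\<lambda>w. (discrepancy w)\<^sup>2)"
    and "expectation (\<lambda>w. (discrepancy w)\<^sup>2)
     \<le> (real d - 1) / real d * expectation (\<lambda>w. centred_square w * discrepancy w)
       + \<beta> / (2 * real d) * (\<Sum>i\<in>I. (energy i)\<^sup>2)"
proof -
  have d0: "real d \<ge> 2" using two_le_d by simp
  let ?n = "\<lambda>S. expectation (\<lambda>w. component S w ^ 2)"
  have fin: "finite (Pow I)" using finite_I by simp
  note orth = has_bochner_integral_orthogonal_sum[OF fin, of M component]
  have A: "has_bochner_integral M (\<lambda>w. (discrepancy w)\<^sup>2) (\<Sum>S\<in>Pow I. eigenvalue S * eigenvalue S * ?n S)"
    using orth[of eigenvalue eigenvalue] component_product unfolding sum_eigenvalue_component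
    by (simp add: has_bochner_integral_iff power2_eq_square)
  have B: "has_bochner_integral M (\<lambda>w. centred_square w * discrepancy w) (\<Sum>S\<in>Pow I. eigenvalue S * ?n S)"
    using orth[of "\<lambda>_. 1" eigenvalue] component_product unfolding mult_1 sum_component sum_eigenvalue_component
    by (simp add: has_bochner_integral_iff)
  show "integrable M (\<lambda>w. (discrepancy w)\<^sup>2)" using A by (simp add: has_bochner_integral_iff)
  have termwise: "eigenvalue S * eigenvalue S * ?n S \<le> (real d - 1) / real d * (eigenvalue S * ?n S) + (if card S = 1 then 1 / (2 * real d) * ?n S else 0)"
    if S: "S \<in> Pow I" for S
  proof -
    have n0: "?n S \<ge> 0" by simp
    consider "S = {}" | "card S = 1" | "2 \<le> card S" "card S \<le> 2 * d" | "card S > 2 * d"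
      using S finite_I by (cases "card S") (auto simp: card_eq_0_iff intro: finite_subset, linarith)
    then show ?thesis
    proof cases
      case 1
      then show ?thesis by (simp add: component_empty)
    next
      case 2
      have "eigenvalue S * eigenvalue S = (real d - 1) / real d * eigenvalue S + eigenvalue S * (1 / (2 * real d))"
        unfolding eigenvalue_def using 2 d0 by (simp add: field_simps)
      also have "\<dots> \<le> (real d - 1) / real d * eigenvalue S + 1 * (1 / (2 * real d))"
        unfolding eigenvalue_def using 2 d0 by (intro add_left_mono mult_right_mono) auto
      finally have "eigenvalue S * eigenvalue S * ?n S \<le> ((real d - 1) / real d * eigenvalue S + 1 * (1 / (2 * real d))) * ?n S"
        by (intro mult_right_mono n0)
      then show ?thesis using 2 by (simp add: distrib_right)
    next
      case 3
      have "eigenvalue S \<ge> 0" using 3 d0 by (simp add: eigenvalue_def field_simps)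
      moreover have "eigenvalue S \<le> (real d - 1) / real d" using 3 d0 by (simp add: eigenvalue_def field_simps)
      ultimately have "eigenvalue S * (eigenvalue S * ?n S) \<le> (real d - 1) / real d * (eigenvalue S * ?n S)"
        using n0 by (intro mult_right_mono) auto
      then show ?thesis using 3 by (simp add: mult.assoc)
    next
      case 4
      then show ?thesis using component_eq_0_of_card_gt[OF S] by simp
    qed
  qed
  have single: "(\<Sum>S\<in>Pow I. if card S = 1 then 1 / (2 * real d) * ?n S else 0)
      \<le> \<beta> / (2 * real d) * (\<Sum>i\<in>I. (energy i)\<^sup>2)"
  proof -
    have "(\<Sum>S\<in>Pow I. if card S = 1 then 1 / (2 * real d) * ?n S else 0) = (\<Sum>S | S \<in> Pow I \<and> card S = 1. 1 / (2 * real d) * ?n S)"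
      by (rule sum.inter_filter[symmetric, OF fin])
    also have "\<dots> = (\<Sum>i\<in>I. 1 / (2 * real d) * ?n {i})"
      by (rule sum.reindex_bij_witness[where i="\<lambda>i. {i}" and j="\<lambda>S. the_elem S"]) (auto simp: card_1_singleton_iff)
    also have "\<dots> \<le> (\<Sum>i\<in>I. 1 / (2 * real d) * (\<beta> * (energy i)\<^sup>2))"
    proof (intro sum_mono mult_left_mono)
      fix i assume i: "i \<in> I"
            note iX = fourth_integrable_power[OF X_fourth[OF i]]
      have "?n {i} = expectation (\<lambda>w. (energy i)\<^sup>2 * (X i w ^ 4 - 2 * X i w ^ 2 + 1))"
        unfolding component_singleton[OF i] by (rule Bochner_Integration.integral_cong) (simp_all add: power2_eq_square power4_eq_xxxx algebra_simps)
      also have "\<dots> = (energy i)\<^sup>2 * (fourth_moment_of i - 1)"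
        using iX[of 4] iX[of 2] second_moment[OF i] prob_space by simp
      also have "\<dots> \<le> (energy i)\<^sup>2 * \<beta>" using fourth_moment[OF i] by (intro mult_left_mono) auto
      finally show "?n {i} \<le> \<beta> * (energy i)\<^sup>2" by (simp add: mult.commute)
    qed (use d0 in auto)
    also have "\<dots> = \<beta> / (2 * real d) * (\<Sum>i\<in>I. (energy i)\<^sup>2)"
      unfolding sum_distrib_left by (intro sum.cong refl) simp
    finally show ?thesis .
  qed
  have "expectation (\<lambda>w. (discrepancy w)\<^sup>2) = (\<Sum>S\<in>Pow I. eigenvalue S * eigenvalue S * ?n S)"
    using A by (simp add: has_bochner_integral_iff)
  also have "\<dots> \<le> (\<Sum>S\<in>Pow I. (real d - 1) / real d * (eigenvalue S * ?n S) + (if card S = 1 then 1 / (2 * real d) * ?n S else 0))"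
    by (intro sum_mono termwise)
  also have "\<dots> = (real d - 1) / real d * (\<Sum>S\<in>Pow I. eigenvalue S * ?n S) + (\<Sum>S\<in>Pow I. if card S = 1 then 1 / (2 * real d) * ?n S else 0)"
    by (simp only: sum.distrib sum_distrib_left)
  also have "\<dots> \<le> (real d - 1) / real d * (\<Sum>S\<in>Pow I. eigenvalue S * ?n S) + \<beta> / (2 * real d) * (\<Sum>i\<in>I. (energy i)\<^sup>2)"
    by (intro add_left_mono single)
  also have "(\<Sum>S\<in>Pow I. eigenvalue S * ?n S) = expectation (\<lambda>w. centred_square w * discrepancy w)"
    using B by (simp add: has_bochner_integral_iff)
  finally show "expectation (\<lambda>w. (discrepancy w)\<^sup>2)
     \<le> (real d - 1) / real d * expectation (\<lambda>w. centred_square w * discrepancy w)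
       + \<beta> / (2 * real d) * (\<Sum>i\<in>I. (energy i)\<^sup>2)" .
qed

lemma expectation_V_power4_le:
  assumes i: "i \<in> I"
  shows "expectation (\<lambda>w. V i w ^ 4) \<le> (16 * \<beta>) ^ (d - 1) * (energy i)\<^sup>2"
  unfolding V_def
proof (rule hypercontractivity)
  fix A assume A: "A \<subseteq> I - {i}" "d - 1 < card A"
  then have "card (insert i A) = Suc (card A)"
    using finite_I by (intro card_insert_disjoint) (auto intro: finite_subset)
  then show "q (insert i A) = 0" using A two_le_d by (intro q_eq_0) auto
qed auto

text \<open>Both error terms are multiples of \<open>\<Sum>\<^sub>i (E V\<^sub>i\<^sup>2)\<^sup>2 \<le> L \<Sum>\<^sub>i E V\<^sub>i\<^sup>2 = L d \<sigma>\<close>, the first one by hypercontractivity.\<close>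

theorem discrepancy_fourth_moment_bound:
  assumes L: "\<And>i. i \<in> I \<Longrightarrow> energy i \<le> L"
  shows "expectation (\<lambda>w. (discrepancy w)\<^sup>2)
     \<le> (real d - 1) / (3 * real d) *
          (expectation (\<lambda>w. Q w ^ 4) - 12 * expectation (\<lambda>w. Q w ^ 3) - 3 * \<sigma>\<^sup>2 + 24 * \<sigma>)
        + (16 * \<beta>) ^ d * L * \<sigma> / 8"
proof -
  have d0: "real d \<ge> 2" using two_le_d by simp
  let ?\<rho> = "(16 * \<beta>) ^ (d - 1)"
  let ?m = "expectation (\<lambda>w. Q w ^ 4) - 12 * expectation (\<lambda>w. Q w ^ 3) - 3 * \<sigma>\<^sup>2 + 24 * \<sigma>"
  have \<rho>1: "1 \<le> ?\<rho>" using one_le_\<beta> by (intro one_le_power) simp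
  have v0: "energy i \<ge> 0" for i by simp
  have vv: "(\<Sum>i\<in>I. (energy i)\<^sup>2) \<le> L * (real d * \<sigma>)"
  proof -
    have "(\<Sum>i\<in>I. (energy i)\<^sup>2) \<le> (\<Sum>i\<in>I. L * energy i)"
    proof (rule sum_mono)
      fix i assume "i \<in> I"
      then show "(energy i)\<^sup>2 \<le> L * energy i"
        unfolding power2_eq_square[of "energy i"] by (intro mult_right_mono L v0)
    qed
    then show ?thesis by (simp only: sum_distrib_left[symmetric] sum_V_square)
  qed
  have vv0: "0 \<le> (\<Sum>i\<in>I. (energy i)\<^sup>2)" by (intro sum_nonneg) auto
  have err: "(\<Sum>i\<in>I. (3 + fourth_moment_of i) / (6 * real d) * expectation (\<lambda>w. V i w ^ 4))
      \<le> 2 * \<beta> / (3 * real d) * ?\<rho> * (\<Sum>i\<in>I. (energy i)\<^sup>2)"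
    unfolding sum_distrib_left
  proof (intro sum_mono)
    fix i assume i: "i \<in> I"
    have "(3 + fourth_moment_of i) / (6 * real d) \<le> (4 * \<beta>) / (6 * real d)"
      using fourth_moment[OF i] one_le_\<beta> d0 by (intro divide_right_mono) auto
    then have "(3 + fourth_moment_of i) / (6 * real d) * expectation (\<lambda>w. V i w ^ 4)
      \<le> (4 * \<beta>) / (6 * real d) * (?\<rho> * (energy i)\<^sup>2)"
      using one_le_\<beta> d0 expectation_V_power4_le[OF i] by (intro mult_mono) auto
    then show "(3 + fourth_moment_of i) / (6 * real d) * expectation (\<lambda>w. V i w ^ 4)
      \<le> 2 * \<beta> / (3 * real d) * ?\<rho> * (energy i)\<^sup>2" by simp
  qed
  have s0: "0 \<le> (\<Sum>i\<in>I. (3 + fourth_moment_of i) / (6 * real d) * expectation (\<lambda>w. V i w ^ 4))"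
  proof (rule sum_nonneg)
    fix i assume "i \<in> I"
    then have "fourth_moment_of i \<ge> 0" using one_le_fourth_moment[of i] by linarith
    then show "0 \<le> (3 + fourth_moment_of i) / (6 * real d) * expectation (\<lambda>w. V i w ^ 4)" by simp
  qed
  have "expectation (\<lambda>w. (discrepancy w)\<^sup>2)
     \<le> (real d - 1) / real d * (?m / 3 + (\<Sum>i\<in>I. (3 + fourth_moment_of i) / (6 * real d) * expectation (\<lambda>w. V i w ^ 4)))
       + \<beta> / (2 * real d) * (\<Sum>i\<in>I. (energy i)\<^sup>2)"
    using spectral_gap_bound(2) unfolding expectation_centred_square_discrepancy .
  also have "\<dots> \<le> (real d - 1) / (3 * real d) * ?m + 1 * (2 * \<beta> / (3 * real d) * ?\<rho> * (\<Sum>i\<in>I. (energy i)\<^sup>2))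
      + \<beta> / (2 * real d) * ?\<rho> * (\<Sum>i\<in>I. (energy i)\<^sup>2)"
  proof (rule add_mono)
    have "(real d - 1) / real d * (\<Sum>i\<in>I. (3 + fourth_moment_of i) / (6 * real d) * expectation (\<lambda>w. V i w ^ 4))
      \<le> 1 * (2 * \<beta> / (3 * real d) * ?\<rho> * (\<Sum>i\<in>I. (energy i)\<^sup>2))"
      using err d0 s0 by (intro mult_mono) auto
    moreover have "(real d - 1) / real d * (?m / 3) = (real d - 1) / (3 * real d) * ?m" by simp
    ultimately show "(real d - 1) / real d * (?m / 3 + (\<Sum>i\<in>I. (3 + fourth_moment_of i) / (6 * real d) * expectation (\<lambda>w. V i w ^ 4)))
       \<le> (real d - 1) / (3 * real d) * ?m + 1 * (2 * \<beta> / (3 * real d) * ?\<rho> * (\<Sum>i\<in>I. (energy i)\<^sup>2))"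
      by (simp only: distrib_left)
    have "\<beta> / (2 * real d) * 1 \<le> \<beta> / (2 * real d) * ?\<rho>"
      using \<rho>1 one_le_\<beta> d0 by (intro mult_left_mono) auto
    then show "\<beta> / (2 * real d) * (\<Sum>i\<in>I. (energy i)\<^sup>2) \<le> \<beta> / (2 * real d) * ?\<rho> * (\<Sum>i\<in>I. (energy i)\<^sup>2)"
      using vv0 by (intro mult_right_mono) auto
  qed
  also have "\<dots> = (real d - 1) / (3 * real d) * ?m + (7 / 6) * \<beta> / real d * ?\<rho> * (\<Sum>i\<in>I. (energy i)\<^sup>2)"
    by (simp add: field_simps)
  also have "\<dots> \<le> (real d - 1) / (3 * real d) * ?m + 2 * \<beta> / real d * ?\<rho> * (L * (real d * \<sigma>))"
    using vv vv0 one_le_\<beta> d0 \<rho>1 by (intro add_left_mono mult_mono divide_right_mono) auto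
  also have "2 * \<beta> / real d * ?\<rho> * (L * (real d * \<sigma>)) = (16 * \<beta>) * ?\<rho> * L * \<sigma> / 8"
    using d0 by simp
  also have "(16 * \<beta>) * ?\<rho> = (16 * \<beta>) ^ d" using two_le_d by (simp add: power_eq_if)
  finally show ?thesis .
qed

end

section \<open>Integration by parts on the product space\<close>

context homogeneous_chaos
begin

lemma abs_X_moments:
  assumes i: "i \<in> I"
  shows "expectation (\<lambda>w. \<bar>X i w\<bar>) \<le> sqrt \<beta>" and "expectation (\<lambda>w. \<bar>X i w\<bar> ^ 3) \<le> sqrt \<beta>"
proof -
  note iX = fourth_integrable_power[OF X_fourth[OF i]]
  have "(expectation (\<lambda>w. 1 * \<bar>X i w\<bar>))\<^sup>2 \<le> expectation (\<lambda>w. 1\<^sup>2) * expectation (\<lambda>w. \<bar>X i w\<bar>\<^sup>2)"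
    using iX[of 1] iX[of 2] by (intro cauchy_schwarz_expectation) (simp_all add: integrable_abs)
  then have "(expectation (\<lambda>w. \<bar>X i w\<bar>))\<^sup>2 \<le> \<beta>" using second_moment[OF i] prob_space one_le_\<beta> by simp
  then show "expectation (\<lambda>w. \<bar>X i w\<bar>) \<le> sqrt \<beta>" by (rule real_le_rsqrt)
  have 3: "\<bar>X i w\<bar> * (X i w)\<^sup>2 = \<bar>X i w\<bar> ^ 3" for w
    by (simp add: power3_eq_cube power2_eq_square abs_mult)
  have i3: "integrable M (\<lambda>w. \<bar>X i w\<bar> ^ 3)"
    using integrable_abs[OF iX[of 3]] by (simp add: power_abs)
  have "(expectation (\<lambda>w. \<bar>X i w\<bar> * (X i w)\<^sup>2))\<^sup>2 \<le> expectation (\<lambda>w. \<bar>X i w\<bar>\<^sup>2) * expectation (\<lambda>w. ((X i w)\<^sup>2)\<^sup>2)"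
    using iX[of 2] iX[of 4] i3 by (intro cauchy_schwarz_expectation) (simp_all add: 3 power_mult[symmetric])
  also have "\<dots> = fourth_moment_of i" using second_moment[OF i] by (simp add: power_mult[symmetric])
  also have "\<dots> \<le> \<beta>" by (rule fourth_moment[OF i])
  finally show "expectation (\<lambda>w. \<bar>X i w\<bar> ^ 3) \<le> sqrt \<beta>" unfolding 3 by (rule real_le_rsqrt)
qed

lemma abs_V_cube_integrable: "integrable M (\<lambda>w. \<bar>V i w\<bar> ^ 3)"
  using integrable_abs[OF fourth_integrable_power[OF V_fourth[of i], of 3]] by (simp add: power_abs)

lemma abs_V_cube:
  assumes i: "i \<in> I" and L: "energy i \<le> L"
  shows "expectation (\<lambda>w. \<bar>V i w\<bar> ^ 3) \<le> sqrt ((16 * \<beta>) ^ (d - 1) * L) * energy i"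
proof -
  let ?\<rho> = "(16 * \<beta>) ^ (d - 1)"
  have v0: "0 \<le> energy i" by simp
  have \<rho>0: "0 \<le> ?\<rho>" using one_le_\<beta> by simp
  note iV = fourth_integrable_power[OF V_fourth[of i]]
  have 3: "\<bar>V i w\<bar> * (V i w)\<^sup>2 = \<bar>V i w\<bar> ^ 3" for w
    by (simp add: power3_eq_cube power2_eq_square abs_mult)
  have "(expectation (\<lambda>w. \<bar>V i w\<bar> * (V i w)\<^sup>2))\<^sup>2 \<le> expectation (\<lambda>w. \<bar>V i w\<bar>\<^sup>2) * expectation (\<lambda>w. ((V i w)\<^sup>2)\<^sup>2)"
    using iV[of 2] iV[of 4] abs_V_cube_integrable[of i] by (intro cauchy_schwarz_expectation) (simp_all add: 3 power_mult[symmetric])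
  also have "\<dots> = energy i * expectation (\<lambda>w. V i w ^ 4)" by (simp add: power_mult[symmetric])
  also have "\<dots> \<le> energy i * (?\<rho> * (energy i)\<^sup>2)" by (intro mult_left_mono expectation_V_power4_le[OF i] v0)
  also have "\<dots> \<le> L * (?\<rho> * (energy i)\<^sup>2)" using L \<rho>0 by (intro mult_right_mono) auto
  also have "\<dots> = (?\<rho> * L) * (energy i)\<^sup>2" by simp
  finally have "expectation (\<lambda>w. \<bar>V i w\<bar> ^ 3) \<le> sqrt ((?\<rho> * L) * (energy i)\<^sup>2)"
    unfolding 3 by (rule real_le_rsqrt)
  also have "\<dots> = sqrt (?\<rho> * L) * energy i" using v0 by (simp add: real_sqrt_mult)
  finally show ?thesis .
qed

end

lemma first_order_remainder:
  fixes F F' F'' :: "real \<Rightarrow> real"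
  assumes F: "\<And>x. (F has_real_derivative F' x) (at x)" "\<And>x. (F' has_real_derivative F'' x) (at x)"
    and C: "\<And>x. \<bar>F'' x\<bar> \<le> C"
  shows "\<bar>F' b - F' a\<bar> \<le> C * \<bar>b - a\<bar>" and "\<bar>F b - F a - (b - a) * F' a\<bar> \<le> C * (b - a)\<^sup>2"
proof -
  have lip: "\<bar>F' b - F' a\<bar> \<le> C * \<bar>b - a\<bar>" for a b
    by (rule lipschitz_of_DERIV_bound[OF F(2) C])
  show "\<bar>F' b - F' a\<bar> \<le> C * \<bar>b - a\<bar>" by (rule lip)
  have C0: "C \<ge> 0" using C[of 0] by (smt (verit))
  have "\<exists>z. \<bar>z - a\<bar> \<le> \<bar>b - a\<bar> \<and> F b - F a = (b - a) * F' z"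
  proof -
    consider "a < b" | "a = b" | "b < a" by linarith
    then show ?thesis
    proof cases
      case 1
      from MVT2[OF 1 F(1)] obtain z where "a < z" "z < b" "F b - F a = (b - a) * F' z" by blast
      then show ?thesis by (intro exI[of _ z]) auto
    next
      case 3
      from MVT2[OF 3 F(1)] obtain z where "b < z" "z < a" "F a - F b = (a - b) * F' z" by blast
      then show ?thesis by (intro exI[of _ z]) (auto simp: algebra_simps)
    qed auto
  qed
  then obtain z where z: "\<bar>z - a\<bar> \<le> \<bar>b - a\<bar>" "F b - F a = (b - a) * F' z" by blast
  have "\<bar>F b - F a - (b - a) * F' a\<bar> = \<bar>b - a\<bar> * \<bar>F' z - F' a\<bar>"
    unfolding z(2) abs_mult[symmetric] by (simp add: algebra_simps)
  also have "\<dots> \<le> \<bar>b - a\<bar> * (C * \<bar>b - a\<bar>)"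
    using lip[of z a] mult_left_mono[OF z(1) C0] by (intro mult_left_mono) auto
  also have "\<dots> = C * (b - a)\<^sup>2" by (simp add: power2_eq_square)
  finally show "\<bar>F b - F a - (b - a) * F' a\<bar> \<le> C * (b - a)\<^sup>2" .
qed

context homogeneous_chaos
begin

text \<open>Expand \<open>F(Q)\<close> to first order and \<open>F'(Q)\<close> to zeroth order around \<open>U\<^sub>i\<close>. Since \<open>X\<^sub>i\<close> is independent of
  \<open>(U\<^sub>i, V\<^sub>i)\<close>, the leading terms are \<open>E[X\<^sub>i V\<^sub>i F(U\<^sub>i)] = 0\<close> and
  \<open>E[X\<^sub>i\<^sup>2 V\<^sub>i\<^sup>2 F'(U\<^sub>i)] = E[V\<^sub>i\<^sup>2 F'(U\<^sub>i)] = E[(1 + X\<^sub>i\<^sup>2) / 2 * V\<^sub>i\<^sup>2 F'(U\<^sub>i)]\<close>, which cancel.\<close>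

lemma stein_coordinate_remainder:
  fixes F F' F'' :: "real \<Rightarrow> real"
  assumes i: "i \<in> I" and L: "energy i \<le> L"
    and F: "\<And>x. (F has_real_derivative F' x) (at x)" "\<And>x. (F' has_real_derivative F'' x) (at x)"
    and bounds: "\<And>x. \<bar>F x\<bar> \<le> A" "\<And>x. \<bar>F' x\<bar> \<le> K" "\<And>x. \<bar>F'' x\<bar> \<le> C"
  shows "integrable M (\<lambda>w. X i w * V i w * F (Q w))"
    and "integrable M (\<lambda>w. (1 + (X i w)\<^sup>2) / 2 * (V i w)\<^sup>2 * F' (Q w))"
    and "\<bar>expectation (\<lambda>w. X i w * V i w * F (Q w)) - expectation (\<lambda>w. (1 + (X i w)\<^sup>2) / 2 * (V i w)\<^sup>2 * F' (Q w))\<bar>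
       \<le> 2 * C * sqrt (\<beta> * (16 * \<beta>) ^ (d - 1) * L) * energy i"
proof -
  let ?J = "I - {i}" and ?v = "partial_coeff i q"
  have iJ: "i \<in> I" "i \<notin> ?J" "?J \<subseteq> I" using i by auto
  have cont: "continuous_on UNIV F" "continuous_on UNIV F'"
    using F DERIV_isCont continuous_at_imp_continuous_on by blast+
  have Fm [measurable]: "F \<in> borel_measurable borel" "F' \<in> borel_measurable borel"
    using cont by (auto intro: borel_measurable_continuous_onI)
  have meas [measurable]: "X i \<in> borel_measurable M" "Q \<in> borel_measurable M" "U i \<in> borel_measurable M" "V i \<in> borel_measurable M"
    using i Q_fourth U_fourth V_fourth by (auto simp: fourth_integrable_def)
  have C0: "C \<ge> 0" using bounds(3)[of 0] by (smt (verit))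
  have bounded_int: "integrable M (\<lambda>w. G w * H w)"
    if "integrable M G" "H \<in> borel_measurable M" "\<And>w. \<bar>H w\<bar> \<le> B" for G H :: "'a \<Rightarrow> real" and B
  proof (rule Bochner_Integration.integrable_bound)
    show "integrable M (\<lambda>w. G w * B)" using that(1) by simp
    show "(\<lambda>w. G w * H w) \<in> borel_measurable M" using that by measurable
    show "AE w in M. norm (G w * H w) \<le> norm (G w * B)"
      using that(3) by (intro AE_I2) (auto simp: abs_mult intro!: mult_left_mono order_trans[OF that(3) abs_ge_self])
  qed
  note split = expectation_split[OF iJ]
  have iX: "integrable M (\<lambda>w. X i w ^ k)" if "k \<le> 4" for k by (rule fourth_integrable_power[OF X_fourth[OF i] that])
  have iV: "integrable M (\<lambda>w. V i w ^ k)" if "k \<le> 4" for k by (rule fourth_integrable_power[OF V_fourth that])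

  have VU: "V i w = multilinear ?v ?J (\<lambda>i. X i w)" "U i w = multilinear q ?J (\<lambda>i. X i w)" for w
    by (simp_all add: V_def U_def chaos_def)
  have aX: "integrable M (\<lambda>w. \<bar>X i w\<bar> ^ k)" if "k \<le> 4" for k
    using integrable_abs[OF iX[OF that]] by (simp add: power_abs)
  have r1: "(\<lambda>x. multilinear ?v ?J x * F (multilinear q ?J x)) \<in> borel_measurable (\<Pi>\<^sub>M i\<in>?J. borel)"
    and r2: "(\<lambda>x. (multilinear ?v ?J x)\<^sup>2 * F' (multilinear q ?J x)) \<in> borel_measurable (\<Pi>\<^sub>M i\<in>?J. borel)"
    and r3: "(\<lambda>x. \<bar>multilinear ?v ?J x\<bar> ^ 3) \<in> borel_measurable (\<Pi>\<^sub>M i\<in>?J. borel)"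
    by measurable
  have k1: "integrable M (\<lambda>w. V i w * F (U i w))"
    using bounded_int[OF iV[of 1], of "\<lambda>w. F (U i w)" A] bounds(1) by simp
  have e2': "integrable M (\<lambda>w. (V i w)\<^sup>2 * F' (U i w))"
    using bounded_int[OF iV[of 2], of "\<lambda>w. F' (U i w)" K] bounds(2) by simp
  note s1 = split[OF r1, where p="\<lambda>t. t", unfolded multilinear_restrict, folded VU, OF refl _ _ k1]
  have e1: "expectation (\<lambda>w. X i w * (V i w * F (U i w))) = 0" "integrable M (\<lambda>w. X i w * (V i w * F (U i w)))"
    using s1 iX[of 1] mean[OF i] by simp_all
  note s2 = split[OF r2, where p="\<lambda>t. t\<^sup>2", unfolded multilinear_restrict, folded VU, OF refl _ _ e2']
  have e2: "expectation (\<lambda>w. (X i w)\<^sup>2 * ((V i w)\<^sup>2 * F' (U i w))) = expectation (\<lambda>w. (V i w)\<^sup>2 * F' (U i w))"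
      "integrable M (\<lambda>w. (X i w)\<^sup>2 * ((V i w)\<^sup>2 * F' (U i w)))"
    using s2 iX[of 2] second_moment[OF i] by simp_all
  note s3 = split[OF r3, where p="\<lambda>t. \<bar>t\<bar> ^ k" for k, unfolded multilinear_restrict, folded VU, OF refl _ aX abs_V_cube_integrable]
  have e3: "expectation (\<lambda>w. \<bar>X i w\<bar> ^ k * \<bar>V i w\<bar> ^ 3) = expectation (\<lambda>w. \<bar>X i w\<bar> ^ k) * expectation (\<lambda>w. \<bar>V i w\<bar> ^ 3)"
      "integrable M (\<lambda>w. \<bar>X i w\<bar> ^ k * \<bar>V i w\<bar> ^ 3)" if "k \<le> 4" for k
    using s3[OF _ that] by simp_all

  let ?G1 = "\<lambda>w. X i w * V i w * F (Q w)" and ?G2 = "\<lambda>w. (1 + (X i w)\<^sup>2) / 2 * (V i w)\<^sup>2 * F' (Q w)"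
  have "integrable M (\<lambda>w. X i w * V i w)"
    using fourth_integrable_mult2[OF X_fourth[OF i] V_fourth[of i], of 1 1] by simp
  then show i1: "integrable M ?G1" by (rule bounded_int) (use bounds in auto)
  have "integrable M (\<lambda>w. (1 + (X i w)\<^sup>2) / 2 * (V i w)\<^sup>2)"
    using mixed_moments(4)[OF iJ, of ?v, folded V_def] by (simp add: has_bochner_integral_iff)
  then show i2: "integrable M ?G2" by (rule bounded_int) (use bounds in auto)

  define rem where "rem = (\<lambda>w. X i w * V i w * (F (Q w) - F (U i w) - X i w * V i w * F' (U i w))
     - (1 + (X i w)\<^sup>2) / 2 * (V i w)\<^sup>2 * (F' (Q w) - F' (U i w)))"
  have rem_eq: "rem w = ?G1 w - ?G2 w - X i w * (V i w * F (U i w))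
     - 1 / 2 * ((X i w)\<^sup>2 * ((V i w)\<^sup>2 * F' (U i w))) + 1 / 2 * ((V i w)\<^sup>2 * F' (U i w))" for w
    unfolding rem_def by (simp add: field_simps power2_eq_square)
  have rem_int: "integrable M rem"
    unfolding rem_eq[abs_def]
    by (intro Bochner_Integration.integrable_add Bochner_Integration.integrable_diff i1 i2 e1 e2 e2' integrable_mult_right)
  have E: "expectation rem = expectation ?G1 - expectation ?G2"
    unfolding rem_eq[abs_def] using i1 i2 e1 e2 e2' by simp
  have pointwise: "\<bar>rem w\<bar> \<le> C * (1 / 2 * (\<bar>X i w\<bar> ^ 1 * \<bar>V i w\<bar> ^ 3) + 3 / 2 * (\<bar>X i w\<bar> ^ 3 * \<bar>V i w\<bar> ^ 3))" for w
  proof -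
    let ?x = "X i w" and ?y = "V i w"
    have Q: "Q w - U i w = ?x * ?y" using Q_split[OF i] by simp
    note rem1 = first_order_remainder(1)[OF F bounds(3), of "Q w" "U i w", unfolded Q]
      and rem2 = first_order_remainder(2)[OF F bounds(3), of "Q w" "U i w", unfolded Q]
    have "\<bar>?x * ?y * (F (Q w) - F (U i w) - ?x * ?y * F' (U i w))\<bar> \<le> \<bar>?x * ?y\<bar> * (C * (?x * ?y)\<^sup>2)"
      unfolding abs_mult[of "?x * ?y"] by (intro mult_left_mono rem2) auto
    also have "\<dots> = C * (\<bar>?x\<bar> ^ 3 * \<bar>?y\<bar> ^ 3)"
    proof -
      have "(?x * ?y)\<^sup>2 = \<bar>?x * ?y\<bar> * \<bar>?x * ?y\<bar>" by (simp add: power2_eq_square)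
      then show ?thesis by (simp add: power3_eq_cube abs_mult mult_ac)
    qed
    finally have a: "\<bar>?x * ?y * (F (Q w) - F (U i w) - ?x * ?y * F' (U i w))\<bar> \<le> C * (\<bar>?x\<bar> ^ 3 * \<bar>?y\<bar> ^ 3)" .
    have "\<bar>(1 + ?x\<^sup>2) / 2 * ?y\<^sup>2 * (F' (Q w) - F' (U i w))\<bar> = (1 + ?x\<^sup>2) / 2 * ?y\<^sup>2 * \<bar>F' (Q w) - F' (U i w)\<bar>"
      by (simp add: abs_mult add_nonneg_nonneg)
    also have "\<dots> \<le> (1 + ?x\<^sup>2) / 2 * ?y\<^sup>2 * (C * \<bar>?x * ?y\<bar>)"
      by (intro mult_left_mono rem1) (auto intro!: mult_nonneg_nonneg add_nonneg_nonneg)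
    also have "\<dots> = C * (1 / 2 * (\<bar>?x\<bar> ^ 1 * \<bar>?y\<bar> ^ 3) + 1 / 2 * (\<bar>?x\<bar> ^ 3 * \<bar>?y\<bar> ^ 3))"
    proof -
      have sq: "t\<^sup>2 = \<bar>t\<bar> * \<bar>t\<bar>" for t :: real by (simp add: power2_eq_square)
      show ?thesis unfolding sq abs_mult power3_eq_cube by (simp add: field_simps)
    qed
    finally have b: "\<bar>(1 + ?x\<^sup>2) / 2 * ?y\<^sup>2 * (F' (Q w) - F' (U i w))\<bar>
      \<le> C * (1 / 2 * (\<bar>?x\<bar> ^ 1 * \<bar>?y\<bar> ^ 3) + 1 / 2 * (\<bar>?x\<bar> ^ 3 * \<bar>?y\<bar> ^ 3))" .
    have "\<bar>rem w\<bar> \<le> C * (\<bar>?x\<bar> ^ 3 * \<bar>?y\<bar> ^ 3) + C * (1 / 2 * (\<bar>?x\<bar> ^ 1 * \<bar>?y\<bar> ^ 3) + 1 / 2 * (\<bar>?x\<bar> ^ 3 * \<bar>?y\<bar> ^ 3))"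
      unfolding rem_def by (rule order_trans[OF abs_triangle_ineq4 add_mono[OF a b]])
    also have "\<dots> = C * (1 / 2 * (\<bar>?x\<bar> ^ 1 * \<bar>?y\<bar> ^ 3) + 3 / 2 * (\<bar>?x\<bar> ^ 3 * \<bar>?y\<bar> ^ 3))"
      by (simp add: distrib_left)
    finally show ?thesis .
  qed
  have "\<bar>expectation rem\<bar> \<le> expectation (\<lambda>w. \<bar>rem w\<bar>)" by (rule integral_abs_bound)
  also have "\<dots> \<le> expectation (\<lambda>w. C * (1 / 2 * (\<bar>X i w\<bar> ^ 1 * \<bar>V i w\<bar> ^ 3) + 3 / 2 * (\<bar>X i w\<bar> ^ 3 * \<bar>V i w\<bar> ^ 3)))"
    using e3(2)[of 1] e3(2)[of 3] by (intro integral_mono integrable_abs[OF rem_int] pointwise) simp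
  also have "\<dots> = C * (1 / 2 * expectation (\<lambda>w. \<bar>X i w\<bar>) + 3 / 2 * expectation (\<lambda>w. \<bar>X i w\<bar> ^ 3)) * expectation (\<lambda>w. \<bar>V i w\<bar> ^ 3)"
    using e3(2)[of 1] e3(2)[of 3] e3(1)[of 1] e3(1)[of 3] by (simp add: algebra_simps)
  also have "\<dots> \<le> C * (1 / 2 * sqrt \<beta> + 3 / 2 * sqrt \<beta>) * (sqrt ((16 * \<beta>) ^ (d - 1) * L) * energy i)"
    using abs_X_moments[OF i] abs_V_cube[OF i L] C0 one_le_\<beta>
    by (intro mult_mono mult_left_mono add_mono mult_nonneg_nonneg) auto
  also have "\<dots> = 2 * C * sqrt (\<beta> * (16 * \<beta>) ^ (d - 1) * L) * energy i"
    by (simp add: real_sqrt_mult)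
  finally show "\<bar>expectation ?G1 - expectation ?G2\<bar> \<le> 2 * C * sqrt (\<beta> * (16 * \<beta>) ^ (d - 1) * L) * energy i"
    unfolding E .
qed

theorem stein_bound:
  fixes F F' F'' :: "real \<Rightarrow> real"
  assumes L: "\<And>i. i \<in> I \<Longrightarrow> energy i \<le> L"
    and F: "\<And>x. (F has_real_derivative F' x) (at x)" "\<And>x. (F' has_real_derivative F'' x) (at x)"
    and bounds: "\<And>x. \<bar>F x\<bar> \<le> A" "\<And>x. \<bar>F' x\<bar> \<le> K" "\<And>x. \<bar>F'' x\<bar> \<le> C"
  shows "\<bar>expectation (\<lambda>w. 2 * (Q w + \<sigma> / 2) * F' (Q w) - Q w * F (Q w))\<bar>
    \<le> K * sqrt (expectation (\<lambda>w. (discrepancy w)\<^sup>2)) + C * \<sigma> / 2 * sqrt ((16 * \<beta>) ^ d * L)"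
proof -
  have d0: "real d \<ge> 2" using two_le_d by simp
  have K0: "K \<ge> 0" using bounds(2)[of 0] by (smt (verit))
  note coord = stein_coordinate_remainder[OF _ L F bounds]
  let ?S = "sqrt (\<beta> * (16 * \<beta>) ^ (d - 1) * L)"
  let ?G1 = "\<lambda>i w. X i w * V i w * F (Q w)" and ?G2 = "\<lambda>i w. (1 + (X i w)\<^sup>2) / 2 * (V i w)\<^sup>2 * F' (Q w)"
  have s1: "(\<Sum>i\<in>I. ?G1 i w) = real d * (Q w * F (Q w))" for w
    unfolding sum_distrib_right[symmetric] euler by simp
  have s2: "(\<Sum>i\<in>I. ?G2 i w) = \<Gamma> w * F' (Q w)" for w
    unfolding sum_distrib_right[symmetric] \<Gamma>_eq ..
  have i1: "integrable M (\<lambda>w. real d * (Q w * F (Q w)))" and i2: "integrable M (\<lambda>w. \<Gamma> w * F' (Q w))"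
    unfolding s1[symmetric] s2[symmetric] by (intro Bochner_Integration.integrable_sum coord(1) coord(2); assumption)+
  have QF: "integrable M (\<lambda>w. Q w * F (Q w))"
    using integrable_mult_right[OF i1, of "1 / real d"] d0 by simp
  have "real d * expectation (\<lambda>w. Q w * F (Q w)) - expectation (\<lambda>w. \<Gamma> w * F' (Q w))
     = (\<Sum>i\<in>I. expectation (?G1 i) - expectation (?G2 i))"
  proof -
    have "real d * expectation (\<lambda>w. Q w * F (Q w)) = (\<Sum>i\<in>I. expectation (?G1 i))"
      using coord(1) by (simp add: Bochner_Integration.integral_sum[symmetric] s1)
    moreover have "expectation (\<lambda>w. \<Gamma> w * F' (Q w)) = (\<Sum>i\<in>I. expectation (?G2 i))"
      unfolding s2[symmetric] by (intro Bochner_Integration.integral_sum coord(2))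
    ultimately show ?thesis by (simp add: sum_subtractf)
  qed
  then have "\<bar>real d * expectation (\<lambda>w. Q w * F (Q w)) - expectation (\<lambda>w. \<Gamma> w * F' (Q w))\<bar>
    \<le> (\<Sum>i\<in>I. \<bar>expectation (?G1 i) - expectation (?G2 i)\<bar>)"
    by (simp only: sum_abs)
  also have "\<dots> \<le> (\<Sum>i\<in>I. 2 * C * ?S * energy i)"
    by (rule sum_mono) (rule coord(3))
  also have "\<dots> = real d * (2 * C * ?S * \<sigma>)"
    unfolding sum_distrib_left[symmetric] sum_V_square by simp
  finally have R: "\<bar>expectation (\<lambda>w. Q w * F (Q w)) - expectation (\<lambda>w. \<Gamma> w * F' (Q w)) / real d\<bar> \<le> 2 * C * ?S * \<sigma>"
  proof -
    assume *: "\<bar>real d * expectation (\<lambda>w. Q w * F (Q w)) - expectation (\<lambda>w. \<Gamma> w * F' (Q w))\<bar> \<le> real d * (2 * C * ?S * \<sigma>)"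
    have "real d * \<bar>expectation (\<lambda>w. Q w * F (Q w)) - expectation (\<lambda>w. \<Gamma> w * F' (Q w)) / real d\<bar>
       = \<bar>real d * (expectation (\<lambda>w. Q w * F (Q w)) - expectation (\<lambda>w. \<Gamma> w * F' (Q w)) / real d)\<bar>"
      by (simp add: abs_mult)
    also have "real d * (expectation (\<lambda>w. Q w * F (Q w)) - expectation (\<lambda>w. \<Gamma> w * F' (Q w)) / real d)
       = real d * expectation (\<lambda>w. Q w * F (Q w)) - expectation (\<lambda>w. \<Gamma> w * F' (Q w))"
      using d0 by (simp add: right_diff_distrib)
    finally have "real d * \<bar>expectation (\<lambda>w. Q w * F (Q w)) - expectation (\<lambda>w. \<Gamma> w * F' (Q w)) / real d\<bar>
       \<le> real d * (2 * C * ?S * \<sigma>)" using * by (simp only:)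
    then show ?thesis by (rule mult_left_le_imp_le) (use d0 in simp)
  qed
  have S: "2 * C * ?S * \<sigma> = C * \<sigma> / 2 * sqrt ((16 * \<beta>) ^ d * L)"
  proof -
    \<comment> \<open>V has degree d - 1; the missing factor 16 * \<beta> comes from the third absolute moment of X.\<close>
    have "(16 * \<beta>) ^ d * L = 16 * (\<beta> * (16 * \<beta>) ^ (d - 1) * L)"
      using two_le_d by (simp add: power_eq_if)
    then have "sqrt ((16 * \<beta>) ^ d * L) = 4 * ?S" by (simp only: real_sqrt_mult[of 16]) simp
    then show ?thesis by simp
  qed
  have disc_sq: "integrable M (\<lambda>w. (discrepancy w)\<^sup>2)" by (rule spectral_gap_bound(1))
  have Fm [measurable]: "F' \<in> borel_measurable borel"
    using F(2) DERIV_isCont continuous_at_imp_continuous_on by (blast intro: borel_measurable_continuous_onI)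
  have Qm [measurable]: "Q \<in> borel_measurable M" using Q_fourth by (simp add: fourth_integrable_def)
  have disc: "integrable M discrepancy"
    using moment_recursions(1,2) unfolding discrepancy_def[abs_def] by (simp add: has_bochner_integral_iff)
  have dF: "integrable M (\<lambda>w. discrepancy w * F' (Q w))"
  proof (rule Bochner_Integration.integrable_bound)
    show "integrable M (\<lambda>w. discrepancy w * K)" using disc by simp
    show "(\<lambda>w. discrepancy w * F' (Q w)) \<in> borel_measurable M" using disc by measurable
    show "AE w in M. norm (discrepancy w * F' (Q w)) \<le> norm (discrepancy w * K)"
      using bounds(2) K0 by (intro AE_I2) (auto simp: abs_mult intro!: mult_left_mono)
  qed
  have "2 * (Q w + \<sigma> / 2) * F' (Q w) - Q w * F (Q w)
     = - (discrepancy w * F' (Q w)) - (Q w * F (Q w) - 1 / real d * (\<Gamma> w * F' (Q w)))" for w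
    unfolding discrepancy_def by (simp add: algebra_simps)
  then have "expectation (\<lambda>w. 2 * (Q w + \<sigma> / 2) * F' (Q w) - Q w * F (Q w))
     = - expectation (\<lambda>w. discrepancy w * F' (Q w)) - (expectation (\<lambda>w. Q w * F (Q w)) - expectation (\<lambda>w. \<Gamma> w * F' (Q w)) / real d)"
    using dF QF i2 by simp
  moreover have "\<bar>expectation (\<lambda>w. discrepancy w * F' (Q w))\<bar> \<le> K * sqrt (expectation (\<lambda>w. (discrepancy w)\<^sup>2))"
  proof -
    have "\<bar>expectation (\<lambda>w. discrepancy w * F' (Q w))\<bar> \<le> expectation (\<lambda>w. \<bar>discrepancy w * F' (Q w)\<bar>)" by (rule integral_abs_bound)
    also have "\<dots> \<le> expectation (\<lambda>w. K * \<bar>discrepancy w\<bar>)"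
    proof (rule integral_mono)
      fix w
      show "\<bar>discrepancy w * F' (Q w)\<bar> \<le> K * \<bar>discrepancy w\<bar>"
        using mult_left_mono[OF bounds(2)[of "Q w"], of "\<bar>discrepancy w\<bar>"] by (simp add: abs_mult mult.commute)
    qed (use dF disc in auto)
    also have "\<dots> = K * expectation (\<lambda>w. \<bar>discrepancy w\<bar>)" by simp
    also have "expectation (\<lambda>w. \<bar>discrepancy w\<bar>) \<le> sqrt (expectation (\<lambda>w. (discrepancy w)\<^sup>2))"
    proof (rule real_le_rsqrt)
      have "(expectation (\<lambda>w. 1 * \<bar>discrepancy w\<bar>))\<^sup>2 \<le> expectation (\<lambda>w. 1\<^sup>2) * expectation (\<lambda>w. \<bar>discrepancy w\<bar>\<^sup>2)"
        using disc disc_sq by (intro cauchy_schwarz_expectation) auto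
      then show "(expectation (\<lambda>w. \<bar>discrepancy w\<bar>))\<^sup>2 \<le> expectation (\<lambda>w. (discrepancy w)\<^sup>2)"
        using prob_space by simp
    qed
    finally show ?thesis using K0 by (simp add: mult_left_mono)
  qed
  ultimately show ?thesis using R unfolding S by linarith
qed

end

section \<open>Chi-square approximation of homogeneous sums\<close>

lemma index_tuples_set:
  assumes "xs \<in> index_tuples N n" "distinct xs"
  shows "set xs \<in> {A \<in> Pow {1..N}. card A = n}"
  using assms by (auto simp: index_tuples_def distinct_card)

lemma finite_index_tuples: "finite (index_tuples N n)"
  using finite_lists_length_eq[of "{1..N}" n] by (simp add: index_tuples_def conj_commute)

text \<open>Each \<open>n\<close>-element set is listed by \<open>n!\<close> tuples.\<close>

lemma sum_index_tuples:
  fixes g :: "nat list \<Rightarrow> real"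
  assumes nd: "\<And>xs. xs \<in> index_tuples N n \<Longrightarrow> \<not> distinct xs \<Longrightarrow> g xs = 0"
    and h: "\<And>xs. xs \<in> index_tuples N n \<Longrightarrow> distinct xs \<Longrightarrow> g xs = h (set xs)"
  shows "(\<Sum>xs\<in>index_tuples N n. g xs) = fact n * (\<Sum>A | A \<in> Pow {1..N} \<and> card A = n. h A)"
proof -
  let ?D = "{xs \<in> index_tuples N n. distinct xs}" and ?T = "{A \<in> Pow {1..N}. card A = n}"
  have finD: "finite ?D" using finite_index_tuples by simp
  have finT: "finite ?T" by simp
  have "(\<Sum>xs\<in>index_tuples N n. g xs) = (\<Sum>xs\<in>?D. g xs)"
    by (rule sum.mono_neutral_right) (use finite_index_tuples nd in auto)
  also have "\<dots> = (\<Sum>A\<in>?T. \<Sum>xs\<in>{xs \<in> ?D. set xs = A}. g xs)"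
    by (rule sum.group[symmetric, OF finD finT]) (use index_tuples_set in blast)
  also have "\<dots> = (\<Sum>A\<in>?T. fact n * h A)"
  proof (rule sum.cong[OF refl])
    fix A assume A: "A \<in> ?T"
    then have finA: "finite A" by (auto intro: finite_subset)
    have eq: "{xs \<in> ?D. set xs = A} = permutations_of_set A"
      using A by (auto simp: index_tuples_def permutations_of_set_def distinct_card)
    have "(\<Sum>xs\<in>{xs \<in> ?D. set xs = A}. g xs) = (\<Sum>xs\<in>permutations_of_set A. h A)"
      unfolding eq[symmetric] by (rule sum.cong[OF refl]) (use h in auto)
    also have "\<dots> = fact n * h A" using A finA by simp
    finally show "(\<Sum>xs\<in>{xs \<in> ?D. set xs = A}. g xs) = fact n * h A" .
  qed
  finally show ?thesis by (simp add: sum_distrib_left)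
qed

lemma symmetric_kernel_sorted:
  assumes f: "symmetric_kernel N d f" and xs: "xs \<in> index_tuples N d" "distinct xs"
  shows "f xs = f (sorted_list_of_set (set xs))"
proof -
  have "mset (sorted_list_of_set (set xs)) = mset xs"
    using xs(2) by (intro set_eq_iff_mset_eq_distinct[THEN iffD1]) auto
  then obtain p where p: "p permutes {..<length xs}" "permute_list p xs = sorted_list_of_set (set xs)"
    by (rule mset_eq_permutation)
  moreover have "length xs = d" using xs(1) by (simp add: index_tuples_def)
  ultimately show ?thesis using f xs(1) unfolding symmetric_kernel_def by metis
qed

lemma vanishes_on_diagonals_not_distinct:
  assumes "vanishes_on_diagonals N d f" "xs \<in> index_tuples N d" "\<not> distinct xs"
  shows "f xs = 0"
proof -
  have "length xs = d" using assms(2) by (simp add: index_tuples_def)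
  then show ?thesis using assms unfolding vanishes_on_diagonals_def distinct_conv_nth by blast
qed

text \<open>The factor \<open>d!\<close> counts the tuples that contribute to the same monomial.\<close>

definition kernel_coeff :: "nat \<Rightarrow> nat \<Rightarrow> (nat list \<Rightarrow> real) \<Rightarrow> nat set \<Rightarrow> real" where
  "kernel_coeff N d f A = (if card A = d then fact d * f (sorted_list_of_set A) else 0)"

lemma homogeneous_kernel_coeff: "homogeneous d (kernel_coeff N d f)"
  by (simp add: homogeneous_def kernel_coeff_def)

lemma homogeneous_sum_eq_multilinear:
  assumes f: "symmetric_kernel N d f" "vanishes_on_diagonals N d f"
  shows "homogeneous_sum d N f X w = multilinear (kernel_coeff N d f) {1..N} (\<lambda>i. X i w)"
proof -
  have "homogeneous_sum d N f X w
     = fact d * (\<Sum>A | A \<in> Pow {1..N} \<and> card A = d. f (sorted_list_of_set A) * (\<Prod>i\<in>A. X i w))"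
    unfolding homogeneous_sum_def
  proof (rule sum_index_tuples)
    fix xs assume xs: "xs \<in> index_tuples N d"
    show "f xs * (\<Prod>i\<leftarrow>xs. X i w) = 0" if "\<not> distinct xs"
      using vanishes_on_diagonals_not_distinct[OF f(2) xs that] by simp
    show "f xs * (\<Prod>i\<leftarrow>xs. X i w) = f (sorted_list_of_set (set xs)) * (\<Prod>i\<in>set xs. X i w)" if "distinct xs"
      using symmetric_kernel_sorted[OF f(1) xs that] prod.distinct_set_conv_list[OF that, of "\<lambda>i. X i w"] by simp
  qed
  also have "\<dots> = (\<Sum>A | A \<in> Pow {1..N} \<and> card A = d. kernel_coeff N d f A * (\<Prod>i\<in>A. X i w))"
    unfolding sum_distrib_left by (intro sum.cong refl) (simp add: kernel_coeff_def)
  also have "\<dots> = multilinear (kernel_coeff N d f) {1..N} (\<lambda>i. X i w)"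
    unfolding multilinear_def by (rule sum.mono_neutral_left) (auto simp: kernel_coeff_def)
  finally show ?thesis .
qed

lemma influence_eq_sum_kernel_coeff:
  assumes f: "symmetric_kernel N d f" "vanishes_on_diagonals N d f" and d: "d \<ge> 1" and i: "i \<in> {1..N}"
  shows "(\<Sum>A | A \<in> Pow {1..N} \<and> i \<in> A. (kernel_coeff N d f A)\<^sup>2) = (fact d)\<^sup>2 * influence d N f i"
proof -
  have cons: "i # xs \<in> index_tuples N d" if "xs \<in> index_tuples N (d - 1)" for xs
    using that i d by (auto simp: index_tuples_def)
  let ?h = "\<lambda>B. if i \<in> B then 0 else (f (sorted_list_of_set (insert i B)))\<^sup>2"
  have "(\<Sum>xs\<in>index_tuples N (d - 1). (f (i # xs))\<^sup>2) = fact (d - 1) * (\<Sum>B | B \<in> Pow {1..N} \<and> card B = d - 1. ?h B)"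
  proof (rule sum_index_tuples)
    fix xs assume xs: "xs \<in> index_tuples N (d - 1)"
    show "(f (i # xs))\<^sup>2 = 0" if "\<not> distinct xs"
      using vanishes_on_diagonals_not_distinct[OF f(2) cons[OF xs]] that by simp
    show "(f (i # xs))\<^sup>2 = ?h (set xs)" if "distinct xs"
      using vanishes_on_diagonals_not_distinct[OF f(2) cons[OF xs]] symmetric_kernel_sorted[OF f(1) cons[OF xs]] that
      by (cases "i \<in> set xs") auto
  qed
  then have "influence d N f i = (\<Sum>B | B \<in> Pow {1..N} \<and> card B = d - 1. ?h B)"
    by (simp add: influence_def)
  also have "\<dots> = (\<Sum>B | B \<in> Pow {1..N} \<and> card B = d - 1 \<and> i \<notin> B. (f (sorted_list_of_set (insert i B)))\<^sup>2)"
    by (rule sum.mono_neutral_cong_right) auto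
  also have "\<dots> = (\<Sum>A | A \<in> Pow {1..N} \<and> card A = d \<and> i \<in> A. (f (sorted_list_of_set A))\<^sup>2)"
  proof (rule sum.reindex_bij_witness[where i="\<lambda>A. A - {i}" and j="insert i"])
    fix A assume "A \<in> {A. A \<in> Pow {1..N} \<and> card A = d \<and> i \<in> A}"
    then show "A - {i} \<in> {B. B \<in> Pow {1..N} \<and> card B = d - 1 \<and> i \<notin> B}" "insert i (A - {i}) = A"
      by (auto intro: finite_subset)
  next
    fix B assume B: "B \<in> {B. B \<in> Pow {1..N} \<and> card B = d - 1 \<and> i \<notin> B}"
    then have "finite B" by (auto intro: finite_subset)
    with B d i show "insert i B \<in> {A. A \<in> Pow {1..N} \<and> card A = d \<and> i \<in> A}" by auto
    show "insert i B - {i} = B" using B by auto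
  qed simp
  finally have inf: "influence d N f i = (\<Sum>A | A \<in> Pow {1..N} \<and> card A = d \<and> i \<in> A. (f (sorted_list_of_set A))\<^sup>2)" .
  have "(\<Sum>A | A \<in> Pow {1..N} \<and> i \<in> A. (kernel_coeff N d f A)\<^sup>2)
      = (\<Sum>A | A \<in> Pow {1..N} \<and> card A = d \<and> i \<in> A. (kernel_coeff N d f A)\<^sup>2)"
    by (rule sum.mono_neutral_right) (auto simp: kernel_coeff_def)
  also have "\<dots> = (fact d)\<^sup>2 * influence d N f i"
    unfolding inf sum_distrib_left by (intro sum.cong refl) (simp add: kernel_coeff_def power_mult_distrib)
  finally show ?thesis .
qed

lemma influence_le_max_influence: "i \<in> {1..N} \<Longrightarrow> influence d N f i \<le> max_influence d N f"
  unfolding max_influence_def by (intro Max_ge) auto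

lemma influence_nonneg: "0 \<le> influence d N f i"
  by (simp add: influence_def sum_nonneg)

lemma second_derivative_bound:
  fixes \<phi>' \<phi>'' \<phi>''' :: "real \<Rightarrow> real"
  assumes "\<And>x. (\<phi>' has_real_derivative \<phi>'' x) (at x)" "\<And>x. (\<phi>'' has_real_derivative \<phi>''' x) (at x)"
    and "\<And>x. \<bar>\<phi>' x\<bar> \<le> 1" "\<And>x. \<bar>\<phi>''' x\<bar> \<le> B"
  shows "\<bar>\<phi>'' x\<bar> \<le> 2 + B"
proof -
  \<comment> \<open>Unit step: the increment of the first derivative over it is at most 2.\<close>
  have "\<bar>\<phi>' (x + 1) - \<phi>' x - \<phi>'' x\<bar> \<le> B"
    using first_order_remainder(2)[OF assms(1,2,4), of "x + 1" x] by simp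
  then show ?thesis using assms(3)[of x] assms(3)[of "x + 1"] by linarith
qed

text \<open>Here \<open>K \<surd>\<nu> \<ge> \<surd>(2 \<pi>) \<ge> 5/2\<close> makes the bound uniform in \<open>\<nu>\<close>. The summand of the constant that contains \<open>\<surd>\<nu>\<close>
  carries the estimate, through \<open>(2 \<surd>2)\<^bsup>3(2d-1)/2\<^esup> = 2\<^bsup>9(2d-1)/4\<^esup> \<ge> 2 * 4\<^sup>d\<close> for \<open>d \<ge> 2\<close>.\<close>

lemma error_constant_bound:
  fixes \<alpha> \<beta> \<nu> \<tau> K :: real
  assumes \<beta>: "1 \<le> \<beta>" "\<beta> \<le> \<alpha>" and \<nu>: "1 \<le> \<nu>" and d: "2 \<le> d" and \<tau>: "0 \<le> \<tau>"
    and K: "sqrt (2 * pi / \<nu>) \<le> K"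
  defines "E \<equiv> K * sqrt ((real d - 1) / (3 * real d)) * (4 * sqrt (real d) * fact d
             * (sqrt 2 * 144 powr (real d - 1 / 2) * \<alpha> powr (real d / 2)
                + sqrt \<nu> * (2 * sqrt 2) powr (3 * (2 * real d - 1) / 2)
                  * \<alpha> powr (3 * real d / 2)) * \<tau> powr (1 / 4))"
  shows "\<tau> \<le> 1 \<Longrightarrow> K * (sqrt \<nu> * (4 * sqrt \<beta>) ^ d * fact d * sqrt \<tau> / 2) + 8 * ((4 * sqrt \<beta>) ^ d * fact d * sqrt \<tau>) \<le> E"
    and "1 \<le> \<tau> \<Longrightarrow> 2 \<le> E"
proof -
  define G where "G = (2 * sqrt 2) powr (3 * (2 * real d - 1) / 2) * \<alpha> powr (3 * real d / 2)"
  have d2: "real d \<ge> 2" using d by simp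
  have K\<nu>: "5 / 2 \<le> K * sqrt \<nu>"
  proof -
    have "5 / 2 \<le> sqrt (2 * pi)" using pi_approx by (intro real_le_rsqrt) (simp add: power2_eq_square)
    also have "\<dots> = sqrt (2 * pi / \<nu>) * sqrt \<nu>" using \<nu> by (simp add: real_sqrt_divide)
    also have "\<dots> \<le> K * sqrt \<nu>" using K \<nu> by (intro mult_right_mono) auto
    finally show ?thesis .
  qed
  have K0: "0 \<le> K" using K \<nu> by (meson order_trans real_sqrt_ge_zero divide_nonneg_nonneg pi_ge_zero mult_nonneg_nonneg zero_le_numeral zero_le_one)
  have cd: "1 / 2 \<le> sqrt ((real d - 1) / (3 * real d)) * sqrt (real d)"
  proof -
    have "sqrt ((real d - 1) / (3 * real d)) * sqrt (real d) = sqrt ((real d - 1) / 3)"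
      using d2 by (simp add: real_sqrt_mult[symmetric])
    moreover have "1 / 2 \<le> sqrt ((real d - 1) / 3)"
      using d2 by (intro real_le_rsqrt) (simp add: power2_eq_square)
    ultimately show ?thesis by simp
  qed
  have two: "2 * sqrt 2 = 2 powr (3 / 2)"
  proof -
    have "(2::real) powr (3 / 2) = 2 powr (1 + 1 / 2)" by simp
    also have "\<dots> = 2 powr 1 * 2 powr (1 / 2)" by (rule powr_add)
    finally show ?thesis by (simp add: powr_half_sqrt)
  qed
  have G: "2 * (4 * sqrt \<beta>) ^ d \<le> G"
  proof -
    have "2 * 4 ^ d = 2 powr (2 * real d + 1)"
      by (simp add: powr_add powr_realpow[symmetric] powr_powr[symmetric])
    also have "\<dots> \<le> 2 powr (3 / 2 * (3 * (2 * real d - 1) / 2))"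
      using d2 by (intro powr_mono) (auto simp: field_simps)
    also have "\<dots> = (2 * sqrt 2) powr (3 * (2 * real d - 1) / 2)" unfolding two powr_powr ..
    finally have 1: "2 * 4 ^ d \<le> (2 * sqrt 2) powr (3 * (2 * real d - 1) / 2)" .
    have "sqrt \<beta> ^ d = \<beta> powr (real d / 2)"
      using \<beta> by (simp add: powr_half_sqrt[symmetric] powr_realpow[symmetric] powr_powr)
    also have "\<dots> \<le> \<alpha> powr (real d / 2)" using \<beta> by (intro powr_mono2) auto
    also have "\<dots> \<le> \<alpha> powr (3 * real d / 2)" using \<beta> by (intro powr_mono) auto
    finally have 2: "sqrt \<beta> ^ d \<le> \<alpha> powr (3 * real d / 2)" .
    have "2 * (4 * sqrt \<beta>) ^ d = (2 * 4 ^ d) * sqrt \<beta> ^ d" by (simp add: power_mult_distrib)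
    also have "\<dots> \<le> G" unfolding G_def using 1 2 \<beta> by (intro mult_mono) auto
    finally show ?thesis .
  qed
  have G0: "0 \<le> G" by (simp add: G_def)
  have EG: "2 * (K * sqrt \<nu>) * fact d * G * \<tau> powr (1 / 4) \<le> E"
  proof -
    have "2 * (K * sqrt \<nu>) * fact d * G * \<tau> powr (1 / 4)
        = 1 / 2 * (K * 4 * fact d * (sqrt \<nu> * G) * \<tau> powr (1 / 4))" by simp
    also have "\<dots> \<le> (sqrt ((real d - 1) / (3 * real d)) * sqrt (real d)) * (K * 4 * fact d * (sqrt \<nu> * G) * \<tau> powr (1 / 4))"
      using K0 \<nu> G0 by (intro mult_right_mono cd) auto
    also have "\<dots> \<le> (sqrt ((real d - 1) / (3 * real d)) * sqrt (real d)) * (K * 4 * fact d * (sqrt 2 * 144 powr (real d - 1 / 2) * \<alpha> powr (real d / 2) + sqrt \<nu> * G) * \<tau> powr (1 / 4))"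
      using K0 d2 by (intro mult_left_mono mult_right_mono) auto
    also have "\<dots> = E" by (simp add: E_def G_def mult_ac)
    finally show ?thesis .
  qed
  show "K * (sqrt \<nu> * (4 * sqrt \<beta>) ^ d * fact d * sqrt \<tau> / 2) + 8 * ((4 * sqrt \<beta>) ^ d * fact d * sqrt \<tau>) \<le> E" if \<tau>1: "\<tau> \<le> 1"
  proof -
    let ?W = "(4 * sqrt \<beta>) ^ d * fact d * sqrt \<tau>"
    have W0: "0 \<le> ?W" using \<beta> \<tau> by simp
    have s: "sqrt \<tau> \<le> \<tau> powr (1 / 4)"
    proof (cases "\<tau> = 0")
      case False
      then have "sqrt \<tau> = \<tau> powr (1 / 2)" using \<tau> by (simp add: powr_half_sqrt)
      also have "\<dots> \<le> \<tau> powr (1 / 4)" using \<tau> \<tau>1 False by (intro powr_mono') auto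
      finally show ?thesis .
    qed simp
    \<comment> \<open>The total factor 1/2 + 16/5 of K * sqrt \<nu> is rounded up to 4.\<close>
    have "8 * ?W \<le> 16 / 5 * (K * sqrt \<nu>) * ?W" using K\<nu> W0 by (intro mult_right_mono) auto
    then have "K * (sqrt \<nu> * (4 * sqrt \<beta>) ^ d * fact d * sqrt \<tau> / 2) + 8 * ?W \<le> 37 / 10 * (K * sqrt \<nu>) * ?W" by simp
    also have "\<dots> \<le> 4 * (K * sqrt \<nu>) * ?W" using K\<nu> W0 by (intro mult_right_mono) auto
    also have "\<dots> = 2 * (K * sqrt \<nu>) * fact d * (2 * (4 * sqrt \<beta>) ^ d) * sqrt \<tau>" by simp
    also have "\<dots> \<le> 2 * (K * sqrt \<nu>) * fact d * G * \<tau> powr (1 / 4)"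
      using G s K\<nu> \<beta> \<tau> G0 by (intro mult_mono mult_left_mono) auto
    finally show ?thesis using EG by linarith
  qed
  show "2 \<le> E" if \<tau>1: "1 \<le> \<tau>"
  proof -
    have "1 \<le> (4 * sqrt \<beta>) ^ d" using \<beta> by (intro one_le_power) (auto intro: order_trans[of 1 "4 * 1"])
    then have "1 \<le> G" using G by linarith
    moreover have "1 \<le> \<tau> powr (1 / 4)" using \<tau>1 by (simp add: ge_one_powr_ge_zero)
    moreover have "1 \<le> (fact d :: real)" by simp
    moreover have "2 \<le> 2 * (K * sqrt \<nu>)" using K\<nu> by simp
    ultimately have "2 * 1 * 1 * 1 \<le> 2 * (K * sqrt \<nu>) * fact d * G * \<tau> powr (1 / 4)"
      by (intro mult_mono) auto
    then show ?thesis using EG by simp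
  qed
qed

theorem theorem6p1:
  fixes M :: "'a measure" and X :: "nat \<Rightarrow> 'a \<Rightarrow> real"
    and P :: "'b measure" and Z :: "'b \<Rightarrow> real"
    and d N \<nu> :: nat and f :: "nat list \<Rightarrow> real"
    and \<alpha> \<beta> B :: real and Q :: "'a \<Rightarrow> real"
    and \<phi> \<phi>' \<phi>'' \<phi>''' :: "real \<Rightarrow> real"
  assumes "prob_space M"
    and "prob_space.indep_vars M (\<lambda>_. borel) X {1..}"
    and "\<And>i. i \<ge> 1 \<Longrightarrow> prob_space.expectation M (X i) = 0"
    and "\<And>i. i \<ge> 1 \<Longrightarrow> prob_space.variance M (X i) = 1"
    and "\<And>i. i \<ge> 1 \<Longrightarrow> integrable M (\<lambda>\<omega>. X i \<omega> ^ 4)"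
    and "bdd_above ((\<lambda>i. prob_space.expectation M (\<lambda>\<omega>. X i \<omega> ^ 4)) ` {1..})"
    and "\<beta> = (SUP i \<in> {1..}. prob_space.expectation M (\<lambda>\<omega>. X i \<omega> ^ 4))"
    and "\<alpha> = max 3 \<beta>"
    and "d \<ge> 2" and "even d" and "N \<ge> 1"
    and "symmetric_kernel N d f"
    and "vanishes_on_diagonals N d f"
    and "Q = homogeneous_sum d N f X"
    and "\<nu> \<ge> 1"
    and "prob_space.expectation M (\<lambda>\<omega>. Q \<omega> ^ 2) = 2 * real \<nu>"
    and "\<And>x. (\<phi> has_real_derivative \<phi>' x) (at x)"
    and "\<And>x. (\<phi>' has_real_derivative \<phi>'' x) (at x)"
    and "\<And>x. (\<phi>'' has_real_derivative \<phi>''' x) (at x)"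
    and "\<And>x. \<bar>\<phi> x\<bar> \<le> 1"
    and "\<And>x. \<bar>\<phi>' x\<bar> \<le> 1"
    and "\<And>x. \<bar>\<phi>''' x\<bar> \<le> B"
    and "prob_space P"
    and "Z \<in> borel_measurable P"
    and "distr P borel Z = centered_chi_square \<nu>"
  shows "\<bar>prob_space.expectation M (\<lambda>\<omega>. \<phi> (Q \<omega>)) - prob_space.expectation P (\<lambda>\<omega>. \<phi> (Z \<omega>))\<bar>
    \<le> B * (30 * \<beta>) ^ d * fact d * sqrt (max_influence d N f)
      + max (sqrt (2 * pi / real \<nu>)) (1 / real \<nu> + 2 / (real \<nu>)\<^sup>2)
        * sqrt ((real d - 1) / (3 * real d))
        * (sqrt \<bar>prob_space.expectation M (\<lambda>\<omega>. Q \<omega> ^ 4)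
                 - 12 * prob_space.expectation M (\<lambda>\<omega>. Q \<omega> ^ 3)
                 - 12 * (real \<nu>)\<^sup>2 + 48 * real \<nu>\<bar>
           + 4 * sqrt (real d) * fact d
             * (sqrt 2 * 144 powr (real d - 1 / 2) * \<alpha> powr (real d / 2)
                + sqrt (real \<nu>) * (2 * sqrt 2) powr (3 * (2 * real d - 1) / 2)
                  * \<alpha> powr (3 * real d / 2))
             * max_influence d N f powr (1 / 4))"
proof -
  interpret prob_space M by (rule assms(1))
  define q where "q = kernel_coeff N d f"
  define \<tau> where "\<tau> = max_influence d N f"
  define K where "K = max (sqrt (2 * pi / real \<nu>)) (1 / real \<nu> + 2 / (real \<nu>)\<^sup>2)"
  define m where "m = expectation (\<lambda>w. Q w ^ 4) - 12 * expectation (\<lambda>w. Q w ^ 3) - 12 * (real \<nu>)\<^sup>2 + 48 * real \<nu>"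
  define c where "c = sqrt ((real d - 1) / (3 * real d))"
  define E where "E = 4 * sqrt (real d) * fact d
             * (sqrt 2 * 144 powr (real d - 1 / 2) * \<alpha> powr (real d / 2)
                + sqrt (real \<nu>) * (2 * sqrt 2) powr (3 * (2 * real d - 1) / 2)
                  * \<alpha> powr (3 * real d / 2)) * \<tau> powr (1 / 4)"
  define b where "b = (4 * sqrt \<beta>) ^ d * fact d * sqrt \<tau>"
  have \<nu>1: "real \<nu> \<ge> 1" using assms(15) by simp
  have d2: "real d \<ge> 2" using assms(9) by simp
  have X1: "X i \<in> borel_measurable M" if "i \<ge> 1" for i
    using assms(2) that by (auto simp: indep_vars_def)
  have X4: "fourth_integrable M (X i)" if "i \<ge> 1" for i
    using X1[OF that] assms(5)[OF that] by (simp add: fourth_integrable_def)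
  have X2: "expectation (\<lambda>w. X i w ^ 2) = 1" if "i \<ge> 1" for i
    using assms(4)[OF that] assms(3)[OF that] by simp
  have X4\<beta>: "expectation (\<lambda>w. X i w ^ 4) \<le> \<beta>" if "i \<ge> 1" for i
    unfolding assms(7) by (rule cSUP_upper) (use that assms(6) in auto)
  have \<beta>1: "1 \<le> \<beta>"
  proof -
    have "(expectation (\<lambda>w. 1 * (X 1 w)\<^sup>2))\<^sup>2 \<le> expectation (\<lambda>w. 1\<^sup>2) * expectation (\<lambda>w. ((X 1 w)\<^sup>2)\<^sup>2)"
      using fourth_integrable_power[OF X4[of 1], of 2] fourth_integrable_power[OF X4[of 1], of 4]
      by (intro cauchy_schwarz_expectation) (simp_all add: power_mult[symmetric])
    then show ?thesis using X2[of 1] X4\<beta>[of 1] prob_space by (simp add: power_mult[symmetric])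
  qed
  define J where "J = {1..N}"
  interpret H: homogeneous_chaos M X J \<beta> d q
  proof unfold_locales
    show "indep_vars (\<lambda>_. borel) X J" by (rule indep_vars_subset[OF assms(2)]) (auto simp: J_def)
    show "homogeneous d q" unfolding q_def by (rule homogeneous_kernel_coeff)
  qed (use assms(3,5,9) X2 X4\<beta> \<beta>1 in \<open>auto simp: J_def\<close>)
  have Q: "Q = H.Q"
  proof (rule ext)
    fix w
    have "Q w = multilinear q {1..N} (\<lambda>i. X i w)"
      unfolding assms(14) q_def by (rule homogeneous_sum_eq_multilinear[OF assms(12,13)])
    then show "Q w = H.Q w" by (simp only: H.Q_def H.chaos_def J_def[symmetric])
  qed
  have \<sigma>: "H.\<sigma> = 2 * real \<nu>"
    using H.expectation_Q_square assms(16) by (simp add: Q)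
  have \<tau>0: "0 \<le> \<tau>"
    using influence_nonneg[of d N f 1] influence_le_max_influence[of 1 N d f] assms(11) by (simp add: \<tau>_def)
  have L: "H.energy i \<le> (fact d)\<^sup>2 * \<tau>" if iJ: "i \<in> J" for i
  proof -
    have i: "i \<in> {1..N}" using iJ by (simp only: J_def)
    have "H.energy i = (fact d)\<^sup>2 * influence d N f i"
      using H.expectation_V_square[OF iJ] influence_eq_sum_kernel_coeff[OF assms(12,13) _ i] assms(9)
      by (simp add: q_def J_def)
    also have "\<dots> \<le> (fact d)\<^sup>2 * \<tau>"
      unfolding \<tau>_def by (intro mult_left_mono influence_le_max_influence i) auto
    finally show ?thesis .
  qed
  have B0: "0 \<le> B" using assms(22)[of 0] by (smt (verit))
  have K0: "0 \<le> K" unfolding K_def by (simp add: max_def)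
  have c0: "0 \<le> c" using d2 by (simp add: c_def)
  note const = error_constant_bound[OF \<beta>1 _ \<nu>1 assms(9) \<tau>0, of \<alpha> K, folded E_def c_def, unfolded E_def[symmetric]]
  have \<phi>m: "\<phi> \<in> borel_measurable borel"
    using has_derivative_imp_continuous_on[OF assms(17)] by (rule borel_measurable_continuous_onI)
  have Qm: "Q \<in> borel_measurable M" using H.Q_fourth by (simp add: Q fourth_integrable_def)
  define mZ where "mZ = (\<integral>x. \<phi> x \<partial>centered_chi_square \<nu>)"
  have Z: "prob_space.expectation P (\<lambda>w. \<phi> (Z w)) = mZ"
    unfolding mZ_def assms(25)[symmetric] by (rule integral_distr[symmetric, OF assms(24) \<phi>m])
  have goal: "\<bar>expectation (\<lambda>w. \<phi> (Q w)) - mZ\<bar> \<le> B * (30 * \<beta>) ^ d * fact d * sqrt \<tau> + K * c * (sqrt \<bar>m\<bar> + E)"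
  proof (cases "\<tau> \<le> 1")
    case False
    have "\<bar>expectation (\<lambda>w. \<phi> (Q w))\<bar> \<le> 1"
    proof -
      have "\<bar>expectation (\<lambda>w. \<phi> (Q w))\<bar> \<le> expectation (\<lambda>w. \<bar>\<phi> (Q w)\<bar>)" by (rule integral_abs_bound)
      also have "\<dots> \<le> expectation (\<lambda>w. 1)"
        using assms(20) \<phi>m Qm by (intro integral_mono integrable_abs integrable_const_bound[of _ 1]) auto
      finally show ?thesis using prob_space by simp
    qed
    moreover have "\<bar>mZ\<bar> \<le> 1"
    proof -
      interpret P: prob_space P by (rule assms(23))
      have "\<bar>P.expectation (\<lambda>w. \<phi> (Z w))\<bar> \<le> P.expectation (\<lambda>w. \<bar>\<phi> (Z w)\<bar>)" by (rule integral_abs_bound)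
      also have "\<dots> \<le> P.expectation (\<lambda>w. 1)"
        using assms(20) \<phi>m assms(24) by (intro integral_mono integrable_abs P.integrable_const_bound[of _ 1]) auto
      finally show ?thesis using P.prob_space Z by simp
    qed
    ultimately have "\<bar>expectation (\<lambda>w. \<phi> (Q w)) - mZ\<bar> \<le> 2" by linarith
    also have "2 \<le> K * c * E"
      using const(2) False assms(8) by (simp add: K_def)
    also have "K * c * E \<le> K * c * (sqrt \<bar>m\<bar> + E)"
      using K0 c0 by (intro mult_left_mono) auto
    also have "\<dots> \<le> B * (30 * \<beta>) ^ d * fact d * sqrt \<tau> + K * c * (sqrt \<bar>m\<bar> + E)"
      using B0 \<beta>1 \<tau>0 by simp
    finally show ?thesis .
  next
    case True
    have \<phi>'': "\<bar>\<phi>'' x\<bar> \<le> 2 + B" for x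
      by (rule second_derivative_bound[OF assms(18,19,21,22)])
    obtain F F' F'' where F: "\<And>x. (F has_real_derivative F' x) (at x)" "\<And>x. (F' has_real_derivative F'' x) (at x)"
      and Fb: "\<And>x. \<bar>F x\<bar> \<le> 2" "\<And>x. \<bar>F' x\<bar> \<le> K" "\<And>x. \<bar>F'' x\<bar> \<le> (2 * (2 + B) + 4) / real \<nu>"
      and stein: "\<And>x. 2 * (x + real \<nu>) * F' x - x * F x = \<phi> x - mZ"
      using chi_square_stein_solution[OF assms(15,17,18) has_derivative_imp_continuous_on[OF assms(19)] assms(20,21) \<phi>'']
      unfolding K_def mZ_def by metis
    have "integrable M (\<lambda>w. \<phi> (Q w))"
      using assms(20) \<phi>m Qm by (intro integrable_const_bound[of _ 1]) auto
    then have "expectation (\<lambda>w. \<phi> (Q w)) - mZ = expectation (\<lambda>w. \<phi> (Q w) - mZ)"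
      using prob_space by simp
    also have "\<dots> = expectation (\<lambda>w. 2 * (H.Q w + H.\<sigma> / 2) * F' (H.Q w) - H.Q w * F (H.Q w))"
      by (simp add: stein[symmetric] Q \<sigma>)
    finally have "\<bar>expectation (\<lambda>w. \<phi> (Q w)) - mZ\<bar>
      \<le> K * sqrt (expectation (\<lambda>w. (H.discrepancy w)\<^sup>2))
        + (2 * (2 + B) + 4) / real \<nu> * H.\<sigma> / 2 * sqrt ((16 * \<beta>) ^ d * ((fact d)\<^sup>2 * \<tau>))"
      using H.stein_bound[OF L F Fb] by simp
    also have "sqrt ((16 * \<beta>) ^ d * ((fact d)\<^sup>2 * \<tau>)) = b"
    proof -
      have "sqrt ((16 * \<beta>) ^ d) = (4 * sqrt \<beta>) ^ d" by (simp add: real_sqrt_power real_sqrt_mult)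
      then show ?thesis by (simp only: b_def real_sqrt_mult real_sqrt_abs) simp
    qed
    also have "(2 * (2 + B) + 4) / real \<nu> * H.\<sigma> / 2 * b = (8 + 2 * B) * b"
      using \<nu>1 by (simp add: \<sigma>)
    also have "sqrt (expectation (\<lambda>w. (H.discrepancy w)\<^sup>2)) \<le> c * sqrt \<bar>m\<bar> + sqrt (real \<nu>) * b / 2"
    proof -
      have b2: "(16 * \<beta>) ^ d * ((fact d)\<^sup>2 * \<tau>) = b\<^sup>2"
      proof -
        have "((4 * sqrt \<beta>) ^ d)\<^sup>2 = ((4 * sqrt \<beta>)\<^sup>2) ^ d"
          by (simp only: power_mult[symmetric] mult.commute[of d 2])
        also have "(4 * sqrt \<beta>)\<^sup>2 = 16 * \<beta>" using \<beta>1 by (simp add: power_mult_distrib)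
        finally have "((4 * sqrt \<beta>) ^ d)\<^sup>2 = (16 * \<beta>) ^ d" .
        then show ?thesis using \<tau>0 unfolding b_def power_mult_distrib[of "_ * _" "sqrt \<tau>"] power_mult_distrib[of "_ ^ d" "fact d"] by simp
      qed
      have "expectation (\<lambda>w. (H.discrepancy w)\<^sup>2)
         \<le> (real d - 1) / (3 * real d) * m + (16 * \<beta>) ^ d * ((fact d)\<^sup>2 * \<tau>) * (2 * real \<nu>) / 8"
        using H.discrepancy_fourth_moment_bound[OF L] unfolding \<sigma> m_def Q by (simp add: power2_eq_square)
      also have "\<dots> \<le> (real d - 1) / (3 * real d) * \<bar>m\<bar> + (16 * \<beta>) ^ d * ((fact d)\<^sup>2 * \<tau>) * (2 * real \<nu>) / 8"
        using d2 by (intro add_right_mono mult_left_mono) auto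
      also have "\<dots> = (real d - 1) / (3 * real d) * \<bar>m\<bar> + real \<nu> * b\<^sup>2 / 4"
        unfolding b2 by simp
      finally have "sqrt (expectation (\<lambda>w. (H.discrepancy w)\<^sup>2)) \<le> sqrt ((real d - 1) / (3 * real d) * \<bar>m\<bar> + real \<nu> * b\<^sup>2 / 4)"
        by simp
      also have "\<dots> \<le> sqrt ((real d - 1) / (3 * real d) * \<bar>m\<bar>) + sqrt (real \<nu> * b\<^sup>2 / 4)"
        using d2 by (intro sqrt_add_le_add_sqrt) auto
      also have "\<dots> = c * sqrt \<bar>m\<bar> + sqrt (real \<nu>) * b / 2"
      proof -
        have "0 \<le> b" using \<beta>1 \<tau>0 by (simp add: b_def)
        then show ?thesis by (simp add: c_def real_sqrt_mult real_sqrt_divide)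
      qed
      finally show ?thesis .
    qed
    finally have "\<bar>expectation (\<lambda>w. \<phi> (Q w)) - mZ\<bar> \<le> K * (c * sqrt \<bar>m\<bar> + sqrt (real \<nu>) * b / 2) + (8 + 2 * B) * b"
      using K0 by (simp add: mult_left_mono)
    also have "\<dots> = 2 * B * b + K * c * sqrt \<bar>m\<bar> + (K * (sqrt (real \<nu>) * b / 2) + 8 * b)"
      by (simp add: algebra_simps)
    also have "\<dots> \<le> B * (30 * \<beta>) ^ d * fact d * sqrt \<tau> + K * c * sqrt \<bar>m\<bar> + K * c * E"
    proof (intro add_mono order_refl)
      have "2 * (4 * sqrt \<beta>) ^ d \<le> (30 * \<beta>) ^ d"
      proof -
        have "sqrt \<beta> \<le> \<beta>" using \<beta>1 by (intro real_le_lsqrt) (auto simp: power2_eq_square)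
        then have "(4 * sqrt \<beta>) ^ d \<le> (4 * \<beta>) ^ d" using \<beta>1 by (intro power_mono) auto
        moreover have "2 * (4 * \<beta>) ^ d \<le> 2 ^ d * (4 * \<beta>) ^ d"
          using \<beta>1 assms(9) power_increasing[of 1 d "2::real"] by (intro mult_right_mono) auto
        moreover have "2 ^ d * (4 * \<beta>) ^ d = (8 * \<beta>) ^ d" by (subst power_mult_distrib[symmetric]) simp
        moreover have "(8 * \<beta>) ^ d \<le> (30 * \<beta>) ^ d" using \<beta>1 by (intro power_mono) auto
        ultimately show ?thesis by linarith
      qed
      then have "B * (2 * (4 * sqrt \<beta>) ^ d) * (fact d * sqrt \<tau>) \<le> B * (30 * \<beta>) ^ d * (fact d * sqrt \<tau>)"
        using B0 \<tau>0 by (intro mult_right_mono mult_left_mono) auto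
      then show "2 * B * b \<le> B * (30 * \<beta>) ^ d * fact d * sqrt \<tau>" by (simp add: b_def mult_ac)
      show "K * (sqrt (real \<nu>) * b / 2) + 8 * b \<le> K * c * E"
        using const(1) True assms(8) by (simp add: K_def b_def mult_ac)
    qed
    finally show ?thesis by (simp add: distrib_left)
  qed
  show ?thesis
    using goal unfolding Z \<tau>_def K_def c_def m_def E_def .
qed

end
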